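(* There exist, for all triples $(n,\Phi,a)$ with $n\in\mathbb{N}^{*}$, $\Phi\in\mathbb{R}$, $a\in\mathbb{R}$ satisfying \[ \frac{4+\frac{\Phi}{\pi}}{1+a^{2}}\leq n^{2}\,, \tag{A} \] a $\frac{2\pi}{n}$-periodic function $\varphi=\varphi_{n,\Phi,a}:\mathbb{R}\to\mathbb{R}$ depending on $n$, $\Phi$ and $a$, and a real constant $C=C_{n,\Phi,a}$ with \[ (1+a^{2})\varphi''+4\varphi=\varphi^{2}-C \quad\text{on } \mathbb{R}, \] such that the following two assertions hold. (i) For every $(n,\Phi,a)$ satisfying (A) and every $\theta_{0}\in\mathbb{R}$, with $z=\theta_{0}+\theta+a\log r$, the velocity field \[ \boldsymbol{u}_{n,\Phi,a}=\frac{1}{r}\left[-\varphi(z)\,\boldsymbol{e}_{r}+a\left(\varphi(z)-4\right)\boldsymbol{e}_{\theta}\right] \] together with the pressure \[ p=\frac{1}{r^{2}}\left[a(1+a^{2})\varphi'(z)-\left(2(1+a^{2})-4a^{2}\right)\varphi(z)\right]-\frac{1}{2r^{2}}\left[16a^{2}+C(1+a^{2})\right] \] satisfies the Navier-Stokes equations \[ \Delta\boldsymbol{u}-\boldsymbol{\nabla}p=\boldsymbol{u}\cdot\boldsymbol{\nabla}\boldsymbol{u}\,,\qquad \boldsymbol{\nabla}\cdot\boldsymbol{u}=0\,,\qquad \lim_{|\boldsymbol{x}|\to\infty}\boldsymbol{u}=\boldsymbol{0} \tag{NS} \] in $\mathbb{R}^{2}\setminus\{\boldsymbol{0}\}$.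 Moreover, $\boldsymbol{u}_{n,\Phi,a}$ is scale-invariant up to a rotation (as defined in the context) with $R(\lambda)=-a\log\lambda$, and it has flux $\Phi$. (ii) Any solution $\boldsymbol{u}$ of (NS) in $\mathbb{R}^{2}\setminus\{\boldsymbol{0}\}$ which is scale-invariant up to a rotation for some continuously differentiable $R:(0,\infty)\to\mathbb{R}$ is equal either to one of the exact solutions $\boldsymbol{u}_{n,\Phi,a}$, for some $(n,\Phi,a)$ satisfying (A) and some angle $\theta_{0}\in\mathbb{R}$, or to a Hamel solution \[ \boldsymbol{u}_{\Phi,0}=\frac{\Phi}{2\pi r}\boldsymbol{e}_{r}+\frac{\mu}{r}\boldsymbol{e}_{\theta} \] for some $\Phi\in\mathbb{R}$ and $\mu\in\mathbb{R}$.
   Context: $\mathbb{N}^{*}=\{1,2,3,\dots\}$. $(r,\theta)$ are polar coordinates on $\mathbb{R}^{2}\setminus\{\boldsymbol{0}\}$, with unit vectors $\boldsymbol{e}_{r}=(\cos\theta,\sin\theta)$ and $\boldsymbol{e}_{\theta}=(-\sin\theta,\cos\theta)$; write $\boldsymbol{u}=u_{r}\boldsymbol{e}_{r}+u_{\theta}\boldsymbol{e}_{\theta}$. A $\frac{2\pi}{n}$-periodic function is one satisfying $\varphi(z+\frac{2\pi}{n})=\varphi(z)$ for all $z$. Solutions of (NS) are understood in the classical sense: a velocity field $\boldsymbol{u}:\mathbb{R}^{2}\setminus\{\boldsymbol{0}\}\to\mathbb{R}^{2}$ for which there is a (single-valued) pressure $p:\mathbb{R}^{2}\setminus\{\boldsymbol{0}\}\to\mathbb{R}$,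 both smooth, such that (NS) holds. The flux of a divergence-free field $\boldsymbol{u}$ on $\mathbb{R}^{2}\setminus\{\boldsymbol{0}\}$ is $\int_{\gamma}\boldsymbol{u}\cdot\boldsymbol{n}$, where $\gamma$ is any simple closed curve encircling the origin and $\boldsymbol{n}$ its outward unit normal; it does not depend on $\gamma$. A field $\boldsymbol{u}$ is scale-invariant up to a rotation, with continuously differentiable angle $R:(0,\infty)\to\mathbb{R}$, if \[ \lambda\boldsymbol{u}(\lambda\boldsymbol{x})=\mathbf{R}_{\lambda}^{-1}\boldsymbol{u}(\mathbf{R}_{\lambda}\boldsymbol{x})\qquad\text{for all }\lambda>0 \text{ and all } \boldsymbol{x}\in\mathbb{R}^{2}\setminus\{\boldsymbol{0}\}, \] where $\mathbf{R}_{\lambda}\in\mathrm{SO}(2)$ is the rotation of angle $R(\lambda)$, with the sign convention that $\mathbf{R}_{\lambda}$ maps the point with polar coordinates $(r,\theta)$ to the point $(r,\theta-R(\lambda))$. Equivalently, in polar coordinates, \[ \lambda u_{r}(\lambda r,\theta)=u_{r}(r,\theta-R(\lambda))\,,\qquad \lambda u_{\theta}(\lambda r,\theta)=u_{\theta}(r,\theta-R(\lambda))\,. \] *)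

theory Defs
  imports "HOL-Complex_Analysis.Complex_Analysis"
begin

text \<open>Frechet derivatives are only meaningful where they exist; the operators below are used together
  with \<open>smooth_on\<close> on an open set.\<close>

definition partial_deriv ::
    "'n::finite \<Rightarrow> (real^'n \<Rightarrow> 'b::real_normed_vector) \<Rightarrow> real^'n \<Rightarrow> 'b" where
  "partial_deriv i f x = frechet_derivative f (at x) (axis i 1)"

definition grad :: "(real^'n::finite \<Rightarrow> real) \<Rightarrow> real^'n \<Rightarrow> real^'n" where
  "grad p x = (\<chi> i. partial_deriv i p x)"

definition div_field :: "(real^'n::finite \<Rightarrow> real^'n) \<Rightarrow> real^'n \<Rightarrow> real" where
  "div_field u x = (\<Sum>i\<in>UNIV. partial_deriv i u x $ i)"

definition laplacian :: "(real^'n::finite \<Rightarrow> 'b::real_normed_vector) \<Rightarrow> real^'n \<Rightarrow> 'b" where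
  "laplacian f x = (\<Sum>i\<in>UNIV. partial_deriv i (partial_deriv i f) x)"

definition convective ::
    "(real^'n::finite \<Rightarrow> real^'n) \<Rightarrow> (real^'n \<Rightarrow> 'b::real_normed_vector) \<Rightarrow> real^'n \<Rightarrow> 'b" where
  "convective u v x = (\<Sum>j\<in>UNIV. (u x $ j) *\<^sub>R partial_deriv j v x)"

text \<open>\<open>C_k_on k f S\<close> is intended for open \<open>S\<close>.\<close>

primrec C_k_on ::
    "nat \<Rightarrow> ('a::real_normed_vector \<Rightarrow> 'b::real_normed_vector) \<Rightarrow> 'a set \<Rightarrow> bool" where
  "C_k_on 0 f S \<longleftrightarrow> continuous_on S f"
| "C_k_on (Suc k) f S \<longleftrightarrow> (\<forall>x\<in>S. f differentiable (at x)) \<and>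
     (\<forall>v. C_k_on k (\<lambda>x. frechet_derivative f (at x) v) S)"

definition smooth_on :: "('a::real_normed_vector \<Rightarrow> 'b::real_normed_vector) \<Rightarrow> 'a set \<Rightarrow> bool" where
  "smooth_on f S \<longleftrightarrow> (\<forall>k. C_k_on k f S)"

text \<open>Fields on the punctured plane are total functions whose value at the origin is irrelevant.\<close>

definition NS_with_pressure :: "(real^2 \<Rightarrow> real^2) \<Rightarrow> (real^2 \<Rightarrow> real) \<Rightarrow> bool" where
  "NS_with_pressure u p \<longleftrightarrow>
     smooth_on u (- {0}) \<and> smooth_on p (- {0}) \<and>
     (\<forall>x. x \<noteq> 0 \<longrightarrow> laplacian u x - grad p x = convective u u x) \<and>
     (\<forall>x. x \<noteq> 0 \<longrightarrow> div_field u x = 0) \<and>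
     (u \<longlongrightarrow> 0) at_infinity"

definition NS_solution :: "(real^2 \<Rightarrow> real^2) \<Rightarrow> bool" where
  "NS_solution u \<longleftrightarrow> (\<exists>p. NS_with_pressure u p)"

definition to_complex :: "real^2 \<Rightarrow> complex" where
  "to_complex x = Complex (x $ 1) (x $ 2)"

definition simple_loop_around_origin :: "(real \<Rightarrow> real^2) \<Rightarrow> bool" where
  "simple_loop_around_origin \<gamma> \<longleftrightarrow>
     simple_path \<gamma> \<and> pathfinish \<gamma> = pathstart \<gamma> \<and>
     \<gamma> piecewise_C1_differentiable_on {0..1} \<and>
     0 \<in> inside (path_image \<gamma>) \<and> winding_number (to_complex \<circ> \<gamma>) 0 = 1"

text \<open>The winding number fixes the counterclockwise orientation. For a counterclockwise simple loop
  the outward unit normal times arc length is \<open>(\<gamma>\<^sub>2', - \<gamma>\<^sub>1') dt\<close>. Independence of the loop is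
  expressed by requiring the same value on all of them.\<close>

definition has_flux :: "(real^2 \<Rightarrow> real^2) \<Rightarrow> real \<Rightarrow> bool" where
  "has_flux u \<Phi> \<longleftrightarrow> (\<forall>\<gamma>. simple_loop_around_origin \<gamma> \<longrightarrow>
     ((\<lambda>t. let v = vector_derivative \<gamma> (at t within {0..1})
            in u (\<gamma> t) \<bullet> vector [v $ 2, - (v $ 1)]) has_integral \<Phi>) {0..1})"

definition rot :: "real \<Rightarrow> real^2^2" where
  "rot \<alpha> = vector [vector [cos \<alpha>, - sin \<alpha>], vector [sin \<alpha>, cos \<alpha>]]"

text \<open>\<open>rot \<alpha>\<close> turns by \<open>\<alpha>\<close> counterclockwise. By convention the rotation of angle \<open>R s\<close> sends the polar
  angle \<open>\<theta>\<close> to \<open>\<theta> - R s\<close>, hence the sign below.\<close>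

definition scale_invariant_up_to_rotation :: "(real \<Rightarrow> real) \<Rightarrow> (real^2 \<Rightarrow> real^2) \<Rightarrow> bool" where
  "scale_invariant_up_to_rotation R u \<longleftrightarrow>
     R C1_differentiable_on {0<..} \<and>
     (\<forall>s>0. \<forall>x. x \<noteq> 0 \<longrightarrow>
        s *\<^sub>R u (s *\<^sub>R x) = matrix_inv (rot (- R s)) *v u (rot (- R s) *v x))"

definition polar_angle :: "real^2 \<Rightarrow> real" where
  "polar_angle x = Arg (to_complex x)"

definition e_r :: "real \<Rightarrow> real^2" where
  "e_r \<theta> = vector [cos \<theta>, sin \<theta>]"

definition e_theta :: "real \<Rightarrow> real^2" where
  "e_theta \<theta> = vector [- sin \<theta>, cos \<theta>]"

text \<open>The principal branch of the angle is harmless: the profiles \<open>\<phi>\<close> are \<open>2 * pi / n\<close>-periodic with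
  \<open>n \<ge> 1\<close>, so the fields below do not depend on the branch.\<close>

definition spiral_coord :: "real \<Rightarrow> real \<Rightarrow> real^2 \<Rightarrow> real" where
  "spiral_coord a \<theta>\<^sub>0 x = \<theta>\<^sub>0 + polar_angle x + a * ln (norm x)"

definition spiral_velocity :: "real \<Rightarrow> (real \<Rightarrow> real) \<Rightarrow> real \<Rightarrow> real^2 \<Rightarrow> real^2" where
  "spiral_velocity a \<phi> \<theta>\<^sub>0 x =
     (let r = norm x; \<theta> = polar_angle x; z = spiral_coord a \<theta>\<^sub>0 x
      in (1 / r) *\<^sub>R (- \<phi> z *\<^sub>R e_r \<theta> + (a * (\<phi> z - 4)) *\<^sub>R e_theta \<theta>))"

definition spiral_pressure :: "real \<Rightarrow> real \<Rightarrow> (real \<Rightarrow> real) \<Rightarrow> real \<Rightarrow> real^2 \<Rightarrow> real" where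
  "spiral_pressure a C \<phi> \<theta>\<^sub>0 x =
     (let r = norm x; z = spiral_coord a \<theta>\<^sub>0 x
      in 1 / r\<^sup>2 * (a * (1 + a\<^sup>2) * deriv \<phi> z - (2 * (1 + a\<^sup>2) - 4 * a\<^sup>2) * \<phi> z)
         - 1 / (2 * r\<^sup>2) * (16 * a\<^sup>2 + C * (1 + a\<^sup>2)))"

definition hamel_velocity :: "real \<Rightarrow> real \<Rightarrow> real^2 \<Rightarrow> real^2" where
  "hamel_velocity \<Phi> \<mu> x =
     (let r = norm x; \<theta> = polar_angle x
      in (\<Phi> / (2 * pi * r)) *\<^sub>R e_r \<theta> + (\<mu> / r) *\<^sub>R e_theta \<theta>)"

definition admissible :: "nat \<Rightarrow> real \<Rightarrow> real \<Rightarrow> bool" where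
  "admissible n \<Phi> a \<longleftrightarrow> n \<ge> 1 \<and> (4 + \<Phi> / pi) / (1 + a\<^sup>2) \<le> (real n)\<^sup>2"

definition profile_ode :: "real \<Rightarrow> real \<Rightarrow> (real \<Rightarrow> real) \<Rightarrow> bool" where
  "profile_ode a C \<phi> \<longleftrightarrow>
     (\<forall>z. \<phi> differentiable (at z) \<and> deriv \<phi> differentiable (at z) \<and>
          (1 + a\<^sup>2) * deriv (deriv \<phi>) z + 4 * \<phi> z = (\<phi> z)\<^sup>2 - C)"

end

theory Submission
  imports Defs "HOL-Library.Periodic_Fun"
begin

text \<open>Write a field as \<open>u = (f(z) e_r + g(z) e_\<theta>) / r\<close> with \<open>z = \<theta>\<^sub>0 + \<theta> + a log r\<close>. Every smooth
  field that is scale-invariant up to a rotation has this form: invariance yields the cocycle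
  identity \<open>f (\<theta> - R (s t)) = f (\<theta> - R s - R t)\<close> for its components on the unit circle, and
  differentiating it at \<open>t = 1\<close> shows that \<open>f\<close> and \<open>g\<close> cannot distinguish \<open>R s\<close> from
  \<open>R'(1) log s\<close> (\<open>spiral_from_rotation\<close>). For such fields the
  Navier-Stokes system is explicit (\<open>div_spiral_field\<close>, \<open>momentum_spiral_field\<close>): zero divergence
  means \<open>g = k - a f\<close>, and the existence of a single-valued pressure is equivalent to
  \<open>(1 + a\<^sup>2) f'' - (k + 4 a) f' + f\<^sup>2 + 4 f = const\<close> (\<open>spiral_NS_solution_ode\<close>). The first order term
  dissipates an energy, so a periodic \<open>f\<close> is either constant, which gives the Hamel fields, or
  \<open>k = - 4 a\<close> (\<open>periodic_dissipation\<close>), and then \<open>\<phi> = - f\<close> satisfies the profile equation.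

  After a shift and a rescaling the profile equation is \<open>y'' = y\<^sup>2 - K\<close>. Its nonconstant periodic
  solutions are the cnoidal waves: up to a translation, those whose period divides \<open>2 \<pi>\<close> are
  \<open>n\<^sup>2 y\<^sub>m (n x)\<close> for a natural number \<open>n \<ge> 1\<close> and an elliptic parameter \<open>m\<close> in \<open>(0, 1)\<close>, where
  \<open>y\<^sub>m\<close> is \<open>cnoidal m\<close> (\<open>periodic_solution_is_cnoidal\<close>). Only the mean value of \<open>y\<^sub>m\<close> is then left
  to be prescribed, because the flux is \<open>- 2 \<pi>\<close> times the mean of \<open>\<phi>\<close>. Everything rests on the fact
  that \<open>m \<mapsto> mean_value m\<close> is a strictly increasing bijection from \<open>[0, 1)\<close> onto \<open>[- 1/2, \<infinity>)\<close>
  (\<open>mean_value_strict_mono\<close>, \<open>mean_value_surj\<close>): the value \<open>- 1/2\<close> at \<open>m = 0\<close>, where the wave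
  degenerates to a constant, is exactly the equality case of the condition on \<open>(n, \<Phi>, a)\<close>;
  surjectivity gives a profile for every admissible triple, and injectivity shows that the chosen
  family exhausts all solutions.\<close>

section \<open>The mean value of a cnoidal wave as a function of the elliptic parameter\<close>

definition Delta :: "real \<Rightarrow> real \<Rightarrow> real" where
  "Delta m t = sqrt (1 - m * (sin t)\<^sup>2)"

text \<open>In terms of the complete elliptic integrals \<open>K\<close> and \<open>E\<close> with parameter \<open>m = k\<^sup>2\<close>, the two functions
  below are \<open>(2 / \<pi>) K\<close> and \<open>(2 / \<pi>) (2 (1 - m) K - 6 E)\<close>. The second combination is chosen
  because it is nondecreasing and recombines with the first into the mean value of a cnoidal wave.\<close>

definition kint :: "real \<Rightarrow> real" where
  "kint m = integral {0..pi} (\<lambda>t. 1 / Delta m t) / pi"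

definition lint :: "real \<Rightarrow> real" where
  "lint m = integral {0..pi} (\<lambda>t. (- 4 - 2 * m + 6 * m * (sin t)\<^sup>2) / Delta m t) / pi"

text \<open>The mean over a period of the wave \<open>cnoidal m\<close> below, in closed form; see
  \<open>cnoidal_antiderivative\<close>.\<close>

definition mean_value :: "real \<Rightarrow> real" where
  "mean_value m = kint m * (lint m + 2 * kint m) / 4"

lemma radicand_lower:
  fixes m t :: real
  assumes "0 \<le> m" shows "1 - m \<le> 1 - m * (sin t)\<^sup>2"
  using mult_left_mono[of "(sin t)\<^sup>2" 1 m] assms by (simp add: abs_square_le_1)

lemma radicand_pos:
  fixes m t :: real
  assumes "0 \<le> m" "m < 1" shows "0 < 1 - m * (sin t)\<^sup>2"
proof -
  have "0 < 1 - m" using assms by simp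
  also have "\<dots> \<le> 1 - m * (sin t)\<^sup>2" by (rule radicand_lower[OF assms(1)])
  finally show ?thesis .
qed

lemma radicand_neq: "(m::real) * (sin t)\<^sup>2 = 1 \<Longrightarrow> 0 \<le> m \<Longrightarrow> 1 \<le> m"
  using radicand_pos[of m t] by linarith

lemma Delta_pos:
  assumes "0 \<le> m" "m < 1" shows "0 < Delta m t"
  using radicand_pos[OF assms] by (simp add: Delta_def)

lemma Delta_sq:
  assumes "0 \<le> m" "m < 1" shows "(Delta m t)\<^sup>2 = 1 - m * (sin t)\<^sup>2"
  using radicand_pos[OF assms, of t] by (simp add: Delta_def)

lemma Delta_shift: "Delta m (t + pi) = Delta m t"
  by (simp add: Delta_def)

lemma continuous_Delta [continuous_intros]: "continuous_on S (Delta m)"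
  unfolding Delta_def by (intro continuous_intros)

lemma Delta_deriv:
  assumes "0 \<le> m" "m < 1"
  shows "(Delta m has_real_derivative - (m * sin t * cos t) / Delta m t) (at t)"
  using radicand_pos[OF assms, of t] unfolding Delta_def
  by (auto intro!: derivative_eq_intros simp: field_simps)

lemma Delta_deriv_parameter:
  assumes "0 \<le> m" "m < 1"
  shows "((\<lambda>m. Delta m t) has_real_derivative - (sin t)\<^sup>2 / (2 * Delta m t)) (at m within S)"
  using radicand_pos[OF assms, of t] unfolding Delta_def
  by (auto intro!: derivative_eq_intros simp: field_simps)

text \<open>Primitives on the whole line let periodic integrands be treated as increments \<open>G (t + p) - G t\<close>,
  with no orientation of the interval of integration to keep track of.\<close>

lemma antiderivative:
  fixes g :: "real \<Rightarrow> real"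
  assumes "continuous_on UNIV g"
  obtains G where "\<And>t. (G has_real_derivative g t) (at t)"
proof -
  have "\<exists>F. \<forall>x. -\<infinity> < ereal x \<longrightarrow> ereal x < \<infinity> \<longrightarrow> (F has_vector_derivative g x) (at x)"
    by (rule einterval_antiderivative)
      (use assms in \<open>auto simp: continuous_on_eq_continuous_at\<close>)
  then show thesis
    using that by (auto simp: has_real_derivative_iff_has_vector_derivative)
qed

lemma antiderivative_increment:
  fixes G g :: "real \<Rightarrow> real"
  assumes G: "\<And>t. (G has_real_derivative g t) (at t)" and "0 \<le> p"
    and per: "\<And>t. g (t + p) = g t"
  shows "G (t + p) = G t + integral {0..p} g"
proof -
  have d: "((\<lambda>t. G (t + p) - G t) has_real_derivative 0) (at t)" for t
    using DERIV_diff[OF DERIV_shift[THEN iffD1, OF G[of "t + p"]] G[of t]] per by simp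
  have "G (t + p) - G t = G (0 + p) - G 0"
    using DERIV_isconst_all[of "\<lambda>t. G (t + p) - G t"] d by blast
  moreover have "(g has_integral (G p - G 0)) {0..p}"
    by (rule fundamental_theorem_of_calculus)
      (use G \<open>0 \<le> p\<close> in \<open>auto simp: has_real_derivative_iff_has_vector_derivative[symmetric]
         intro: has_field_derivative_at_within\<close>)
  ultimately show ?thesis by (simp add: integral_unique)
qed

lemma Delta_integrable:
  assumes "0 \<le> m" "m < 1" "continuous_on {0..pi} g"
  shows "(\<lambda>t. g t / Delta m t) integrable_on {0..pi}"
  using Delta_pos[OF assms(1,2), THEN less_imp_neq]
  by (intro integrable_continuous_real continuous_intros assms(3)) metis

lemma kint_strict_mono:
  assumes "0 \<le> m" "m < m'" "m' < 1"
  shows "kint m < kint m'"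
proof -
  have "integral {0..pi} (\<lambda>t. 1 / Delta m t) < integral {0..pi} (\<lambda>t. 1 / Delta m' t)"
  proof (rule integral_less_real)
    show "continuous_on {0..pi} (\<lambda>t. 1 / Delta m t)" "continuous_on {0..pi} (\<lambda>t. 1 / Delta m' t)"
      using Delta_pos[of m] Delta_pos[of m'] assms
      by (auto intro!: continuous_intros simp: less_imp_neq[symmetric])
    show "{0<..<pi} \<noteq> {}" by (simp add: not_le)
    fix t assume t: "t \<in> {0<..<pi}"
    then have "0 < sin t" by (simp add: sin_gt_zero)
    then have "Delta m' t < Delta m t"
      using assms by (simp add: Delta_def)
    then show "1 / Delta m t < 1 / Delta m' t"
      using Delta_pos[of m' t] assms by (simp add: frac_less2)
  qed
  then show ?thesis by (simp add: kint_def divide_strict_right_mono)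
qed

lemma kint_0: "kint 0 = 1" by (simp add: kint_def Delta_def)
lemma lint_0: "lint 0 = - 4" by (simp add: lint_def Delta_def)

lemma continuous_kint: "continuous_on {0..b} kint" if "b < 1"
proof -
  have "continuous_on {0..b} (\<lambda>m. integral (cbox 0 pi) (\<lambda>t. 1 / Delta m t))"
  proof (rule integral_continuous_on_param)
    have "continuous_on ({0..b} \<times> cbox 0 pi) (\<lambda>z. 1 / Delta (fst z) (snd z))"
      using that unfolding Delta_def
      by (intro continuous_intros) (auto dest: radicand_neq)
    then show "continuous_on ({0..b} \<times> cbox 0 pi) (\<lambda>(m, t). 1 / Delta m t)"
      by (simp add: split_def)
  qed
  then show ?thesis unfolding kint_def by (intro continuous_intros) (auto simp: cbox_interval)
qed

text \<open>Differentiation under the integral sign gives an integrand \<open>h\<close> with a factor \<open>1 / \<Delta>\<^sup>3\<close> and no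
  definite sign. Subtracting the derivative of \<open>- sin cos / \<Delta>\<close>, which integrates to zero over
  \<open>[0, \<pi>]\<close>, leaves \<open>(2 sin\<^sup>2 - 1) / \<Delta>\<close>. Since \<open>1 / \<Delta>\<close> is largest where \<open>sin\<^sup>2\<close> is, this weights the positive
  part of \<open>2 sin\<^sup>2 - 1\<close>, which has mean zero, more than its negative part.\<close>

lemma lint_deriv_nonneg:
  assumes "m0 \<in> {0..b}" "b < 1"
  shows "\<exists>d\<ge>0. (lint has_real_derivative d) (at m0 within {0..b})"
proof -
  define h where "h = (\<lambda>m t. (- 2 + 6 * (sin t)\<^sup>2) / Delta m t
      + (- 2 - m + 3 * m * (sin t)\<^sup>2) * (sin t)\<^sup>2 / (Delta m t)^3)"
  have m0: "0 \<le> m0" "m0 < 1" using assms by auto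
  have *: "((\<lambda>m. integral (cbox 0 pi) (\<lambda>t. (- 4 - 2 * m + 6 * m * (sin t)\<^sup>2) / Delta m t))
     has_field_derivative integral (cbox 0 pi) (h m0)) (at m0 within {0..b})"
  proof (rule leibniz_rule_field_derivative)
    fix m t :: real assume "m \<in> {0..b}" "t \<in> cbox 0 pi"
    then have m: "0 \<le> m" "m < 1" using assms by auto
    show "((\<lambda>m. (- 4 - 2 * m + 6 * m * (sin t)\<^sup>2) / Delta m t) has_real_derivative h m t) (at m within {0..b})"
      unfolding h_def using Delta_pos[OF m, of t]
      by (auto intro!: derivative_eq_intros Delta_deriv_parameter m simp: field_simps power3_eq_cube)
  next
    fix m assume "m \<in> {0..b}"
    then show "(\<lambda>t. (- 4 - 2 * m + 6 * m * (sin t)\<^sup>2) / Delta m t) integrable_on cbox 0 pi"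
      unfolding cbox_interval using assms by (intro Delta_integrable continuous_intros) auto
  next
    have "continuous_on ({0..b} \<times> cbox 0 pi) (\<lambda>z. h (fst z) (snd z))"
      unfolding h_def Delta_def using assms
      by (intro continuous_intros) (auto dest: radicand_neq)
    then show "continuous_on ({0..b} \<times> cbox 0 pi) (\<lambda>(m, t). h m t)"
      by (simp add: split_def)
  qed (use assms in auto)
  have anti: "((\<lambda>t. - (sin t * cos t) / Delta m0 t) has_real_derivative
      h m0 t - (2 * (sin t)\<^sup>2 - 1) / Delta m0 t) (at t within S)" for t S
  proof -
    let ?d = "Delta m0 t"
    have p: "?d > 0" by (rule Delta_pos[OF m0])
    have e1: "m0 * (sin t)\<^sup>2 = 1 - ?d\<^sup>2" using Delta_sq[OF m0, of t] by simp
    have e2: "(cos t)\<^sup>2 = 1 - (sin t)\<^sup>2" by (simp add: cos_squared_eq)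
    have "((\<lambda>t. - (sin t * cos t) / Delta m0 t) has_real_derivative
        (- (cos t * cos t - sin t * sin t) * ?d - (sin t * cos t) * (m0 * sin t * cos t) / ?d) / ?d\<^sup>2)
        (at t within S)"
      using p by (auto intro!: derivative_eq_intros Delta_deriv[OF m0, THEN has_field_derivative_at_within]
          simp: field_simps power2_eq_square)
    moreover have "(- (cos t * cos t - sin t * sin t) * ?d - (sin t * cos t) * (m0 * sin t * cos t) / ?d) / ?d\<^sup>2
       = (- (1 - 2 * (sin t)\<^sup>2) * ?d\<^sup>2 - (1 - ?d\<^sup>2) * (1 - (sin t)\<^sup>2)) / ?d^3"
      using p by (simp add: field_simps power2_eq_square power3_eq_cube e1[symmetric] e2[symmetric])
        (use e1 e2 in algebra)
    moreover have "h m0 t - (2 * (sin t)\<^sup>2 - 1) / Delta m0 t = 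
        ((- 1 + 4 * (sin t)\<^sup>2) * ?d\<^sup>2 + (- 2 * (sin t)\<^sup>2 - (1 - ?d\<^sup>2) + 3 * (1 - ?d\<^sup>2) * (sin t)\<^sup>2)) / ?d^3"
      using p e1 unfolding h_def by (simp add: field_simps power2_eq_square power3_eq_cube)
        algebra
    ultimately show ?thesis 
      by (simp add: algebra_simps)
  qed
  have "((\<lambda>t. h m0 t - (2 * (sin t)\<^sup>2 - 1) / Delta m0 t) has_integral
      (- (sin pi * cos pi) / Delta m0 pi - (- (sin 0 * cos 0) / Delta m0 0))) {0..pi}"
    by (rule fundamental_theorem_of_calculus)
      (use anti in \<open>auto simp: has_real_derivative_iff_has_vector_derivative[symmetric]\<close>)
  then have i1: "((\<lambda>t. h m0 t - (2 * (sin t)\<^sup>2 - 1) / Delta m0 t) has_integral 0) {0..pi}" by simp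
  have i2: "((\<lambda>t. (2 * (sin t)\<^sup>2 - 1) / sqrt (1 - m0 / 2)) has_integral
      (- (sin pi * cos pi) / sqrt (1 - m0 / 2) - (- (sin 0 * cos 0) / sqrt (1 - m0 / 2)))) {0..pi}"
  proof (rule fundamental_theorem_of_calculus)
    fix t assume "t \<in> {0..pi}"
    have "((\<lambda>t. - (sin t * cos t)) has_real_derivative 2 * (sin t)\<^sup>2 - 1) (at t within {0..pi})"
      by (auto intro!: derivative_eq_intros simp: power2_eq_square[symmetric] cos_squared_eq)
    from DERIV_cdivide[OF this]
    show "((\<lambda>t. - (sin t * cos t) / sqrt (1 - m0 / 2)) has_vector_derivative
       (2 * (sin t)\<^sup>2 - 1) / sqrt (1 - m0 / 2)) (at t within {0..pi})"
      by (simp add: has_real_derivative_iff_has_vector_derivative)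
  qed simp
  \<comment> \<open>The weight is compared with its value at \<open>sin\<^sup>2 t = 1/2\<close>, where \<open>2 sin\<^sup>2 t - 1\<close> changes sign.\<close>
  have ge: "(2 * (sin t)\<^sup>2 - 1) / sqrt (1 - m0 / 2) \<le> (2 * (sin t)\<^sup>2 - 1) / Delta m0 t" for t
  proof (cases "2 * (sin t)\<^sup>2 \<le> 1")
    case True
    then have "m0 * (sin t)\<^sup>2 \<le> m0 * (1/2)" using m0 by (intro mult_left_mono) auto
    then have "sqrt (1 - m0 / 2) \<le> Delta m0 t" unfolding Delta_def by simp
    then show ?thesis using True m0 Delta_pos[OF m0, of t] by (intro divide_left_mono_neg mult_pos_pos) auto
  next
    case False
    then have "m0 * (1/2) \<le> m0 * (sin t)\<^sup>2" using m0 by (intro mult_left_mono) auto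
    then have "Delta m0 t \<le> sqrt (1 - m0 / 2)" unfolding Delta_def by simp
    then show ?thesis using False m0 Delta_pos[OF m0, of t] by (intro divide_left_mono) auto
  qed
  have i3: "(\<lambda>t. (2 * (sin t)\<^sup>2 - 1) / Delta m0 t) integrable_on {0..pi}"
    by (intro Delta_integrable m0 continuous_intros)
  have "integral {0..pi} (h m0) = integral {0..pi} (\<lambda>t. (2 * (sin t)\<^sup>2 - 1) / Delta m0 t)"
    using has_integral_add[OF i1 integrable_integral[OF i3]] by (simp add: integral_unique)
  moreover have "0 \<le> integral {0..pi} (\<lambda>t. (2 * (sin t)\<^sup>2 - 1) / Delta m0 t)"
    using has_integral_le[OF i2 integrable_integral[OF i3] ge] by simp
  ultimately have "0 \<le> integral (cbox 0 pi) (h m0)" by (simp add: cbox_interval)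
  moreover have "(lint has_real_derivative integral (cbox 0 pi) (h m0) / pi) (at m0 within {0..b})"
    using DERIV_cdivide[OF *, of pi] unfolding lint_def cbox_interval .
  ultimately show ?thesis by (meson divide_nonneg_pos pi_gt_zero)
qed

lemma lint_mono:
  assumes "0 \<le> m" "m \<le> m'" "m' < 1"
  shows "lint m \<le> lint m'"
proof (rule DERIV_nonneg_imp_increasing_open[OF \<open>m \<le> m'\<close>])
  have "\<forall>x\<in>{0..m'}. lint differentiable (at x within {0..m'})"
    using lint_deriv_nonneg[OF _ assms(3)] real_differentiable_def by blast
  then show "continuous_on {m..m'} lint"
    using assms(1) differentiable_imp_continuous_on[of lint "{0..m'}"]
    by (auto simp: differentiable_on_def intro: continuous_on_subset)
  fix x assume "m < x" "x < m'"
  then show "\<exists>y. (lint has_real_derivative y) (at x) \<and> 0 \<le> y"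
    using lint_deriv_nonneg[of x m'] assms at_within_Icc_at[of 0 x m'] by auto
qed

lemma continuous_lint: "continuous_on {0..b} lint" if "b < 1"
  using lint_deriv_nonneg[OF _ that] real_differentiable_def
  by (intro differentiable_imp_continuous_on) (auto simp: differentiable_on_def, blast)

lemma kint_ge_1: assumes "0 \<le> m" "m < 1" shows "1 \<le> kint m"
  using kint_strict_mono[of 0 m] assms kint_0 by (cases "m = 0") auto

lemma lint_ge: assumes "0 \<le> m" "m < 1" shows "- 4 \<le> lint m"
  using lint_mono[of 0 m] assms lint_0 by auto

text \<open>Around \<open>m = 0\<close> the product \<open>kint m * lint m\<close> is not visibly monotone, since \<open>lint\<close> is negative there.
  Expanding around the values \<open>kint 0 = 1\<close> and \<open>lint 0 = - 4\<close> makes the terms linear in \<open>kint m - 1\<close>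
  cancel, and what remains is built from nonnegative nondecreasing quantities by sums and products.\<close>

lemma mean_value_eq:
  "4 * mean_value m = - 2 + (lint m + 4) + (kint m - 1) * (lint m + 4) + 2 * (kint m - 1)\<^sup>2"
  unfolding mean_value_def by (simp add: algebra_simps power2_eq_square)

lemma mean_value_strict_mono:
  assumes "0 \<le> m" "m < m'" "m' < 1"
  shows "mean_value m < mean_value m'"
proof -
  have k: "0 \<le> kint m - 1" "kint m - 1 < kint m' - 1"
    using kint_strict_mono[OF assms] kint_ge_1[of m] assms by auto
  have l: "0 \<le> lint m + 4" "lint m + 4 \<le> lint m' + 4"
    using lint_mono[of m m'] lint_ge[of m] assms by auto
  have "(kint m - 1) * (lint m + 4) \<le> (kint m' - 1) * (lint m' + 4)"
    using k l by (intro mult_mono) auto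
  moreover have "(kint m - 1)\<^sup>2 < (kint m' - 1)\<^sup>2"
    using k by (intro power_strict_mono) auto
  ultimately have "4 * mean_value m < 4 * mean_value m'"
    unfolding mean_value_eq using l by linarith
  then show ?thesis by simp
qed

lemma mean_value_0: "mean_value 0 = - 1/2"
  by (simp add: mean_value_def kint_0 lint_0)

text \<open>The integral diverges logarithmically as \<open>m \<rightarrow> 1\<close>: near \<open>\<pi> / 2\<close> the bound
  \<open>\<Delta> \<le> e + (\<pi> / 2 - t)\<close> with \<open>e = sqrt (1 - m)\<close> holds, and \<open>1 / (e + s)\<close> integrates to \<open>log ((e + \<pi> / 2) / e)\<close>.\<close>

lemma kint_unbounded: "\<exists>m. 0 \<le> m \<and> m < 1 \<and> B \<le> kint m"
proof -
  \<comment> \<open>This makes \<open>log ((e + \<pi> / 2) / e)\<close> at least \<open>\<pi> \<bar>B\<bar>\<close>; the cap \<open>1/2\<close> keeps \<open>1 - e\<^sup>2\<close> in the range.\<close>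
  define e where "e = min (1/2) (pi / (2 * exp (pi * \<bar>B\<bar>)))"
  have e: "0 < e" "e \<le> 1/2" by (auto simp: e_def)
  define m where "m = 1 - e\<^sup>2"
  have "e\<^sup>2 \<le> 1\<^sup>2" using e by (intro power_mono) auto
  then have m: "0 \<le> m" "m < 1" using e by (auto simp: m_def)
  have D: "Delta m t \<le> e + (pi / 2 - t)" if "t \<in> {0..pi/2}" for t
  proof -
    have c0: "0 \<le> cos t" using that by (intro cos_ge_zero) auto
    have "cos t = sin (pi / 2 - t)" by (simp add: sin_diff)
    also have "\<dots> \<le> pi / 2 - t" using that by (intro sin_x_le_x) auto
    finally have c: "cos t \<le> pi / 2 - t" .
    have "1 - m * (sin t)\<^sup>2 = (cos t)\<^sup>2 + e\<^sup>2 * (sin t)\<^sup>2"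
      unfolding m_def by (simp add: algebra_simps cos_squared_eq)
    also have "\<dots> \<le> (cos t)\<^sup>2 + e\<^sup>2 * 1"
      by (intro add_left_mono mult_left_mono) (auto simp: abs_square_le_1)
    also have "\<dots> \<le> (e + cos t)\<^sup>2" using c0 e by (simp add: power2_sum)
    finally have "Delta m t \<le> e + cos t"
      unfolding Delta_def using c0 e by (intro real_le_lsqrt) auto
    then show ?thesis using c by linarith
  qed
  have i1: "((\<lambda>t. 1 / (e + (pi / 2 - t))) has_integral
     (- ln (e + (pi / 2 - pi / 2)) - (- ln (e + (pi / 2 - 0))))) {0..pi/2}"
    by (rule fundamental_theorem_of_calculus)
      (use e in \<open>auto simp: has_real_derivative_iff_has_vector_derivative[symmetric]
        intro!: derivative_eq_intros\<close>)
  have i: "(\<lambda>t. 1 / Delta m t) integrable_on {0..pi}"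
    by (intro Delta_integrable m continuous_intros)
  have i2: "(\<lambda>t. 1 / Delta m t) integrable_on {0..pi/2}"
    by (rule integrable_on_subinterval[OF i]) auto
  have "- ln e + ln (e + pi / 2) \<le> integral {0..pi/2} (\<lambda>t. 1 / Delta m t)"
    using has_integral_le[OF i1 integrable_integral[OF i2]] D Delta_pos[OF m] e
    by (simp add: frac_le)
  also have "\<dots> \<le> integral {0..pi} (\<lambda>t. 1 / Delta m t)"
    by (rule integral_subset_le) (use i i2 Delta_pos[OF m] in \<open>auto simp: less_imp_le\<close>)
  finally have "- ln e + ln (e + pi / 2) \<le> pi * kint m" by (simp add: kint_def)
  moreover have "pi * \<bar>B\<bar> \<le> - ln e + ln (e + pi / 2)"
  proof -
    have "exp (pi * \<bar>B\<bar>) * e \<le> pi / 2" 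
    proof -
      have "e \<le> pi / (2 * exp (pi * \<bar>B\<bar>))" by (simp add: e_def)
      then show ?thesis by (simp add: field_simps)
    qed
    then have "exp (pi * \<bar>B\<bar>) \<le> (e + pi / 2) / e" using e by (simp add: field_simps)
    then have "pi * \<bar>B\<bar> \<le> ln ((e + pi / 2) / e)"
      using e pi_gt_zero by (subst ln_ge_iff) (auto intro!: divide_pos_pos add_pos_pos)
    moreover have "ln ((e + pi / 2) / e) = ln (e + pi / 2) - ln e"
      using e pi_gt_zero by (intro ln_divide_pos add_pos_pos) auto
    ultimately show ?thesis by linarith
  qed
  ultimately have "pi * \<bar>B\<bar> \<le> pi * kint m" by linarith
  then have "B \<le> kint m" by (simp)
  then show ?thesis using m by blast
qed

lemma mean_value_surj:
  assumes "- 1/2 \<le> v"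
  obtains m where "0 \<le> m" "m < 1" "mean_value m = v"
proof -
  obtain b where b: "0 \<le> b" "b < 1" "2 + \<bar>2 * v\<bar> \<le> kint b"
    using kint_unbounded by blast
  have "0 \<le> (kint b - 1) * (lint b + 4)"
    using kint_ge_1[of b] lint_ge[of b] b by (intro mult_nonneg_nonneg) auto
  moreover have "(1 + \<bar>2 * v\<bar>)\<^sup>2 \<le> (kint b - 1)\<^sup>2" using b by (intro power_mono) auto
  moreover have "1 + \<bar>4 * v\<bar> \<le> (1 + \<bar>2 * v\<bar>)\<^sup>2" by (simp add: power2_sum abs_mult)
  ultimately have "4 * v \<le> 4 * mean_value b" unfolding mean_value_eq using lint_ge[of b] b by linarith
  moreover have "continuous_on {0..b} mean_value"
    unfolding mean_value_def by (intro continuous_intros continuous_kint continuous_lint b) simp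
  ultimately show thesis
    using IVT'[of mean_value 0 v b] mean_value_0 assms b that by force
qed

section \<open>Cnoidal waves\<close>

text \<open>The Jacobi amplitude solves \<open>\<tau>' = \<Delta> \<circ> \<tau>\<close>. It is obtained without any existence theorem for
  differential equations, as the inverse of the primitive \<open>F\<close> of \<open>1 / \<Delta>\<close>, which is a bijection of the
  line because \<open>F' \<ge> 1\<close>.\<close>

lemma amplitude_exists:
  assumes m: "0 \<le> m" "m < 1"
  shows "\<exists>\<tau>. \<tau> 0 = 0 \<and> (\<forall>x. (\<tau> has_real_derivative Delta m (\<tau> x)) (at x)) \<and>
     (\<forall>x. \<tau> (x + pi * kint m) = \<tau> x + pi)"
proof -
  have c: "continuous_on UNIV (\<lambda>t. 1 / Delta m t)"
    by (intro continuous_intros) (simp add: Delta_pos[OF m] less_imp_neq[symmetric])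
  obtain F0 where F0: "\<And>t. (F0 has_real_derivative 1 / Delta m t) (at t)"
    using antiderivative[OF c] by blast
  define F where "F = (\<lambda>t. F0 t - F0 0)"
  have F: "(F has_real_derivative 1 / Delta m t) (at t)" for t
    unfolding F_def using DERIV_diff[OF F0[of t] DERIV_const[of "F0 0"]] by simp
  have F_shift: "F (t + pi) = F t + pi * kint m" for t
    using antiderivative_increment[OF F, of pi] by (simp add: Delta_shift kint_def)
  have one_le: "1 \<le> 1 / Delta m t" for t
    using Delta_pos[OF m, of t] m by (simp add: Delta_def)
  have growth: "t - s \<le> F t - F s" if "s \<le> t" for s t
  proof -
    have "F s - s \<le> F t - t"
    proof (rule DERIV_nonneg_imp_nondecreasing[OF that])
      fix x
      show "\<exists>d. ((\<lambda>x. F x - x) has_real_derivative d) (at x) \<and> 0 \<le> d"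
        using DERIV_diff[OF F[of x] DERIV_ident] one_le[of x] by (intro exI conjI) auto
    qed
    then show ?thesis by simp
  qed
  have cF: "continuous_on UNIV F"
    using F by (intro continuous_at_imp_continuous_on) (auto intro: DERIV_isCont)
  have F_0: "F 0 = 0" by (simp add: F_def)
  have surj: "\<exists>t. F t = x" for x
  proof (cases "0 \<le> x")
    case True
    then have "\<exists>t\<ge>0. t \<le> x \<and> F t = x"
      using growth[of 0 x] F_0 by (intro IVT' continuous_on_subset[OF cF]) auto
    then show ?thesis by blast
  next
    case False
    then have "\<exists>t\<ge>x. t \<le> 0 \<and> F t = x"
      using growth[of x 0] F_0 by (intro IVT' continuous_on_subset[OF cF]) auto
    then show ?thesis by blast
  qed
  have inj: "s = t" if "F s = F t" for s t
    using growth[of s t] growth[of t s] that by linarith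
  define \<tau> where "\<tau> = inv F"
  have F\<tau>: "F (\<tau> x) = x" for x
  proof -
    have "x \<in> range F" using surj[of x] by blast
    then show ?thesis unfolding \<tau>_def by (rule f_inv_into_f)
  qed
  have \<tau>F: "\<tau> (F t) = t" for t by (rule inj) (rule F\<tau>)
  have lip: "\<bar>\<tau> x - \<tau> y\<bar> \<le> \<bar>x - y\<bar>" for x y
    using growth[of "\<tau> x" "\<tau> y"] growth[of "\<tau> y" "\<tau> x"] F\<tau>[of x] F\<tau>[of y] by linarith
  have cont: "isCont \<tau> x" for x
    unfolding isCont_def
  proof (rule LIM_I)
    fix r :: real assume "0 < r"
    show "\<exists>s>0. \<forall>y. y \<noteq> x \<and> norm (y - x) < s \<longrightarrow> norm (\<tau> y - \<tau> x) < r"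
    proof (intro exI[of _ r] conjI allI impI)
      fix y assume "y \<noteq> x \<and> norm (y - x) < r"
      then show "norm (\<tau> y - \<tau> x) < r" using lip[of y x] by simp
    qed (rule \<open>0 < r\<close>)
  qed
  have d: "(\<tau> has_real_derivative inverse (1 / Delta m (\<tau> x))) (at x)" for x
  proof (rule DERIV_inverse_function[where f = F and a = "x - 1" and b = "x + 1", OF F])
    show "1 / Delta m (\<tau> x) \<noteq> 0" using Delta_pos[OF m, of "\<tau> x"] by simp
  qed (simp_all add: F\<tau> cont)
  have "\<tau> (x + pi * kint m) = \<tau> x + pi" for x
    using F_shift[of "\<tau> x"] F\<tau>[of x] \<tau>F[of "\<tau> x + pi"] by simp
  moreover have "\<tau> 0 = 0" using \<tau>F[of 0] F_0 by simp
  ultimately show ?thesis using d by (intro exI[of _ \<tau>]) simp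
qed

definition amp :: "real \<Rightarrow> real \<Rightarrow> real" where
  "amp m = (SOME \<tau>. \<tau> 0 = 0 \<and> (\<forall>x. (\<tau> has_real_derivative Delta m (\<tau> x)) (at x)) \<and>
     (\<forall>x. \<tau> (x + pi * kint m) = \<tau> x + pi))"

lemma amp:
  assumes "0 \<le> m" "m < 1"
  shows amp_0: "amp m 0 = 0"
    and amp_deriv: "(amp m has_real_derivative Delta m (amp m x)) (at x)"
    and amp_shift: "amp m (x + pi * kint m) = amp m x + pi"
  using someI_ex[OF amplitude_exists[OF assms]] unfolding amp_def by blast+

lemma amp_strict_mono:
  assumes "0 \<le> m" "m < 1" "x < y" shows "amp m x < amp m y"
  using DERIV_pos_imp_increasing[OF assms(3)] amp_deriv[OF assms(1,2)] Delta_pos[OF assms(1,2)] by blast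

lemma amp_shift_int:
  assumes m: "0 \<le> m" "m < 1"
  shows "amp m (of_int j * (pi * kint m)) = of_int j * pi"
proof -
  have n: "amp m (x + of_nat i * (pi * kint m)) = amp m x + of_nat i * pi" for i x
  proof (induction i)
    case (Suc i)
    then show ?case
      using amp_shift[OF m, of "x + of_nat i * (pi * kint m)"] by (simp add: algebra_simps)
  qed simp
  show ?thesis
  proof (cases j)
    case (nonneg i)
    then show ?thesis using n[of 0 i] amp_0[OF m] by simp
  next
    case (neg i)
    then have j: "of_int j = - real (Suc i)" by simp
    show ?thesis
      using n[of "of_int j * (pi * kint m)" "Suc i"] amp_0[OF m] unfolding j
      by (simp add: distrib_right[symmetric] del: of_nat_Suc)
  qed
qed

text \<open>Writing a wave between \<open>e3\<close> and \<open>e2\<close> as \<open>e3 + (e2 - e3) sin\<^sup>2 (amp m x)\<close> turns the first integral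
  \<open>3 y'\<^sup>2 = 2 (y - e1) (y - e2) (y - e3)\<close> of \<open>y'' = y\<^sup>2 - K\<close> into the amplitude equation. The constants
  here are those of speed one, that is \<open>e1 - e3 = 6\<close>, and the condition \<open>e1 + e2 + e3 = 0\<close> that the
  equation imposes.\<close>

definition cnoidal0 :: "real \<Rightarrow> real \<Rightarrow> real" where
  "cnoidal0 m x = - 2 * (1 + m) + 6 * m * (sin (amp m x))\<^sup>2"

definition cnoidal0' :: "real \<Rightarrow> real \<Rightarrow> real" where
  "cnoidal0' m x = 12 * m * sin (amp m x) * cos (amp m x) * Delta m (amp m x)"

lemma cnoidal0_deriv:
  assumes m: "0 \<le> m" "m < 1"
  shows "(cnoidal0 m has_real_derivative cnoidal0' m x) (at x)"
  unfolding cnoidal0_def cnoidal0'_def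
  by (auto intro!: derivative_eq_intros amp_deriv[OF m])

lemma cnoidal0'_deriv:
  assumes m: "0 \<le> m" "m < 1"
  shows "(cnoidal0' m has_real_derivative (cnoidal0 m x)\<^sup>2 - 4 * (m\<^sup>2 - m + 1)) (at x)"
proof -
  let ?t = "amp m x"
  let ?d = "Delta m ?t"
  have p: "?d \<noteq> 0" using Delta_pos[OF m, of ?t] by simp
  have e1: "?d\<^sup>2 = 1 - m * (sin ?t)\<^sup>2" by (rule Delta_sq[OF m])
  have e2: "(cos ?t)\<^sup>2 = 1 - (sin ?t)\<^sup>2" by (simp add: cos_squared_eq)
  have dd: "((\<lambda>x. Delta m (amp m x)) has_real_derivative - (m * sin ?t * cos ?t)) (at x)"
    by (rule DERIV_cong[OF DERIV_chain2[OF Delta_deriv[OF m] amp_deriv[OF m]]]) (simp add: p)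
  have "(cnoidal0' m has_real_derivative
     12 * m * ((cos ?t * cos ?t - sin ?t * sin ?t) * ?d\<^sup>2 - m * (sin ?t)\<^sup>2 * (cos ?t)\<^sup>2)) (at x)"
    unfolding cnoidal0'_def
    by (auto intro!: derivative_eq_intros amp_deriv[OF m] dd simp: algebra_simps power2_eq_square)
  moreover have "12 * m * ((cos ?t * cos ?t - sin ?t * sin ?t) * ?d\<^sup>2 - m * (sin ?t)\<^sup>2 * (cos ?t)\<^sup>2)
      = (cnoidal0 m x)\<^sup>2 - 4 * (m\<^sup>2 - m + 1)"
    unfolding cnoidal0_def using e1 e2 by algebra
  ultimately show ?thesis by simp
qed

lemma cnoidal0_shift:
  assumes "0 \<le> m" "m < 1"
  shows "cnoidal0 m (x + pi * kint m) = cnoidal0 m x"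
  by (simp add: cnoidal0_def amp_shift[OF assms])

text \<open>A period carries the minimum at \<open>0\<close> to another minimum, hence to a zero of \<open>sin \<circ> amp m\<close>. This is what
  produces the integer \<open>n\<close> of the classification.\<close>

lemma cnoidal0_period:
  assumes m: "0 < m" "m < 1" and "0 < P" and "cnoidal0 m P = cnoidal0 m 0"
  obtains n where "n \<ge> 1" "P = of_nat n * (pi * kint m)"
proof -
  have m': "0 \<le> m" using m by simp
  have "sin (amp m P) = 0" using assms amp_0[OF m' m(2)] by (simp add: cnoidal0_def)
  then obtain j :: int where j: "amp m P = of_int j * pi" using sin_zero_iff_int2 by auto
  have "amp m P = amp m (of_int j * (pi * kint m))" using j amp_shift_int[OF m' m(2)] by simp
  then have P: "P = of_int j * (pi * kint m)"
    using amp_strict_mono[OF m' m(2)] by (metis linorder_neq_iff)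
  have "0 < amp m P" using amp_strict_mono[OF m' m(2) \<open>0 < P\<close>] amp_0[OF m' m(2)] by simp
  then have "0 < j" using j by (simp add: zero_less_mult_iff)
  then show thesis using that[of "nat j"] P by auto
qed

text \<open>Along the amplitude, \<open>dx = dt / \<Delta>\<close>, so a primitive of the wave is \<open>G \<circ> amp m\<close> for a primitive
  \<open>G\<close> of the wave over \<open>\<Delta>\<close> in the variable \<open>t\<close>.\<close>

lemma cnoidal0_antiderivative:
  assumes m: "0 \<le> m" "m < 1"
  shows "\<exists>Q. (\<forall>x. (Q has_real_derivative cnoidal0 m x) (at x)) \<and>
    (\<forall>x. Q (x + pi * kint m) = Q x + pi * (lint m + 2 * kint m))"
proof -
  define g where "g = (\<lambda>t. (- 2 * (1 + m) + 6 * m * (sin t)\<^sup>2) / Delta m t)"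
  have "continuous_on UNIV g"
    unfolding g_def using Delta_pos[OF m, THEN less_imp_neq] by (intro continuous_intros) metis
  then obtain G where G: "\<And>t. (G has_real_derivative g t) (at t)" using antiderivative by blast
  have "integral {0..pi} g = integral {0..pi} (\<lambda>t. (- 4 - 2 * m + 6 * m * (sin t)\<^sup>2) / Delta m t + 2 * (1 / Delta m t))"
    unfolding g_def by (simp add: add_divide_distrib diff_divide_distrib algebra_simps)
  also have "\<dots> = integral {0..pi} (\<lambda>t. (- 4 - 2 * m + 6 * m * (sin t)\<^sup>2) / Delta m t)
      + 2 * integral {0..pi} (\<lambda>t. 1 / Delta m t)"
    by (intro integral_unique has_integral_add has_integral_mult_right integrable_integral
        Delta_integrable m continuous_intros)
  also have "\<dots> = pi * (lint m + 2 * kint m)"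
    unfolding lint_def kint_def by (simp add: field_simps)
  finally have i: "integral {0..pi} g = pi * (lint m + 2 * kint m)" .
  have "g (t + pi) = g t" for t by (simp add: g_def Delta_shift)
  then have "G (t + pi) = G t + pi * (lint m + 2 * kint m)" for t
    using antiderivative_increment[OF G, of pi] i by simp
  moreover have "((\<lambda>x. G (amp m x)) has_real_derivative cnoidal0 m x) (at x)" for x
    using Delta_pos[OF m, of "amp m x"]
    by (intro DERIV_cong[OF DERIV_chain2[OF G amp_deriv[OF m]]]) (simp add: g_def cnoidal0_def)
  ultimately show ?thesis
    by (intro exI[of _ "\<lambda>x. G (amp m x)"]) (simp add: amp_shift[OF m])
qed

text \<open>The scaling \<open>y \<mapsto> c\<^sup>2 y (c x)\<close> preserves the form of \<open>y'' = y\<^sup>2 - K\<close>; with \<open>c = kint m / 2\<close> it brings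
  the period \<open>\<pi> kint m\<close> to \<open>2 \<pi>\<close>.\<close>

definition cnoidal :: "real \<Rightarrow> real \<Rightarrow> real" where
  "cnoidal m x = (kint m / 2)\<^sup>2 * cnoidal0 m (kint m / 2 * x)"

definition cnoidal' :: "real \<Rightarrow> real \<Rightarrow> real" where
  "cnoidal' m x = (kint m / 2)^3 * cnoidal0' m (kint m / 2 * x)"

definition cnoidal_const :: "real \<Rightarrow> real" where
  "cnoidal_const m = (kint m / 2)^4 * (4 * (m\<^sup>2 - m + 1))"

lemma cnoidal_deriv:
  assumes m: "0 \<le> m" "m < 1"
  shows "(cnoidal m has_real_derivative cnoidal' m x) (at x)"
  unfolding cnoidal_def cnoidal'_def
  by (rule derivative_eq_intros DERIV_chain2[OF cnoidal0_deriv[OF m]] refl)+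
    (simp add: power2_eq_square power3_eq_cube)

lemma cnoidal'_deriv:
  assumes m: "0 \<le> m" "m < 1"
  shows "(cnoidal' m has_real_derivative (cnoidal m x)\<^sup>2 - cnoidal_const m) (at x)"
  unfolding cnoidal_def cnoidal'_def cnoidal_const_def
  by (rule derivative_eq_intros DERIV_chain2[OF cnoidal0'_deriv[OF m]] refl)+
    (simp add: power2_eq_square power3_eq_cube power4_eq_xxxx algebra_simps)

lemma cnoidal_shift:
  assumes m: "0 \<le> m" "m < 1"
  shows "cnoidal m (x + 2 * pi) = cnoidal m x"
  using cnoidal0_shift[OF m, of "kint m / 2 * x"] by (simp add: cnoidal_def algebra_simps)

lemma cnoidal_antiderivative:
  assumes m: "0 \<le> m" "m < 1"
  shows "\<exists>Q. (\<forall>x. (Q has_real_derivative cnoidal m x) (at x)) \<and>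
    (\<forall>x. Q (x + 2 * pi) = Q x + 2 * pi * mean_value m)"
proof -
  obtain Q where Q: "\<And>x. (Q has_real_derivative cnoidal0 m x) (at x)"
    "\<And>x. Q (x + pi * kint m) = Q x + pi * (lint m + 2 * kint m)"
    using cnoidal0_antiderivative[OF m] by blast
  let ?Q = "\<lambda>x. kint m / 2 * Q (kint m / 2 * x)"
  have "(?Q has_real_derivative cnoidal m x) (at x)" for x
    unfolding cnoidal_def
    by (rule derivative_eq_intros DERIV_chain2[OF Q(1)] refl)+ (simp add: power2_eq_square)
  moreover have "?Q (x + 2 * pi) = ?Q x + 2 * pi * mean_value m" for x
    using Q(2)[of "kint m / 2 * x"] by (simp add: mean_value_def algebra_simps)
  ultimately show ?thesis by blast
qed

text \<open>The difference \<open>d\<close> of two bounded solutions satisfies \<open>d'' = (y + z) d\<close>, so \<open>d\<^sup>2 + d'\<^sup>2\<close> grows or decays at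
  most exponentially and vanishes identically once it vanishes somewhere.\<close>

lemma second_order_uniqueness:
  fixes y z :: "real \<Rightarrow> real"
  assumes y: "\<And>x. (y has_real_derivative y' x) (at x)" "\<And>x. (y' has_real_derivative (y x)\<^sup>2 - K) (at x)"
    and z: "\<And>x. (z has_real_derivative z' x) (at x)" "\<And>x. (z' has_real_derivative (z x)\<^sup>2 - K) (at x)"
    and bounds: "\<And>x. \<bar>y x\<bar> \<le> B" "\<And>x. \<bar>z x\<bar> \<le> B"
    and init: "y x0 = z x0" "y' x0 = z' x0"
  shows "y x = z x"
proof -
  define E where "E = (\<lambda>x. (y x - z x)\<^sup>2 + (y' x - z' x)\<^sup>2)"
  define E' where "E' = (\<lambda>x. 2 * (y x - z x) * (y' x - z' x) * (1 + (y x + z x)))"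
  define c where "c = 1 + 2 * B"
  have E: "(E has_real_derivative E' x) (at x)" for x
    unfolding E_def E'_def
    by (rule derivative_eq_intros y z refl)+ (simp add: power2_eq_square algebra_simps)
  have "\<bar>E' x\<bar> \<le> c * E x" for x
  proof -
    have "\<bar>2 * (y x - z x) * (y' x - z' x)\<bar> \<le> E x"
      using sum_squares_bound[of "\<bar>y x - z x\<bar>" "\<bar>y' x - z' x\<bar>"]
      unfolding E_def abs_mult abs_numeral power2_abs .
    moreover have "\<bar>1 + (y x + z x)\<bar> \<le> c" using bounds[of x] unfolding c_def by linarith
    ultimately have "\<bar>2 * (y x - z x) * (y' x - z' x)\<bar> * \<bar>1 + (y x + z x)\<bar> \<le> E x * c"
      by (intro mult_mono) (auto simp: E_def)
    then show ?thesis by (simp add: E'_def abs_mult mult.commute)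
  qed
  then have "- (c * E x) \<le> E' x \<and> E' x \<le> c * E x" for x
    by (simp add: abs_le_iff minus_le_iff)
  then have lo: "0 \<le> E' x + c * E x" and hi: "E' x - c * E x \<le> 0" for x
    using add_left_mono[of "- (c * E x)" "E' x" "c * E x"] by simp_all
  have E0: "E x0 = 0" by (simp add: E_def init)
  have Ex: "E x \<le> 0"
  proof (cases "x0 \<le> x")
    case True
    have "E x * exp (- c * x) \<le> E x0 * exp (- c * x0)"
    proof (rule DERIV_nonpos_imp_nonincreasing[OF True])
      fix x
      have "((\<lambda>x. E x * exp (- c * x)) has_real_derivative (E' x - c * E x) * exp (- c * x)) (at x)"
        by (rule derivative_eq_intros E refl)+ (simp add: algebra_simps)
      moreover have "(E' x - c * E x) * exp (- c * x) \<le> 0" using hi[of x] by (simp add: mult_nonpos_nonneg)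
      ultimately show "\<exists>d. ((\<lambda>x. E x * exp (- c * x)) has_real_derivative d) (at x) \<and> d \<le> 0"
        by blast
    qed
    then show ?thesis using E0 by (simp add: mult_le_0_iff)
  next
    case False
    then have le: "x \<le> x0" by simp
    have "E x * exp (c * x) \<le> E x0 * exp (c * x0)"
    proof (rule DERIV_nonneg_imp_nondecreasing[OF le])
      fix x
      have "((\<lambda>x. E x * exp (c * x)) has_real_derivative (E' x + c * E x) * exp (c * x)) (at x)"
        by (rule derivative_eq_intros E refl)+ (simp add: algebra_simps)
      moreover have "0 \<le> (E' x + c * E x) * exp (c * x)" using lo[of x] by simp
      ultimately show "\<exists>d. ((\<lambda>x. E x * exp (c * x)) has_real_derivative d) (at x) \<and> 0 \<le> d"
        by blast
    qed
    then show ?thesis using E0 by (simp add: mult_le_0_iff)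
  qed
  have "(y x - z x)\<^sup>2 \<le> E x" by (simp add: E_def)
  then have "(y x - z x)\<^sup>2 \<le> 0" using Ex by linarith
  then show ?thesis by simp
qed

section \<open>Classification of the periodic solutions of the profile equation\<close>

lemma periodic_extrema:
  fixes f :: "real \<Rightarrow> real"
  assumes "continuous_on UNIV f" "\<And>x. f (x + p) = f x" "0 < p"
  obtains x0 x1 where "\<And>x. f x0 \<le> f x" "\<And>x. f x \<le> f x1"
proof -
  interpret periodic_fun_simple f p by standard (rule assms(2))
  have c: "continuous_on {0..p} f" using assms(1) continuous_on_subset by blast
  have red: "\<exists>t\<in>{0..p}. f x = f t" for x
  proof -
    have "f x = f (x - of_int \<lfloor>x / p\<rfloor> * p)" by (simp add: minus_of_int)
    moreover have "of_int \<lfloor>x / p\<rfloor> * p \<le> x" "x \<le> (of_int \<lfloor>x / p\<rfloor> + 1) * p"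
      using assms(3) by (simp_all add: pos_le_divide_eq[symmetric] pos_divide_le_eq[symmetric] less_imp_le)
    then have "x - of_int \<lfloor>x / p\<rfloor> * p \<in> {0..p}" by (simp add: algebra_simps)
    ultimately show ?thesis by blast
  qed
  obtain x0 where x0: "\<forall>t\<in>{0..p}. f x0 \<le> f t"
    using continuous_attains_inf[OF _ _ c] assms(3) by auto
  obtain x1 where x1: "\<forall>t\<in>{0..p}. f t \<le> f x1"
    using continuous_attains_sup[OF _ _ c] assms(3) by auto
  have "f x0 \<le> f x" "f x \<le> f x1" for x
    using red[of x] x0 x1 by auto
  then show thesis using that by blast
qed

text \<open>The minimum \<open>e3\<close> and the maximum \<open>e2\<close> are roots of the cubic given by the first integral; the third
  root is \<open>e1 = - e2 - e3\<close>. As the cubic is nonnegative on \<open>[e3, e2]\<close>, one has \<open>e2 \<le> e1\<close>. Equality would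
  make \<open>e2\<close> an equilibrium attained by the solution, forcing it to be constant. The three roots
  determine a cnoidal wave with the same value and slope at the minimum, which therefore is the given
  solution, and its \<open>2 \<pi>\<close>-periodicity fixes the speed \<open>c\<close> up to the integer \<open>n\<close>.\<close>

lemma periodic_solution_is_cnoidal:
  fixes y :: "real \<Rightarrow> real"
  assumes y: "\<And>x. (y has_real_derivative y' x) (at x)" "\<And>x. (y' has_real_derivative (y x)\<^sup>2 - K) (at x)"
    and per: "\<And>x. y (x + 2 * pi) = y x" and nonconst: "y a \<noteq> y b"
  obtains n m x0 where "n \<ge> 1" "0 \<le> m" "m < 1"
    "\<And>x. y x = (real n)\<^sup>2 * cnoidal m (real n * (x - x0))"
proof -
  have "continuous_on UNIV y"
    using y(1) by (intro continuous_at_imp_continuous_on) (auto intro: DERIV_isCont)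
  then obtain x0 x1 where min: "\<And>x. y x0 \<le> y x" and max: "\<And>x. y x \<le> y x1"
    by (rule periodic_extrema[where p = "2 * pi"]) (use per in auto)
  define e2 e3 where "e2 = y x1" and "e3 = y x0"
  define e1 where "e1 = - e2 - e3"
  have "e3 < e2" using min[of a] max[of a] min[of b] max[of b] nonconst unfolding e2_def e3_def by linarith
  have y'0: "y' x0 = 0" "y' x1 = 0"
    by (rule DERIV_local_min[OF y(1) zero_less_one], simp add: min)
      (rule DERIV_local_max[OF y(1) zero_less_one], simp add: max)
  define N where "N = (\<lambda>x. (y' x)\<^sup>2 - 2/3 * (y x)^3 + 2 * K * y x)"
  have "(N has_real_derivative 0) (at x)" for x
    unfolding N_def
    by (rule derivative_eq_intros y refl)+ (simp add: power2_eq_square power3_eq_cube algebra_simps)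
  then have energy: "N x = N w" for x w using DERIV_isconst_all by blast
  have "N x0 = N x1" by (rule energy)
  then have "2 * K * (e2 - e3) = 2/3 * (e2^3 - e3^3)"
    using y'0 by (simp add: N_def e2_def e3_def algebra_simps)
  also have "\<dots> = 2/3 * (e2\<^sup>2 + e2 * e3 + e3\<^sup>2) * (e2 - e3)"
  proof -
    have "e2^3 - e3^3 = (e2\<^sup>2 + e2 * e3 + e3\<^sup>2) * (e2 - e3)" by algebra
    then show ?thesis by simp
  qed
  finally have K: "3 * K = e2\<^sup>2 + e2 * e3 + e3\<^sup>2" using \<open>e3 < e2\<close> by simp
  have cubic: "(y' x)\<^sup>2 = 2/3 * (y x - e1) * (y x - e2) * (y x - e3)" for x
  proof -
    have "N x = N x1" by (rule energy)
    then have "3 * (y' x)\<^sup>2 = 2 * (y x)^3 - 2 * (3 * K) * y x - 2 * e2^3 + 2 * (3 * K) * e2"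
      using y'0 by (simp add: N_def e2_def)
    also have "\<dots> = 2 * (y x - e1) * (y x - e2) * (y x - e3)"
      unfolding K e1_def by algebra
    finally show ?thesis by simp
  qed
  have below: "v \<le> e1" if "e3 < v" "v < e2" for v
  proof -
    have "\<exists>x. y x = v"
    proof (cases "x0 \<le> x1")
      case True
      then show ?thesis
        using IVT[of y x0 v x1] that DERIV_isCont[OF y(1)] unfolding e2_def e3_def by auto
    next
      case False
      then show ?thesis
        using IVT2[of y x0 v x1] that DERIV_isCont[OF y(1)] unfolding e2_def e3_def by auto
    qed
    then obtain x where x: "y x = v" by blast
    have "0 \<le> 2/3 * (v - e1) * (v - e2) * (v - e3)" using cubic[of x] x by (metis zero_le_power2)
    then have "0 \<le> (e1 - v) * ((e2 - v) * (v - e3))" by (simp add: algebra_simps)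
    moreover have "0 < (e2 - v) * (v - e3)" using that by simp
    ultimately show ?thesis by (simp add: zero_le_mult_iff)
  qed
  have "e2 \<le> e1" by (rule dense_le_bounded[OF \<open>e3 < e2\<close> below])
  define B where "B = \<bar>e2\<bar> + \<bar>e3\<bar>"
  have By: "\<bar>y x\<bar> \<le> B" for x using min[of x] max[of x] unfolding B_def e2_def e3_def by linarith
  \<comment> \<open>If \<open>e1 = e2\<close>, both \<open>y\<close> and the constant \<open>e2\<close> solve the equation with the same data at the maximum.\<close>
  have "e1 \<noteq> e2"
  proof
    assume "e1 = e2"
    then have "e3 = - 2 * e2" by (simp add: e1_def)
    then have "3 * K = 3 * e2\<^sup>2" unfolding K by algebra
    then have K2: "e2\<^sup>2 - K = 0" by simp
    have "y x = e2" for x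
      by (rule second_order_uniqueness[OF y, where z = "\<lambda>_. e2" and z' = "\<lambda>_. 0" and B = B and ?x0.0 = x1])
        (simp_all add: K2 By y'0, simp_all add: e2_def B_def)
    then show False using nonconst by simp
  qed
  with \<open>e2 \<le> e1\<close> have "e2 < e1" by simp
  define c where "c = sqrt ((e1 - e3) / 6)"
  define m where "m = (e2 - e3) / (e1 - e3)"
  have m: "0 < m" "m < 1" using \<open>e3 < e2\<close> \<open>e2 < e1\<close> by (auto simp: m_def)
  have m0: "0 \<le> m" using m by simp
  have c: "0 < c" "c\<^sup>2 = (e1 - e3) / 6" using \<open>e3 < e2\<close> \<open>e2 < e1\<close> by (auto simp: c_def)
  have cm: "c\<^sup>2 * m = (e2 - e3) / 6" 
  proof -
    have "e1 - e3 \<noteq> 0" using \<open>e3 < e2\<close> \<open>e2 < e1\<close> by simp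
    then have "(e1 - e3) * m = e2 - e3" unfolding m_def by simp
    then show ?thesis unfolding c(2) by simp
  qed
  define z where "z = (\<lambda>x. c\<^sup>2 * cnoidal0 m (c * (x - x0)))"
  define z' where "z' = (\<lambda>x. c^3 * cnoidal0' m (c * (x - x0)))"
  have inner: "((\<lambda>x. c * (x - x0)) has_real_derivative c) (at x)" for x
    by (auto intro!: derivative_eq_intros)
  have z1: "(z has_real_derivative z' x) (at x)" for x
    unfolding z_def z'_def
    by (rule DERIV_cong[OF DERIV_cmult[OF DERIV_chain2[OF cnoidal0_deriv[OF m0 m(2)] inner]]])
      (simp add: power2_eq_square power3_eq_cube)
  have KK: "K = c^4 * (4 * (m\<^sup>2 - m + 1))"
  proof -
    have "c^4 * (4 * (m\<^sup>2 - m + 1)) = 4 * ((c\<^sup>2 * m)\<^sup>2 - (c\<^sup>2 * m) * c\<^sup>2 + (c\<^sup>2)\<^sup>2)"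
      by algebra
    also have "\<dots> = 4 * (((e2 - e3) / 6)\<^sup>2 - (e2 - e3) / 6 * ((e1 - e3) / 6) + ((e1 - e3) / 6)\<^sup>2)"
      by (simp only: cm) (simp only: c(2))
    also have "\<dots> = ((e2 - e3)\<^sup>2 - (e2 - e3) * (e1 - e3) + (e1 - e3)\<^sup>2) / 9"
      by (simp add: power_divide)
    also have "(e2 - e3)\<^sup>2 - (e2 - e3) * (e1 - e3) + (e1 - e3)\<^sup>2 = 9 * K"
      using K unfolding e1_def by algebra
    finally show ?thesis by simp
  qed
  have z2: "(z' has_real_derivative (z x)\<^sup>2 - K) (at x)" for x
    unfolding z_def z'_def KK
    by (rule DERIV_cong[OF DERIV_cmult[OF DERIV_chain2[OF cnoidal0'_deriv[OF m0 m(2)] inner]]])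
      algebra
  have zval: "z x = e3 + (e2 - e3) * (sin (amp m (c * (x - x0))))\<^sup>2" for x
  proof -
    have "z x = - 2 * (c\<^sup>2 + c\<^sup>2 * m) + 6 * (c\<^sup>2 * m) * (sin (amp m (c * (x - x0))))\<^sup>2"
      unfolding z_def cnoidal0_def by (simp add: algebra_simps)
    also have "\<dots> = - 2 * ((e1 - e3) / 6 + (e2 - e3) / 6)
        + 6 * ((e2 - e3) / 6) * (sin (amp m (c * (x - x0))))\<^sup>2"
      by (simp only: cm) (simp only: c(2))
    also have "- 2 * ((e1 - e3) / 6 + (e2 - e3) / 6) = e3" by (simp add: e1_def field_simps)
    finally show ?thesis by simp
  qed
  have Bz: "\<bar>z x\<bar> \<le> B" for x
  proof -
    have "0 \<le> (e2 - e3) * (sin (amp m (c * (x - x0))))\<^sup>2" using \<open>e3 < e2\<close> by simp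
    moreover have "(e2 - e3) * (sin (amp m (c * (x - x0))))\<^sup>2 \<le> (e2 - e3) * 1"
      using \<open>e3 < e2\<close> by (intro mult_left_mono) (auto simp: abs_square_le_1)
    ultimately have "e3 \<le> z x" "z x \<le> e2" unfolding zval by simp_all
    then show ?thesis unfolding B_def by linarith
  qed
  have yz: "y x = z x" for x
  proof (rule second_order_uniqueness[of y y' K z z' B x0])
    show "y x0 = z x0" by (simp add: zval amp_0[OF m0 m(2)] e3_def)
    show "y' x0 = z' x0" by (simp add: z'_def cnoidal0'_def amp_0[OF m0 m(2)] y'0)
  qed (fact y z1 z2 By Bz)+
  have "z (x0 + 2 * pi) = z x0" using per yz by metis
  then have "cnoidal0 m (c * (2 * pi)) = cnoidal0 m 0" using c(1) by (simp add: z_def)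
  then obtain n where n: "n \<ge> 1" "c * (2 * pi) = real n * (pi * kint m)"
    using cnoidal0_period[OF m, of "c * (2 * pi)"] c by auto
  then have ceq: "c = real n * (kint m / 2)" by simp
  have "y x = (real n)\<^sup>2 * cnoidal m (real n * (x - x0))" for x
    unfolding yz z_def cnoidal_def ceq by (simp only: power_mult_distrib mult_ac)
  then show thesis using that n(1) m0 m(2) by blast
qed

section \<open>Differential calculus of functions of the spiral coordinate\<close>

lemma norm_sq_real2: "(norm (x::real^2))\<^sup>2 = (x $ 1)\<^sup>2 + (x $ 2)\<^sup>2"
  unfolding power2_norm_eq_inner inner_vec_def sum_2 by (simp add: power2_eq_square)

lemma norm_to_complex: "norm (to_complex x) = norm x"
  by (simp add: to_complex_def cmod_def norm_vec_def L2_set_def sum_2)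

lemma to_complex_eq_0_iff [simp]: "to_complex x = 0 \<longleftrightarrow> x = 0"
  using norm_to_complex[of x] by (metis norm_eq_zero)

lemma norm_sq_pos: "x \<noteq> 0 \<Longrightarrow> 0 < (x $ 1)\<^sup>2 + (x $ 2)\<^sup>2" for x :: "real^2"
  using norm_sq_real2[of x] by (metis norm_eq_zero zero_less_power2)

lemma to_complex_polar: "to_complex x = of_real (norm x) * cis (polar_angle x)"
  using rcis_cmod_Arg[of "to_complex x"] by (simp add: rcis_def polar_angle_def norm_to_complex)

lemma polar_components:
  "x $ 1 = norm x * cos (polar_angle x)" "x $ 2 = norm x * sin (polar_angle x)"
  using arg_cong[OF to_complex_polar[of x], of Re] arg_cong[OF to_complex_polar[of x], of Im]
  by (simp_all add: to_complex_def)

text \<open>For any logarithm \<open>w\<close> of the point, the spiral coordinate is \<open>\<theta>\<^sub>0 + Im w + a Re w\<close> up to a multiple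
  of \<open>2 \<pi>\<close>, which a periodic function does not notice; so multiplying the point by \<open>exp \<zeta>\<close> simply adds \<open>\<zeta>\<close> to \<open>w\<close>. Rotations,
  dilations and local branches of the logarithm are all instances.\<close>

lemma spiral_coord_mult:
  assumes "x \<noteq> 0" and eq: "to_complex y = exp \<zeta> * to_complex x"
    and per: "\<And>z. \<psi> (z + 2 * pi) = \<psi> z"
  shows "\<psi> (spiral_coord a \<theta>\<^sub>0 y) = \<psi> (spiral_coord a \<theta>\<^sub>0 x + Im \<zeta> + a * Re \<zeta>)"
proof -
  interpret periodic_fun_simple \<psi> "2 * pi" by standard (rule per)
  have "y \<noteq> 0" using assms(1) eq by (metis exp_not_eq_zero mult_eq_0_iff to_complex_eq_0_iff)
  have polar: "to_complex w = exp (Complex (ln (norm w)) (polar_angle w))" if "w \<noteq> 0" for w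
    using that to_complex_polar[of w] by (simp add: exp_eq_polar exp_ln)
  have "exp (Complex (ln (norm y)) (polar_angle y)) = exp (\<zeta> + Complex (ln (norm x)) (polar_angle x))"
    using eq polar[OF \<open>x \<noteq> 0\<close>] polar[OF \<open>y \<noteq> 0\<close>] by (simp add: exp_add)
  then obtain n :: int where n: "Complex (ln (norm y)) (polar_angle y)
      = \<zeta> + Complex (ln (norm x)) (polar_angle x) + (of_int (2 * n) * pi) * \<i>"
    unfolding exp_eq by blast
  have "ln (norm y) = Re \<zeta> + ln (norm x)" using arg_cong[OF n, of Re] by simp
  moreover have "polar_angle y = Im \<zeta> + polar_angle x + of_int n * (2 * pi)"
    using arg_cong[OF n, of Im] by simp
  ultimately have "spiral_coord a \<theta>\<^sub>0 y
      = spiral_coord a \<theta>\<^sub>0 x + Im \<zeta> + a * Re \<zeta> + of_int n * (2 * pi)"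
    by (simp add: spiral_coord_def algebra_simps)
  then show ?thesis by (simp add: plus_of_int)
qed

text \<open>Frechet derivatives on the plane recorded by their two partial derivatives. Rules in this form compose
  forwards: instantiating them on one another computes gradients of explicit expressions.\<close>

abbreviation has_grad :: "(real^2 \<Rightarrow> 'b::real_normed_vector) \<Rightarrow> real^2 \<Rightarrow> 'b \<Rightarrow> 'b \<Rightarrow> bool" where
  "has_grad f x p q \<equiv> (f has_derivative (\<lambda>h. (h $ 1) *\<^sub>R p + (h $ 2) *\<^sub>R q)) (at x)"

lemma has_grad_partial:
  assumes "has_grad f x p q"
  shows "partial_deriv 1 f x = p" "partial_deriv 2 f x = q"
  using frechet_derivative_at[OF assms, symmetric] by (simp_all add: partial_deriv_def axis_def)

lemma has_grad_cong_open:
  assumes "has_grad f x p q" "open S" "x \<in> S" "\<And>y. y \<in> S \<Longrightarrow> f y = g y"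
  shows "has_grad g x p q"
  by (rule has_derivative_transform_within_open[OF assms])

lemma has_grad_eq:
  assumes "has_grad f x p q" "p = p'" "q = q'"
  shows "has_grad f x p' q'"
  using assms by simp

lemma has_grad_const: "has_grad (\<lambda>x. c) x 0 0"
  by simp

lemma has_derivative_coord: "((\<lambda>x. x $ i) has_derivative (\<lambda>h. h $ i)) (at (x :: real^2))"
  by (rule bounded_linear_imp_has_derivative[OF bounded_linear_vec_nth])

lemma has_grad_coord: "has_grad (\<lambda>x. x $ 1) x 1 0" "has_grad (\<lambda>x. x $ 2) x 0 1"
  using has_derivative_coord[of 1 x] has_derivative_coord[of 2 x] by simp_all

lemma has_grad_add:
  assumes f: "has_grad f x p q" and g: "has_grad g x p' q'"
  shows "has_grad (\<lambda>x. f x + g x) x (p + p') (q + q')"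
  by (rule has_derivative_eq_rhs[OF has_derivative_add[OF f g]]) (simp add: fun_eq_iff algebra_simps)

lemma has_grad_diff:
  assumes f: "has_grad f x p q" and g: "has_grad g x p' q'"
  shows "has_grad (\<lambda>x. f x - g x) x (p - p') (q - q')"
  by (rule has_derivative_eq_rhs[OF has_derivative_diff[OF f g]]) (simp add: fun_eq_iff algebra_simps)

lemma has_grad_mult:
  fixes f g :: "real^2 \<Rightarrow> real"
  assumes f: "has_grad f x p q" and g: "has_grad g x p' q'"
  shows "has_grad (\<lambda>x. f x * g x) x (p * g x + f x * p') (q * g x + f x * q')"
  by (rule has_derivative_eq_rhs[OF has_derivative_mult[OF f g]]) (simp add: fun_eq_iff algebra_simps)

lemma has_grad_vector:
  fixes f g :: "real^2 \<Rightarrow> real"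
  assumes f: "has_grad f x p q" and g: "has_grad g x p' q'"
  shows "has_grad (\<lambda>x. vector [f x, g x] :: real^2) x (vector [p, p']) (vector [q, q'])"
proof -
  have "has_grad (\<lambda>x. f x *\<^sub>R axis 1 1 + g x *\<^sub>R axis 2 1 :: real^2) x
      (p *\<^sub>R axis 1 1 + p' *\<^sub>R axis 2 1) (q *\<^sub>R axis 1 1 + q' *\<^sub>R axis 2 1)"
    by (rule has_derivative_eq_rhs[OF has_derivative_add[OF 
          has_derivative_scaleR_left[OF f] has_derivative_scaleR_left[OF g]]])
      (auto simp: algebra_simps)
  moreover have "u *\<^sub>R axis 1 1 + v *\<^sub>R axis 2 1 = (vector [u, v] :: real^2)" for u v
    by (simp add: vec_eq_iff forall_2 axis_def)
  ultimately show ?thesis by simp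
qed

definition inv_sq :: "real^2 \<Rightarrow> real" where
  "inv_sq x = 1 / ((x $ 1)\<^sup>2 + (x $ 2)\<^sup>2)"

lemma inv_sq_mult:
  assumes "x \<noteq> 0" shows "inv_sq x * ((x $ 1)\<^sup>2 + (x $ 2)\<^sup>2) = 1"
  unfolding inv_sq_def times_divide_eq_left mult_1_left
  by (rule divide_self) (rule less_imp_neq[OF norm_sq_pos[OF assms], symmetric])

lemma inv_sq_norm: "inv_sq x = 1 / (norm x)\<^sup>2"
  by (simp add: inv_sq_def norm_sq_real2)

lemma has_grad_inv_sq:
  assumes "x \<noteq> 0"
  shows "has_grad inv_sq x (- 2 * x $ 1 * (inv_sq x)\<^sup>2) (- 2 * x $ 2 * (inv_sq x)\<^sup>2)"
proof -
  let ?\<rho> = "\<lambda>x::real^2. (x $ 1)\<^sup>2 + (x $ 2)\<^sup>2"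
  have "has_grad ?\<rho> x (2 * x $ 1) (2 * x $ 2)"
    using has_grad_add[OF has_grad_mult[OF has_grad_coord(1)[of x] has_grad_coord(1)]
        has_grad_mult[OF has_grad_coord(2)[of x] has_grad_coord(2)]]
    by (simp add: power2_eq_square)
  moreover have "((\<lambda>y. 1 / y) has_real_derivative - ((inv_sq x)\<^sup>2)) (at (?\<rho> x))"
    using norm_sq_pos[OF assms]
    by (auto intro!: derivative_eq_intros simp: inv_sq_def power2_eq_square)
  ultimately have "(inv_sq has_derivative
      (\<lambda>h. ((h $ 1) *\<^sub>R (2 * x $ 1) + (h $ 2) *\<^sub>R (2 * x $ 2)) * - ((inv_sq x)\<^sup>2))) (at x)"
    unfolding inv_sq_def by (rule DERIV_compose_FDERIV[rotated])
  then show ?thesis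
    by (rule has_derivative_eq_rhs) (simp add: fun_eq_iff algebra_simps)
qed

text \<open>Near \<open>x\<close>, the branch cut of the argument is avoided by the coordinate \<open>Z\<close> built from
  \<open>Ln (y / x)\<close>, which is smooth at \<open>y = x\<close>; by periodicity it can be exchanged for the spiral
  coordinate inside \<open>\<psi>\<close>.\<close>

lemma has_grad_spiral:
  assumes "x \<noteq> 0" and per: "\<And>z. \<psi> (z + 2 * pi) = \<psi> z"
    and d: "(\<psi> has_real_derivative \<psi>') (at (spiral_coord a \<theta>\<^sub>0 x))"
  shows "has_grad (\<lambda>x. \<psi> (spiral_coord a \<theta>\<^sub>0 x)) x
    (\<psi>' * (a * x $ 1 - x $ 2) * inv_sq x) (\<psi>' * (a * x $ 2 + x $ 1) * inv_sq x)"
proof -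
  define w where "w = to_complex x"
  have "w \<noteq> 0" using assms(1) by (simp add: w_def)
  define L where "L = (\<lambda>y. Ln (to_complex y / w))"
  define Z where "Z = (\<lambda>y. spiral_coord a \<theta>\<^sub>0 x + Im (L y) + a * Re (L y))"
  have tc: "to_complex = (\<lambda>y. of_real (y $ 1) + \<i> * of_real (y $ 2))"
    by (auto simp: to_complex_def fun_eq_iff complex_eq_iff)
  have dtc: "(to_complex has_derivative to_complex) (at x)"
    unfolding tc by (auto intro!: derivative_eq_intros has_derivative_coord)
  have "((\<lambda>y. to_complex y / w) has_derivative (\<lambda>h. to_complex h / w)) (at x)"
    by (rule has_derivative_eq_rhs[OF has_derivative_divide'[OF dtc has_derivative_const]])
      (use \<open>w \<noteq> 0\<close> in \<open>auto simp: divide_simps\<close>)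
  moreover have "(Ln has_derivative (\<lambda>h. h)) (at (to_complex x / w))"
    using has_field_derivative_Ln[of 1] \<open>w \<noteq> 0\<close>
    by (simp add: w_def has_field_derivative_def mult_1_left[abs_def])
  ultimately have dL: "(L has_derivative (\<lambda>h. to_complex h / w)) (at x)"
    unfolding L_def using has_derivative_compose by blast
  have dZ: "(Z has_derivative (\<lambda>h. Im (to_complex h / w) + a * Re (to_complex h / w))) (at x)"
    unfolding Z_def by (auto intro!: derivative_eq_intros dL)
  have Zx: "Z x = spiral_coord a \<theta>\<^sub>0 x" using \<open>w \<noteq> 0\<close> by (simp add: Z_def L_def w_def)
  have "((\<lambda>y. \<psi> (Z y)) has_derivative
      (\<lambda>h. (Im (to_complex h / w) + a * Re (to_complex h / w)) * \<psi>')) (at x)"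
    by (rule DERIV_compose_FDERIV[OF _ dZ]) (use d in \<open>simp add: Zx\<close>)
  moreover have "(\<lambda>h. (Im (to_complex h / w) + a * Re (to_complex h / w)) * \<psi>')
      = (\<lambda>h. (h $ 1) *\<^sub>R (\<psi>' * (a * x $ 1 - x $ 2) * inv_sq x)
           + (h $ 2) *\<^sub>R (\<psi>' * (a * x $ 2 + x $ 1) * inv_sq x))"
    unfolding w_def using norm_sq_pos[OF assms(1)]
    by (auto simp: fun_eq_iff to_complex_def Re_divide Im_divide inv_sq_def divide_simps)
      (simp_all add: algebra_simps power2_eq_square)
  moreover have "\<psi> (Z y) = \<psi> (spiral_coord a \<theta>\<^sub>0 y)" if "y \<in> - {0}" for y
  proof -
    have "to_complex y = exp (L y) * to_complex x"
      using that \<open>w \<noteq> 0\<close> by (simp add: L_def w_def)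
    from spiral_coord_mult[OF assms(1) this, where \<psi> = \<psi>, OF per] show ?thesis by (simp add: Z_def)
  qed
  ultimately show ?thesis
    using has_derivative_transform_within_open[of _ _ x UNIV "- {0}"] assms(1) by fastforce
qed

section \<open>The Navier-Stokes system for spiral fields\<close>

lemma periodic_deriv:
  fixes f :: "real \<Rightarrow> real"
  assumes d: "\<And>z. (f has_real_derivative f' z) (at z)" and per: "\<And>z. f (z + p) = f z"
  shows "f' (z + p) = f' z"
proof -
  have "((\<lambda>z. f (z + p)) has_real_derivative f' (z + p)) (at z)"
    using d[of "z + p"] by (simp add: DERIV_shift)
  then have "(f has_real_derivative f' (z + p)) (at z)" using per by simp
  then show ?thesis using d DERIV_unique by blast
qed

text \<open>The field \<open>(f(z) e_r + g(z) e_\<theta>) / r\<close> in Cartesian components.\<close>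

definition spiral_field :: "real \<Rightarrow> real \<Rightarrow> (real \<Rightarrow> real) \<Rightarrow> (real \<Rightarrow> real) \<Rightarrow> real^2 \<Rightarrow> real^2" where
  "spiral_field a \<theta>\<^sub>0 f g x = (let z = spiral_coord a \<theta>\<^sub>0 x in
     vector [(f z * x $ 1 - g z * x $ 2) * inv_sq x, (f z * x $ 2 + g z * x $ 1) * inv_sq x])"

lemma partial_deriv_cong:
  assumes "\<forall>y. y \<noteq> 0 \<longrightarrow> f y = g y" "x \<noteq> 0" "has_grad g x p q"
  shows "partial_deriv 1 f x = p" "partial_deriv 2 f x = q"
proof -
  have "has_grad f x p q"
    by (rule has_grad_cong_open[OF assms(3), of "- {0}"]) (use assms in auto)
  then show "partial_deriv 1 f x = p" "partial_deriv 2 f x = q"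
    by (rule has_grad_partial)+
qed

locale spiral_profiles =
  fixes a \<theta>\<^sub>0 :: real and f f1 f2 g g1 g2 :: "real \<Rightarrow> real"
  assumes f: "\<And>z. (f has_real_derivative f1 z) (at z)" "\<And>z. (f1 has_real_derivative f2 z) (at z)"
    and g: "\<And>z. (g has_real_derivative g1 z) (at z)" "\<And>z. (g1 has_real_derivative g2 z) (at z)"
    and per: "\<And>z. f (z + 2 * pi) = f z" "\<And>z. g (z + 2 * pi) = g z"
begin

lemma per1: "f1 (z + 2 * pi) = f1 z" "g1 (z + 2 * pi) = g1 z"
  using periodic_deriv[of f f1 "2 * pi"] periodic_deriv[of g g1 "2 * pi"] f g per by blast+

abbreviation S :: "(real \<Rightarrow> real) \<Rightarrow> real^2 \<Rightarrow> real" where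
  "S \<psi> x \<equiv> \<psi> (spiral_coord a \<theta>\<^sub>0 x)"

text \<open>The partial derivatives of the two components, left in the unsimplified form (with factors \<open>1\<close> and
  \<open>0\<close>) that the product rule yields, so that they can be differentiated once more by the same rules.\<close>

definition d1_u1 where "d1_u1 x = (S f1 x * (a * x $ 1 - x $ 2) * inv_sq x * x $ 1 + S f x * 1
    - (S g1 x * (a * x $ 1 - x $ 2) * inv_sq x * x $ 2 + S g x * 0)) * inv_sq x
    + (S f x * x $ 1 - S g x * x $ 2) * (- 2 * x $ 1 * (inv_sq x)\<^sup>2)"
definition d2_u1 where "d2_u1 x = (S f1 x * (a * x $ 2 + x $ 1) * inv_sq x * x $ 1 + S f x * 0
    - (S g1 x * (a * x $ 2 + x $ 1) * inv_sq x * x $ 2 + S g x * 1)) * inv_sq x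
    + (S f x * x $ 1 - S g x * x $ 2) * (- 2 * x $ 2 * (inv_sq x)\<^sup>2)"
definition d1_u2 where "d1_u2 x = (S f1 x * (a * x $ 1 - x $ 2) * inv_sq x * x $ 2 + S f x * 0
    + (S g1 x * (a * x $ 1 - x $ 2) * inv_sq x * x $ 1 + S g x * 1)) * inv_sq x
    + (S f x * x $ 2 + S g x * x $ 1) * (- 2 * x $ 1 * (inv_sq x)\<^sup>2)"
definition d2_u2 where "d2_u2 x = (S f1 x * (a * x $ 2 + x $ 1) * inv_sq x * x $ 2 + S f x * 1
    + (S g1 x * (a * x $ 2 + x $ 1) * inv_sq x * x $ 1 + S g x * 0)) * inv_sq x
    + (S f x * x $ 2 + S g x * x $ 1) * (- 2 * x $ 2 * (inv_sq x)\<^sup>2)"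

context
  fixes x :: "real^2"
  assumes x: "x \<noteq> 0"
begin

lemmas grad_x1 = has_grad_coord(1)[of x] and grad_x2 = has_grad_coord(2)[of x]
lemmas grad_R = has_grad_inv_sq[OF x]
lemmas grad_f = has_grad_spiral[OF x, where \<psi> = f and a = a and \<theta>\<^sub>0 = \<theta>\<^sub>0, OF per(1) f(1)]
lemmas grad_g = has_grad_spiral[OF x, where \<psi> = g and a = a and \<theta>\<^sub>0 = \<theta>\<^sub>0, OF per(2) g(1)]
lemmas grad_f1 = has_grad_spiral[OF x, where \<psi> = f1 and a = a and \<theta>\<^sub>0 = \<theta>\<^sub>0, OF per1(1) f(2)]
lemmas grad_g1 = has_grad_spiral[OF x, where \<psi> = g1 and a = a and \<theta>\<^sub>0 = \<theta>\<^sub>0, OF per1(2) g(2)]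

lemma grad_spiral_field:
  "has_grad (spiral_field a \<theta>\<^sub>0 f g) x (vector [d1_u1 x, d1_u2 x]) (vector [d2_u1 x, d2_u2 x])"
  using has_grad_vector[OF
      has_grad_mult[OF has_grad_diff[OF has_grad_mult[OF grad_f grad_x1] has_grad_mult[OF grad_g grad_x2]] grad_R]
      has_grad_mult[OF has_grad_add[OF has_grad_mult[OF grad_f grad_x2] has_grad_mult[OF grad_g grad_x1]] grad_R]]
  unfolding spiral_field_def d1_u1_def d2_u1_def d1_u2_def d2_u2_def Let_def .

lemmas grad_lin1 = has_grad_diff[OF has_grad_mult[OF has_grad_const[of a] grad_x1] grad_x2]
lemmas grad_lin2 = has_grad_add[OF has_grad_mult[OF has_grad_const[of a] grad_x2] grad_x1]
lemmas grad_minus_two = has_grad_const[of "-2::real" x]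
lemmas grad_RR = has_grad_mult[OF grad_R grad_R, folded power2_eq_square]
lemmas grad_one = has_grad_const[of "1::real" x]
lemmas grad_zero = has_grad_const[of "0::real" x]
lemmas grad_num1 = has_grad_diff[OF has_grad_mult[OF grad_f grad_x1] has_grad_mult[OF grad_g grad_x2]]
lemmas grad_num2 = has_grad_add[OF has_grad_mult[OF grad_f grad_x2] has_grad_mult[OF grad_g grad_x1]]

lemmas grad_d1_u1 = has_grad_add[OF has_grad_mult[OF has_grad_diff[OF
    has_grad_add[OF has_grad_mult[OF has_grad_mult[OF has_grad_mult[OF grad_f1 grad_lin1] grad_R] grad_x1] has_grad_mult[OF grad_f grad_one]]
    has_grad_add[OF has_grad_mult[OF has_grad_mult[OF has_grad_mult[OF grad_g1 grad_lin1] grad_R] grad_x2] has_grad_mult[OF grad_g grad_zero]]] grad_R]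
    has_grad_mult[OF grad_num1 has_grad_mult[OF has_grad_mult[OF grad_minus_two grad_x1] grad_RR]], folded d1_u1_def]
lemmas grad_d2_u1 = has_grad_add[OF has_grad_mult[OF has_grad_diff[OF
    has_grad_add[OF has_grad_mult[OF has_grad_mult[OF has_grad_mult[OF grad_f1 grad_lin2] grad_R] grad_x1] has_grad_mult[OF grad_f grad_zero]]
    has_grad_add[OF has_grad_mult[OF has_grad_mult[OF has_grad_mult[OF grad_g1 grad_lin2] grad_R] grad_x2] has_grad_mult[OF grad_g grad_one]]] grad_R]
    has_grad_mult[OF grad_num1 has_grad_mult[OF has_grad_mult[OF grad_minus_two grad_x2] grad_RR]], folded d2_u1_def]
lemmas grad_d1_u2 = has_grad_add[OF has_grad_mult[OF has_grad_add[OF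
    has_grad_add[OF has_grad_mult[OF has_grad_mult[OF has_grad_mult[OF grad_f1 grad_lin1] grad_R] grad_x2] has_grad_mult[OF grad_f grad_zero]]
    has_grad_add[OF has_grad_mult[OF has_grad_mult[OF has_grad_mult[OF grad_g1 grad_lin1] grad_R] grad_x1] has_grad_mult[OF grad_g grad_one]]] grad_R]
    has_grad_mult[OF grad_num2 has_grad_mult[OF has_grad_mult[OF grad_minus_two grad_x1] grad_RR]], folded d1_u2_def]
lemmas grad_d2_u2 = has_grad_add[OF has_grad_mult[OF has_grad_add[OF
    has_grad_add[OF has_grad_mult[OF has_grad_mult[OF has_grad_mult[OF grad_f1 grad_lin2] grad_R] grad_x2] has_grad_mult[OF grad_f grad_one]]
    has_grad_add[OF has_grad_mult[OF has_grad_mult[OF has_grad_mult[OF grad_g1 grad_lin2] grad_R] grad_x1] has_grad_mult[OF grad_g grad_zero]]] grad_R]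
    has_grad_mult[OF grad_num2 has_grad_mult[OF has_grad_mult[OF grad_minus_two grad_x2] grad_RR]], folded d2_u2_def]

end

text \<open>For a spiral field, the vector \<open>\<Delta>u - (u \<cdot> \<nabla>)u\<close> is \<open>(radial_part(z) e_r + angular_part(z) e_\<theta>) / r\<^sup>3\<close>.\<close>

definition radial_part :: "real \<Rightarrow> real" where
  "radial_part z = (1 + a\<^sup>2) * f2 z - 2 * a * f1 z - 2 * g1 z
     - (f z * (a * f1 z - f z) + g z * f1 z - (g z)\<^sup>2)"
definition angular_part :: "real \<Rightarrow> real" where
  "angular_part z = (1 + a\<^sup>2) * g2 z - 2 * a * g1 z + 2 * f1 z - (a * f z + g z) * g1 z"

lemma div_spiral_field:
  assumes "x \<noteq> 0"
  shows "div_field (spiral_field a \<theta>\<^sub>0 f g) x = (a * S f1 x + S g1 x) * inv_sq x"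
proof -
  have "div_field (spiral_field a \<theta>\<^sub>0 f g) x = d1_u1 x + d2_u2 x"
    using has_grad_partial[OF grad_spiral_field[OF assms]] by (simp add: div_field_def sum_2)
  also have "\<dots> = (a * S f1 x + S g1 x) * inv_sq x"
    unfolding d1_u1_def d2_u2_def using inv_sq_mult[OF assms] by algebra
  finally show ?thesis .
qed

text \<open>Once the second derivatives are expanded, the claim is a polynomial identity in the coordinates, the
  values of the profiles and \<open>inv_sq x\<close>, modulo the relation \<open>inv_sq x * (x\<^sub>1\<^sup>2 + x\<^sub>2\<^sup>2) = 1\<close>.\<close>

lemma momentum_spiral_field:
  assumes x: "x \<noteq> 0"
  shows "laplacian (spiral_field a \<theta>\<^sub>0 f g) x - convective (spiral_field a \<theta>\<^sub>0 f g) (spiral_field a \<theta>\<^sub>0 f g) x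
    = vector [(S radial_part x * x $ 1 - S angular_part x * x $ 2) * (inv_sq x)\<^sup>2,
       (S radial_part x * x $ 2 + S angular_part x * x $ 1) * (inv_sq x)\<^sup>2]"
proof -
  let ?u = "spiral_field a \<theta>\<^sub>0 f g"
  have p1: "\<forall>y. y \<noteq> 0 \<longrightarrow> partial_deriv 1 ?u y = vector [d1_u1 y, d1_u2 y]"
    and p2: "\<forall>y. y \<noteq> 0 \<longrightarrow> partial_deriv 2 ?u y = vector [d2_u1 y, d2_u2 y]"
    using has_grad_partial[OF grad_spiral_field] by auto
  note q1 = partial_deriv_cong(1)[OF p1 x has_grad_vector[OF grad_d1_u1[OF x] grad_d1_u2[OF x]]]
  note q2 = partial_deriv_cong(2)[OF p2 x has_grad_vector[OF grad_d2_u1[OF x] grad_d2_u2[OF x]]]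
  note r = inv_sq_mult[OF x]
  show ?thesis
    unfolding laplacian_def convective_def sum_2 q1 q2 p1[rule_format, OF x] p2[rule_format, OF x]
    unfolding vec_eq_iff forall_2
      spiral_field_def Let_def d1_u1_def d2_u1_def d1_u2_def d2_u2_def radial_part_def angular_part_def
      vector_2 vector_add_component vector_minus_component vector_scaleR_component real_scaleR_def
    by (intro conjI) (use r in algebra)+
qed

end

text \<open>The gradient of \<open>G(z) / r\<^sup>2\<close> is \<open>((a G' - 2 G) e_r + G' e_\<theta>) / r\<^sup>3\<close>. Matching it with the momentum
  equation forces \<open>G' = angular_part\<close>, and what remains is a condition on \<open>radial_part\<close>.\<close>

lemma grad_spiral_pressure:
  assumes x: "x \<noteq> 0" and per: "\<And>z. G (z + 2 * pi) = G z"
    and d: "\<And>z. (G has_real_derivative G1 z) (at z)"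
  shows "has_grad (\<lambda>x. G (spiral_coord a \<theta>\<^sub>0 x) * inv_sq x) x
    (((a * G1 (spiral_coord a \<theta>\<^sub>0 x) - 2 * G (spiral_coord a \<theta>\<^sub>0 x)) * x $ 1
      - G1 (spiral_coord a \<theta>\<^sub>0 x) * x $ 2) * (inv_sq x)\<^sup>2)
    (((a * G1 (spiral_coord a \<theta>\<^sub>0 x) - 2 * G (spiral_coord a \<theta>\<^sub>0 x)) * x $ 2
      + G1 (spiral_coord a \<theta>\<^sub>0 x) * x $ 1) * (inv_sq x)\<^sup>2)"
  using has_grad_mult[OF has_grad_spiral[OF x, where \<psi> = G and a = a and \<theta>\<^sub>0 = \<theta>\<^sub>0, OF per d]
      has_grad_inv_sq[OF x]]
  by (rule has_grad_eq) (simp_all add: algebra_simps power2_eq_square)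

section \<open>Smoothness, decay, invariance and flux of spiral fields\<close>

lemma C_k_on_cong:
  assumes "open S" "\<And>x. x \<in> S \<Longrightarrow> f x = g x" "C_k_on k f S"
  shows "C_k_on k g S"
  using assms(2,3)
proof (induction k arbitrary: f g)
  case 0
  then show ?case using continuous_on_cong[of S S f g] by simp
next
  case (Suc k)
  have d: "f differentiable at x" if "x \<in> S" for x using Suc.prems(2) that by simp
  have "g differentiable at x" if "x \<in> S" for x
    using d[OF that] Suc.prems(1) has_derivative_transform_within_open[OF _ assms(1) that]
    unfolding differentiable_def by blast
  moreover have "C_k_on k (\<lambda>x. frechet_derivative g (at x) v) S" for v
  proof (rule Suc.IH)
    show "C_k_on k (\<lambda>x. frechet_derivative f (at x) v) S" using Suc.prems(2) by simp
    show "frechet_derivative f (at x) v = frechet_derivative g (at x) v" if "x \<in> S" for x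
      using frechet_derivative_transform_within_open[OF d[OF that] assms(1) that Suc.prems(1)] by simp
  qed
  ultimately show ?case by simp
qed

text \<open>Smoothness by coinduction: a class of differentiable functions whose directional derivatives stay
  in the class consists of smooth functions.\<close>

lemma smooth_onI_closed_class:
  assumes "open S" and "P f"
    and diff: "\<And>f x. P f \<Longrightarrow> x \<in> S \<Longrightarrow> f differentiable at x"
    and closed: "\<And>f v. P f \<Longrightarrow> \<exists>g. P g \<and> (\<forall>x\<in>S. frechet_derivative f (at x) v = g x)"
  shows "smooth_on f S"
proof -
  have "C_k_on k f S" for k
    using \<open>P f\<close>
  proof (induction k arbitrary: f)
    case 0
    then show ?case
      using diff by (auto intro!: continuous_at_imp_continuous_on differentiable_imp_continuous_within)
  next
    case (Suc k)
    have "C_k_on k (\<lambda>x. frechet_derivative f (at x) v) S" for v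
    proof -
      obtain g where g: "P g" "\<forall>x\<in>S. frechet_derivative f (at x) v = g x"
        using closed[OF Suc.prems] by blast
      show ?thesis
        by (rule C_k_on_cong[OF assms(1) _ Suc.IH[OF g(1)]]) (use g(2) in simp)
    qed
    then show ?case using diff Suc.prems by simp
  qed
  then show ?thesis by (simp add: smooth_on_def)
qed

text \<open>Such a class for the fields at hand. When \<open>\<phi>''\<close> is a quadratic polynomial in \<open>\<phi>\<close>, as for the profile
  equation, the ring generated by the coordinates, \<open>1 / r\<^sup>2\<close>, \<open>\<phi>(z)\<close> and \<open>\<phi>'(z)\<close> is closed under
  partial derivatives.\<close>

inductive spiral_ring :: "real \<Rightarrow> real \<Rightarrow> (real \<Rightarrow> real) \<Rightarrow> (real \<Rightarrow> real) \<Rightarrow> (real^2 \<Rightarrow> real) \<Rightarrow> bool"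
  for a \<theta>\<^sub>0 \<phi> \<phi>' where
    const: "spiral_ring a \<theta>\<^sub>0 \<phi> \<phi>' (\<lambda>x. c)"
  | coord1: "spiral_ring a \<theta>\<^sub>0 \<phi> \<phi>' (\<lambda>x. x $ 1)"
  | coord2: "spiral_ring a \<theta>\<^sub>0 \<phi> \<phi>' (\<lambda>x. x $ 2)"
  | inv: "spiral_ring a \<theta>\<^sub>0 \<phi> \<phi>' inv_sq"
  | profile: "spiral_ring a \<theta>\<^sub>0 \<phi> \<phi>' (\<lambda>x. \<phi> (spiral_coord a \<theta>\<^sub>0 x))"
  | profile': "spiral_ring a \<theta>\<^sub>0 \<phi> \<phi>' (\<lambda>x. \<phi>' (spiral_coord a \<theta>\<^sub>0 x))"
  | add: "spiral_ring a \<theta>\<^sub>0 \<phi> \<phi>' p \<Longrightarrow> spiral_ring a \<theta>\<^sub>0 \<phi> \<phi>' q \<Longrightarrow>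
      spiral_ring a \<theta>\<^sub>0 \<phi> \<phi>' (\<lambda>x. p x + q x)"
  | mult: "spiral_ring a \<theta>\<^sub>0 \<phi> \<phi>' p \<Longrightarrow> spiral_ring a \<theta>\<^sub>0 \<phi> \<phi>' q \<Longrightarrow>
      spiral_ring a \<theta>\<^sub>0 \<phi> \<phi>' (\<lambda>x. p x * q x)"

lemma spiral_ring_diff:
  assumes "spiral_ring a \<theta>\<^sub>0 \<phi> \<phi>' p" "spiral_ring a \<theta>\<^sub>0 \<phi> \<phi>' q"
  shows "spiral_ring a \<theta>\<^sub>0 \<phi> \<phi>' (\<lambda>x. p x - q x)"
  using spiral_ring.add[OF assms(1) spiral_ring.mult[OF spiral_ring.const[where c = "- 1"] assms(2)]]
  by simp

lemmas spiral_ring_intros = spiral_ring.intros spiral_ring_diff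

lemma spiral_ring_grad:
  assumes \<phi>: "\<And>z. (\<phi> has_real_derivative \<phi>' z) (at z)"
    and \<phi>': "\<And>z. (\<phi>' has_real_derivative \<alpha> * (\<phi> z * \<phi> z) + \<beta> * \<phi> z + c) (at z)"
    and per: "\<And>z. \<phi> (z + 2 * pi) = \<phi> z"
    and "spiral_ring a \<theta>\<^sub>0 \<phi> \<phi>' f"
  shows "\<exists>p q. spiral_ring a \<theta>\<^sub>0 \<phi> \<phi>' p \<and> spiral_ring a \<theta>\<^sub>0 \<phi> \<phi>' q \<and>
    (\<forall>x. x \<noteq> 0 \<longrightarrow> has_grad f x (p x) (q x))"
  using assms(4)
proof induction
  case (const c)
  show ?case
    by (intro exI conjI allI impI) (rule spiral_ring.const, rule spiral_ring.const, rule has_grad_const)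
next
  case coord1
  show ?case
    by (intro exI conjI allI impI) (rule spiral_ring.const, rule spiral_ring.const, rule has_grad_coord(1))
next
  case coord2
  show ?case
    by (intro exI conjI allI impI) (rule spiral_ring.const, rule spiral_ring.const, rule has_grad_coord(2))
next
  case inv
  show ?case
    by (rule exI[of _ "\<lambda>x. - 2 * x $ 1 * (inv_sq x * inv_sq x)"],
        rule exI[of _ "\<lambda>x. - 2 * x $ 2 * (inv_sq x * inv_sq x)"],
        intro conjI allI impI spiral_ring.intros)
      (use has_grad_inv_sq in \<open>simp add: power2_eq_square\<close>)
next
  case profile
  show ?case
    by (rule exI[of _ "\<lambda>x. \<phi>' (spiral_coord a \<theta>\<^sub>0 x) * (a * x $ 1 - x $ 2) * inv_sq x"],
        rule exI[of _ "\<lambda>x. \<phi>' (spiral_coord a \<theta>\<^sub>0 x) * (a * x $ 2 + x $ 1) * inv_sq x"],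
        intro conjI allI impI spiral_ring_intros has_grad_spiral \<phi> per)
next
  case profile'
  have per': "\<phi>' (z + 2 * pi) = \<phi>' z" for z
    using periodic_deriv[of \<phi> \<phi>' "2 * pi"] \<phi> per by blast
  define \<phi>'' where "\<phi>'' = (\<lambda>z. \<alpha> * (\<phi> z * \<phi> z) + \<beta> * \<phi> z + c)"
  have d: "(\<phi>' has_real_derivative \<phi>'' z) (at z)" for z
    unfolding \<phi>''_def by (rule \<phi>')
  have r: "spiral_ring a \<theta>\<^sub>0 \<phi> \<phi>' (\<lambda>x. \<phi>'' (spiral_coord a \<theta>\<^sub>0 x))"
    unfolding \<phi>''_def by (intro spiral_ring_intros)
  show ?case
    by (rule exI[of _ "\<lambda>x. \<phi>'' (spiral_coord a \<theta>\<^sub>0 x) * (a * x $ 1 - x $ 2) * inv_sq x"],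
        rule exI[of _ "\<lambda>x. \<phi>'' (spiral_coord a \<theta>\<^sub>0 x) * (a * x $ 2 + x $ 1) * inv_sq x"],
        intro conjI allI impI spiral_ring_intros r has_grad_spiral d per')
next
  case (add p q)
  then obtain p1 p2 q1 q2 where
    r: "spiral_ring a \<theta>\<^sub>0 \<phi> \<phi>' p1" "spiral_ring a \<theta>\<^sub>0 \<phi> \<phi>' p2"
       "spiral_ring a \<theta>\<^sub>0 \<phi> \<phi>' q1" "spiral_ring a \<theta>\<^sub>0 \<phi> \<phi>' q2"
    and g: "\<And>x. x \<noteq> 0 \<Longrightarrow> has_grad p x (p1 x) (p2 x)" "\<And>x. x \<noteq> 0 \<Longrightarrow> has_grad q x (q1 x) (q2 x)"
    by blast
  show ?case
    by (rule exI[of _ "\<lambda>x. p1 x + q1 x"], rule exI[of _ "\<lambda>x. p2 x + q2 x"], intro conjI allI impI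
        spiral_ring_intros r has_grad_add g)
next
  case (mult p q)
  then obtain p1 p2 q1 q2 where
    r: "spiral_ring a \<theta>\<^sub>0 \<phi> \<phi>' p1" "spiral_ring a \<theta>\<^sub>0 \<phi> \<phi>' p2"
       "spiral_ring a \<theta>\<^sub>0 \<phi> \<phi>' q1" "spiral_ring a \<theta>\<^sub>0 \<phi> \<phi>' q2"
    and g: "\<And>x. x \<noteq> 0 \<Longrightarrow> has_grad p x (p1 x) (p2 x)" "\<And>x. x \<noteq> 0 \<Longrightarrow> has_grad q x (q1 x) (q2 x)"
    by blast
  show ?case
    by (rule exI[of _ "\<lambda>x. p1 x * q x + p x * q1 x"], rule exI[of _ "\<lambda>x. p2 x * q x + p x * q2 x"],
        intro conjI allI impI spiral_ring_intros r mult.hyps has_grad_mult g)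
qed

lemma spiral_ring_smooth:
  assumes \<phi>: "\<And>z. (\<phi> has_real_derivative \<phi>' z) (at z)"
    and \<phi>': "\<And>z. (\<phi>' has_real_derivative \<alpha> * (\<phi> z * \<phi> z) + \<beta> * \<phi> z + c) (at z)"
    and per: "\<And>z. \<phi> (z + 2 * pi) = \<phi> z"
  shows "spiral_ring a \<theta>\<^sub>0 \<phi> \<phi>' f \<Longrightarrow> smooth_on f (- {0})"
    and "spiral_ring a \<theta>\<^sub>0 \<phi> \<phi>' p \<Longrightarrow> spiral_ring a \<theta>\<^sub>0 \<phi> \<phi>' q \<Longrightarrow>
      smooth_on (\<lambda>x. vector [p x, q x] :: real^2) (- {0})"
proof -
  let ?P = "spiral_ring a \<theta>\<^sub>0 \<phi> \<phi>'"
  note grad = spiral_ring_grad[OF \<phi> \<phi>' per, of a \<theta>\<^sub>0]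
  show "smooth_on f (- {0})" if "?P f"
  proof (rule smooth_onI_closed_class[of _ ?P, OF _ that])
    fix f assume "?P f"
    then obtain p q where pq: "?P p" "?P q" "\<And>x. x \<noteq> 0 \<Longrightarrow> has_grad f x (p x) (q x)"
      using grad by blast
    show "f differentiable at x" if "x \<in> - {0}" for x
      using pq(3)[of x] that unfolding differentiable_def by blast
    show "\<exists>g. ?P g \<and> (\<forall>x\<in>- {0}. frechet_derivative f (at x) v = g x)" for v
      using pq(3)[THEN frechet_derivative_at, symmetric]
      by (intro exI[of _ "\<lambda>x. v $ 1 * p x + v $ 2 * q x"] conjI spiral_ring_intros pq) auto
  qed (simp add: open_Compl)
  let ?Q = "\<lambda>h::real^2 \<Rightarrow> real^2. \<exists>p q. ?P p \<and> ?P q \<and> h = (\<lambda>x. vector [p x, q x])"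
  show "smooth_on (\<lambda>x. vector [p x, q x] :: real^2) (- {0})" if "?P p" "?P q"
  proof (rule smooth_onI_closed_class[of _ ?Q])
    show "?Q (\<lambda>x. vector [p x, q x])" using that by blast
    fix h :: "real^2 \<Rightarrow> real^2" assume "?Q h"
    then obtain p q where h: "?P p" "?P q" "h = (\<lambda>x. vector [p x, q x])" by blast
    obtain p1 p2 where p: "?P p1" "?P p2" "\<And>x. x \<noteq> 0 \<Longrightarrow> has_grad p x (p1 x) (p2 x)"
      using grad[OF h(1)] by blast
    obtain q1 q2 where q: "?P q1" "?P q2" "\<And>x. x \<noteq> 0 \<Longrightarrow> has_grad q x (q1 x) (q2 x)"
      using grad[OF h(2)] by blast
    have g: "has_grad h x (vector [p1 x, q1 x]) (vector [p2 x, q2 x])" if "x \<noteq> 0" for x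
      unfolding h(3) by (rule has_grad_vector[OF p(3)[OF that] q(3)[OF that]])
    show "h differentiable at x" if "x \<in> - {0}" for x
      using g[of x] that unfolding differentiable_def by blast
    show "\<exists>g. ?Q g \<and> (\<forall>x\<in>- {0}. frechet_derivative h (at x) v = g x)" for v
    proof (rule exI[of _ "\<lambda>x. vector [v $ 1 * p1 x + v $ 2 * p2 x, v $ 1 * q1 x + v $ 2 * q2 x]"],
        intro conjI ballI)
      show "?Q (\<lambda>x. vector [v $ 1 * p1 x + v $ 2 * p2 x, v $ 1 * q1 x + v $ 2 * q2 x])"
        by (rule exI[of _ "\<lambda>x. v $ 1 * p1 x + v $ 2 * p2 x"],
            rule exI[of _ "\<lambda>x. v $ 1 * q1 x + v $ 2 * q2 x"], intro conjI spiral_ring_intros p q refl)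
      fix x :: "real^2" assume "x \<in> - {0}"
      then show "frechet_derivative h (at x) v
          = vector [v $ 1 * p1 x + v $ 2 * p2 x, v $ 1 * q1 x + v $ 2 * q2 x]"
        using g[of x, THEN frechet_derivative_at, symmetric] by (simp add: vec_eq_iff forall_2)
    qed
  qed (simp add: open_Compl)
qed

lemma spiral_field_tendsto_0:
  assumes "\<And>z. \<bar>f z\<bar> \<le> M" "\<And>z. \<bar>g z\<bar> \<le> M"
  shows "(spiral_field a \<theta>\<^sub>0 f g \<longlongrightarrow> 0) at_infinity"
proof (rule Lim_null_comparison)
  show "\<forall>\<^sub>F x in at_infinity. norm (spiral_field a \<theta>\<^sub>0 f g x) \<le> 4 * M * inverse (norm x)"
  proof (rule always_eventually, rule allI)
    fix x :: "real^2"
    let ?z = "spiral_coord a \<theta>\<^sub>0 x"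
    have M: "0 \<le> M" using assms(1)[of 0] by simp
    have i0: "0 \<le> inv_sq x" by (simp add: inv_sq_norm)
    have c: "\<bar>x $ 1\<bar> \<le> norm x" "\<bar>x $ 2\<bar> \<le> norm x" using component_le_norm_cart by auto
    have b: "\<bar>p * r + s * q\<bar> \<le> 2 * M * norm x" if "\<bar>p\<bar> \<le> M" "\<bar>s\<bar> \<le> M" "\<bar>r\<bar> \<le> norm x" "\<bar>q\<bar> \<le> norm x"
      for p q r s
    proof -
      have "\<bar>p * r\<bar> \<le> M * norm x" "\<bar>s * q\<bar> \<le> M * norm x"
        unfolding abs_mult using that M by (intro mult_mono; simp)+
      then show ?thesis by linarith
    qed
    have "norm (spiral_field a \<theta>\<^sub>0 f g x) \<le> (\<Sum>i\<in>UNIV. \<bar>spiral_field a \<theta>\<^sub>0 f g x $ i\<bar>)"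
      by (rule norm_le_l1_cart)
    also have "\<dots> = (\<bar>f ?z * x $ 1 + - g ?z * x $ 2\<bar> + \<bar>f ?z * x $ 2 + g ?z * x $ 1\<bar>) * inv_sq x"
      by (simp only: sum_2 spiral_field_def Let_def vector_2 abs_mult abs_of_nonneg[OF i0])
        (simp only: distrib_right[symmetric] mult_minus_left diff_conv_add_uminus)
    also have "\<dots> \<le> (2 * M * norm x + 2 * M * norm x) * inv_sq x"
      using assms[of ?z] c by (intro add_mono mult_right_mono b) (simp_all add: inv_sq_norm)
    also have "\<dots> = 4 * M * inverse (norm x)"
      by (cases "x = 0") (simp_all add: inv_sq_norm field_simps power2_eq_square)
    finally show "norm (spiral_field a \<theta>\<^sub>0 f g x) \<le> 4 * M * inverse (norm x)" .
  qed
  have "((\<lambda>x::real^2. inverse (norm x)) \<longlongrightarrow> 0) at_infinity"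
    by (rule tendsto_inverse_0_at_top[OF filterlim_norm_at_top])
  then show "((\<lambda>x::real^2. 4 * M * inverse (norm x)) \<longlongrightarrow> 0) at_infinity"
    by (rule tendsto_mult_right_zero)
qed

lemma rot_vec: "rot \<alpha> *v x = vector [cos \<alpha> * x $ 1 - sin \<alpha> * x $ 2, sin \<alpha> * x $ 1 + cos \<alpha> * x $ 2]"
  by (simp add: rot_def vec_eq_iff forall_2 matrix_vector_mult_def sum_2)

lemma matrix_inv_rot: "matrix_inv (rot \<alpha>) = rot (- \<alpha>)"
proof -
  have inv: "rot \<alpha> ** rot (- \<alpha>) = mat 1" for \<alpha>
    by (simp add: rot_def vec_eq_iff forall_2 matrix_matrix_mult_def sum_2 mat_def
        power2_eq_square[symmetric] mult.commute)
  have inv': "rot (- \<alpha>) ** rot \<alpha> = mat 1" using inv[of "- \<alpha>"] by simp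
  have "rot \<alpha> ** matrix_inv (rot \<alpha>) = mat 1"
    unfolding matrix_inv_def by (rule someI2[of _ "rot (- \<alpha>)"]) (use inv inv' in auto)
  then show ?thesis
    by (metis inv' matrix_mul_assoc matrix_mul_lid matrix_mul_rid)
qed

lemma to_complex_rot: "to_complex (rot \<alpha> *v x) = exp (\<i> * of_real \<alpha>) * to_complex x"
  by (simp add: rot_vec to_complex_def complex_eq_iff exp_eq_polar Re_exp Im_exp)

lemma to_complex_scale: "s > 0 \<Longrightarrow> to_complex (s *\<^sub>R x) = exp (of_real (ln s)) * to_complex x"
  by (simp add: to_complex_def complex_eq_iff exp_of_real)

lemma spiral_field_invariant:
  assumes per: "\<And>z. f (z + 2 * pi) = f z" "\<And>z. g (z + 2 * pi) = g z"
  shows "scale_invariant_up_to_rotation (\<lambda>s. - a * ln s) (spiral_field a \<theta>\<^sub>0 f g)"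
  unfolding scale_invariant_up_to_rotation_def
proof (intro conjI allI impI)
  show "(\<lambda>s. - a * ln s) C1_differentiable_on {0<..}"
    unfolding C1_differentiable_on_def
    by (intro exI[of _ "\<lambda>s. - a * (1 / s)"] conjI ballI continuous_intros)
      (auto simp: has_real_derivative_iff_has_vector_derivative[symmetric] intro!: derivative_eq_intros)
next
  fix s :: real and x :: "real^2" assume s: "s > 0" and x: "x \<noteq> 0"
  define \<alpha> where "\<alpha> = a * ln s"
  define y where "y = rot \<alpha> *v x"
  let ?z = "spiral_coord a \<theta>\<^sub>0 x"
  have zs: "\<psi> (spiral_coord a \<theta>\<^sub>0 (s *\<^sub>R x)) = \<psi> (?z + \<alpha>)" if "\<And>z. \<psi> (z + 2 * pi) = \<psi> z" for \<psi> :: "real \<Rightarrow> real"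
    using spiral_coord_mult[OF x to_complex_scale[OF s], where \<psi> = \<psi>, OF that] by (simp add: \<alpha>_def)
  have zy: "\<psi> (spiral_coord a \<theta>\<^sub>0 y) = \<psi> (?z + \<alpha>)" if "\<And>z. \<psi> (z + 2 * pi) = \<psi> z" for \<psi> :: "real \<Rightarrow> real"
    using spiral_coord_mult[OF x to_complex_rot, where \<psi> = \<psi>, OF that] by (simp add: y_def)
  note zf = zs[where \<psi> = f, OF per(1)] zy[where \<psi> = f, OF per(1)]
  note zg = zs[where \<psi> = g, OF per(2)] zy[where \<psi> = g, OF per(2)]
  have ny: "inv_sq y = inv_sq x"
  proof -
    have "cmod (to_complex y) = cmod (to_complex x)" by (simp add: y_def to_complex_rot norm_mult)
    then show ?thesis by (simp add: norm_to_complex inv_sq_norm)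
  qed
  have ns: "s * (p * (s * q) - p' * (s * q')) * inv_sq (s *\<^sub>R x) = (p * q - p' * q') * inv_sq x" for p q p' q'
    using s x by (simp add: inv_sq_norm power_mult_distrib power2_eq_square field_simps)
  have y: "y $ 1 = cos \<alpha> * x $ 1 - sin \<alpha> * x $ 2" "y $ 2 = sin \<alpha> * x $ 1 + cos \<alpha> * x $ 2"
    by (simp_all add: y_def rot_vec)
  have cs: "(cos \<alpha>)\<^sup>2 = 1 - (sin \<alpha>)\<^sup>2" by (simp add: cos_squared_eq)
  have "s *\<^sub>R spiral_field a \<theta>\<^sub>0 f g (s *\<^sub>R x) = vector
     [(f (?z + \<alpha>) * x $ 1 - g (?z + \<alpha>) * x $ 2) * inv_sq x,
      (f (?z + \<alpha>) * x $ 2 + g (?z + \<alpha>) * x $ 1) * inv_sq x]"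
    using ns[of "f (?z + \<alpha>)" "x $ 1" "g (?z + \<alpha>)" "x $ 2"] ns[of "f (?z + \<alpha>)" "x $ 2" "- g (?z + \<alpha>)" "x $ 1"]
    by (simp add: vec_eq_iff forall_2 spiral_field_def Let_def zf(1) zg(1) mult.assoc)
  also have "\<dots> = rot (- \<alpha>) *v spiral_field a \<theta>\<^sub>0 f g y"
    unfolding spiral_field_def Let_def zf(2) zg(2) ny rot_vec vector_2 vec_eq_iff forall_2
      y cos_minus sin_minus
    by (intro conjI) (use cs in algebra)+
  also have "\<dots> = matrix_inv (rot \<alpha>) *v spiral_field a \<theta>\<^sub>0 f g (rot \<alpha> *v x)"
    by (simp add: matrix_inv_rot y_def)
  finally show "s *\<^sub>R spiral_field a \<theta>\<^sub>0 f g (s *\<^sub>R x) =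
      matrix_inv (rot (- (- a * ln s))) *v spiral_field a \<theta>\<^sub>0 f g (rot (- (- a * ln s)) *v x)"
    by (simp add: \<alpha>_def)
qed

text \<open>The flux form is closed, but its potential is multivalued. With \<open>\<mu> = \<Phi> / (2 \<pi>)\<close>, subtracting \<open>\<mu> z\<close>
  from the primitive \<open>F\<close> of \<open>f\<close> leaves a periodic function \<open>P\<close>, so \<open>P(z)\<close> is single-valued and
  contributes nothing along a loop. The rest of the form is a combination of \<open>d\<theta>\<close> and \<open>d log r\<close>, the
  imaginary and real parts of \<open>\<omega> = \<gamma>' / \<gamma>\<close>, whose integral is \<open>2 \<pi> \<i>\<close> by the winding number.\<close>

lemma spiral_field_flux:
  assumes F: "\<And>z. (F has_real_derivative f z) (at z)" "\<And>z. F (z + 2 * pi) = F z + \<Phi>"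
    and per: "\<And>z. f (z + 2 * pi) = f z" and g: "\<And>z. g z = k - a * f z"
  shows "has_flux (spiral_field a \<theta>\<^sub>0 f g) \<Phi>"
  unfolding has_flux_def Let_def
proof (intro allI impI)
  fix \<gamma> assume \<gamma>: "simple_loop_around_origin \<gamma>"
  have C1: "\<gamma> piecewise_C1_differentiable_on {0..1}" and ends: "\<gamma> 1 = \<gamma> 0"
    and ins: "0 \<in> inside (path_image \<gamma>)" and w1: "winding_number (to_complex \<circ> \<gamma>) 0 = 1"
    using \<gamma> by (auto simp: simple_loop_around_origin_def pathfinish_def pathstart_def)
  have nz: "\<gamma> t \<noteq> 0" if "t \<in> {0..1}" for t
  proof -
    have "0 \<notin> path_image \<gamma>" using ins inside_no_overlap by blast
    then show ?thesis using that by (force simp: path_image_def)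
  qed
  obtain T D where T: "finite T" and cont: "continuous_on {0..1} \<gamma>"
    and D: "\<And>t. t \<in> {0..1} - T \<Longrightarrow> (\<gamma> has_vector_derivative D t) (at t)"
    and cD: "continuous_on ({0..1} - T) D"
    using C1 unfolding piecewise_C1_differentiable_on_def C1_differentiable_on_def by metis
  have bl: "bounded_linear to_complex"
  proof -
    have eq: "to_complex = (\<lambda>x. (x $ 1) *\<^sub>R 1 + (x $ 2) *\<^sub>R \<i>)"
      by (auto simp: to_complex_def fun_eq_iff complex_eq_iff)
    show ?thesis
      unfolding eq by (intro bounded_linear_add bounded_linear_compose[OF bounded_linear_scaleR_left]
          bounded_linear_vec_nth)
  qed
  have dtc: "((to_complex \<circ> \<gamma>) has_vector_derivative to_complex (D t)) (at t)" if "t \<in> {0..1} - T" for t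
    using bounded_linear.has_vector_derivative[OF bl D[OF that]] by (simp add: o_def)
  have vp: "valid_path (to_complex \<circ> \<gamma>)"
    unfolding valid_path_def piecewise_C1_differentiable_on_def C1_differentiable_on_def
  proof (intro conjI exI[of _ T] T exI[of _ "to_complex \<circ> D"] ballI)
    show "continuous_on {0..1} (to_complex \<circ> \<gamma>)" "continuous_on ({0..1} - T) (to_complex \<circ> D)"
      unfolding o_def using bounded_linear.continuous_on[OF bl] cont cD by blast+
  qed (use dtc in simp)
  have notin: "0 \<notin> path_image (to_complex \<circ> \<gamma>)"
    using nz by (auto simp: path_image_def)
  define \<omega> where "\<omega> = (\<lambda>t. to_complex (D t) / to_complex (\<gamma> t))"
  have "((\<lambda>w. 1 / (w - 0)) has_contour_integral (2 * pi * \<i> * winding_number (to_complex \<circ> \<gamma>) 0)) (to_complex \<circ> \<gamma>)"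
    by (rule has_contour_integral_winding_number[OF vp notin])
  then have "((\<lambda>t. 1 / to_complex (\<gamma> t) * vector_derivative (to_complex \<circ> \<gamma>) (at t within {0..1}))
      has_integral (2 * pi * \<i>)) {0..1}"
    by (simp add: has_contour_integral_def w1)
  then have i\<omega>: "(\<omega> has_integral (2 * pi * \<i>)) {0..1}"
  proof (rule has_integral_spike_finite[OF T, rotated])
    fix t assume t: "t \<in> {0..1} - T"
    then show "\<omega> t = 1 / to_complex (\<gamma> t) * vector_derivative (to_complex \<circ> \<gamma>) (at t within {0..1})"
      using vector_derivative_at_within_ivl[OF dtc[OF t], of 0 1] by (simp add: \<omega>_def)
  qed
  have iRe: "((\<lambda>t. Re (\<omega> t)) has_integral 0) {0..1}" and iIm: "((\<lambda>t. Im (\<omega> t)) has_integral 2 * pi) {0..1}"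
    using has_integral_linear[OF i\<omega> bounded_linear_Re] has_integral_linear[OF i\<omega> bounded_linear_Im]
    by (simp_all add: o_def)
  define \<mu> where "\<mu> = \<Phi> / (2 * pi)"
  define P where "P = (\<lambda>z. F z - \<mu> * z)"
  have dP: "(P has_real_derivative f z - \<mu>) (at z)" for z
    unfolding P_def by (auto intro!: derivative_eq_intros F)
  have perP: "P (z + 2 * pi) = P z" for z
  proof -
    have "\<mu> * (2 * pi) = \<Phi>" by (simp add: \<mu>_def)
    then show ?thesis using F(2)[of z] by (simp add: P_def distrib_left)
  qed
  define Q where "Q = (\<lambda>x. P (spiral_coord a \<theta>\<^sub>0 x))"
  note gQ = has_grad_spiral[where \<psi> = P and a = a and \<theta>\<^sub>0 = \<theta>\<^sub>0, OF _ perP dP, folded Q_def]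
  define q where "q = (\<lambda>t. (f (spiral_coord a \<theta>\<^sub>0 (\<gamma> t)) - \<mu>) * (Im (\<omega> t) + a * Re (\<omega> t)))"
  have \<omega>: "Re (\<omega> t) = (\<gamma> t $ 1 * D t $ 1 + \<gamma> t $ 2 * D t $ 2) * inv_sq (\<gamma> t)"
      "Im (\<omega> t) = (\<gamma> t $ 1 * D t $ 2 - \<gamma> t $ 2 * D t $ 1) * inv_sq (\<gamma> t)" for t
    by (simp_all add: \<omega>_def to_complex_def Re_divide Im_divide inv_sq_def mult.commute)
  have "(q has_integral (Q (\<gamma> 1) - Q (\<gamma> 0))) {0..1}"
  proof (rule fundamental_theorem_of_calculus_interior_strong[OF T])
    fix t :: real assume t: "t \<in> {0<..<1} - T"
    have "((\<lambda>t. Q (\<gamma> t)) has_derivative (\<lambda>h. (h *\<^sub>R D t) $ 1 *\<^sub>R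
        ((f (spiral_coord a \<theta>\<^sub>0 (\<gamma> t)) - \<mu>) * (a * \<gamma> t $ 1 - \<gamma> t $ 2) * inv_sq (\<gamma> t)) +
      (h *\<^sub>R D t) $ 2 *\<^sub>R
        ((f (spiral_coord a \<theta>\<^sub>0 (\<gamma> t)) - \<mu>) * (a * \<gamma> t $ 2 + \<gamma> t $ 1) * inv_sq (\<gamma> t)))) (at t)"
      by (rule has_derivative_compose[OF _ gQ])
        (use D[of t] nz[of t] t in \<open>auto simp: has_vector_derivative_def\<close>)
    then show "((\<lambda>t. Q (\<gamma> t)) has_vector_derivative q t) (at t)"
      unfolding has_vector_derivative_def
      by (rule has_derivative_eq_rhs) (simp add: fun_eq_iff q_def \<omega> algebra_simps)
  next
    have "continuous_on (- {0}) Q"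
      using gQ by (intro continuous_at_imp_continuous_on) (auto intro: has_derivative_continuous)
    then show "continuous_on {0..1} (\<lambda>t. Q (\<gamma> t))"
      by (rule continuous_on_compose2[OF _ cont]) (use nz in auto)
  qed simp
  then have "(q has_integral 0) {0..1}" by (simp add: ends)
  from has_integral_add[OF this has_integral_add[OF has_integral_mult_right[OF iIm, of \<mu>]
      has_integral_mult_right[OF iRe, of "\<mu> * a - k"]]]
  have i: "((\<lambda>t. q t + (\<mu> * Im (\<omega> t) + (\<mu> * a - k) * Re (\<omega> t))) has_integral \<Phi>) {0..1}"
    by (simp add: \<mu>_def)
  show "((\<lambda>t. spiral_field a \<theta>\<^sub>0 f g (\<gamma> t) \<bullet> vector
      [vector_derivative \<gamma> (at t within {0..1}) $ 2, - vector_derivative \<gamma> (at t within {0..1}) $ 1])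
      has_integral \<Phi>) {0..1}"
  proof (rule has_integral_spike_finite[OF T _ i])
    fix t assume t: "t \<in> {0..1} - T"
    have v: "vector_derivative \<gamma> (at t within {0..1}) = D t"
      using vector_derivative_at_within_ivl[OF D[OF t], of 0 1] t by simp
    show "spiral_field a \<theta>\<^sub>0 f g (\<gamma> t) \<bullet> vector
      [vector_derivative \<gamma> (at t within {0..1}) $ 2, - vector_derivative \<gamma> (at t within {0..1}) $ 1]
      = q t + (\<mu> * Im (\<omega> t) + (\<mu> * a - k) * Re (\<omega> t))"
      unfolding v q_def \<omega> spiral_field_def Let_def inner_vec_def sum_2 vector_2 g inner_real_def
      by algebra
  qed
qed

section \<open>The family of spiral solutions\<close>

text \<open>If \<open>y'' = y\<^sup>2 - K\<close>, then \<open>2 + (1 + a\<^sup>2) n\<^sup>2 y (n z)\<close> satisfies the profile equation, the summand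
  \<open>2\<close> completing the square \<open>\<phi>\<^sup>2 - 4 \<phi>\<close>.\<close>

definition profile :: "real \<Rightarrow> nat \<Rightarrow> real \<Rightarrow> real \<Rightarrow> real" where
  "profile a n m z = 2 + (1 + a\<^sup>2) * (real n)\<^sup>2 * cnoidal m (real n * z)"

definition profile' :: "real \<Rightarrow> nat \<Rightarrow> real \<Rightarrow> real \<Rightarrow> real" where
  "profile' a n m z = (1 + a\<^sup>2) * (real n)^3 * cnoidal' m (real n * z)"

definition profile_const :: "real \<Rightarrow> nat \<Rightarrow> real \<Rightarrow> real" where
  "profile_const a n m = (1 + a\<^sup>2)\<^sup>2 * (real n)^4 * cnoidal_const m - 4"

lemma one_plus_sq_pos: "0 < 1 + (a::real)\<^sup>2"
  by (simp add: add_pos_nonneg)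

lemma profile_deriv:
  assumes m: "0 \<le> m" "m < 1"
  shows "(profile a n m has_real_derivative profile' a n m z) (at z)"
proof -
  have inner: "((\<lambda>z. real n * z) has_real_derivative real n) (at z)"
    by (auto intro!: derivative_eq_intros)
  show ?thesis
    unfolding profile_def profile'_def
    by (rule DERIV_cong[OF DERIV_add[OF DERIV_const DERIV_cmult[OF DERIV_chain2[OF cnoidal_deriv[OF m] inner]]]])
      (simp add: power2_eq_square power3_eq_cube)
qed

lemma profile'_deriv:
  assumes m: "0 \<le> m" "m < 1"
  shows "(profile' a n m has_real_derivative
    ((profile a n m z)\<^sup>2 - profile_const a n m - 4 * profile a n m z) / (1 + a\<^sup>2)) (at z)"
proof -
  have inner: "((\<lambda>z. real n * z) has_real_derivative real n) (at z)"
    by (auto intro!: derivative_eq_intros)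
  have eq: "(profile a n m z)\<^sup>2 - profile_const a n m - 4 * profile a n m z
      = ((1 + a\<^sup>2) * (real n)^3 * (((cnoidal m (real n * z))\<^sup>2 - cnoidal_const m) * real n)) * (1 + a\<^sup>2)"
    unfolding profile_def profile_const_def by algebra
  have nz: "1 + a\<^sup>2 \<noteq> 0" using one_plus_sq_pos[of a] by simp
  have "((profile a n m z)\<^sup>2 - profile_const a n m - 4 * profile a n m z) / (1 + a\<^sup>2)
      = (1 + a\<^sup>2) * (real n)^3 * (((cnoidal m (real n * z))\<^sup>2 - cnoidal_const m) * real n)"
    unfolding eq by (rule nonzero_mult_div_cancel_right[OF nz])
  then show ?thesis
    unfolding profile'_def
    by (simp only:) (rule DERIV_cmult[OF DERIV_chain2[OF cnoidal'_deriv[OF m] inner]])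
qed

lemma profile_period:
  assumes m: "0 \<le> m" "m < 1"
  shows "n \<ge> 1 \<Longrightarrow> profile a n m (z + 2 * pi / real n) = profile a n m z"
    and "profile a n m (z + 2 * pi) = profile a n m z"
proof -
  interpret periodic_fun_simple "cnoidal m" "2 * pi" by standard (rule cnoidal_shift[OF m])
  show "profile a n m (z + 2 * pi / real n) = profile a n m z" if "n \<ge> 1"
    using that cnoidal_shift[OF m, of "real n * z"] by (simp add: profile_def distrib_left)
  show "profile a n m (z + 2 * pi) = profile a n m z"
    using plus_of_nat[of "real n * z" n] by (simp add: profile_def distrib_left)
qed

lemma profile_antiderivative:
  assumes m: "0 \<le> m" "m < 1" and "n \<ge> 1"
  shows "\<exists>F. (\<forall>z. (F has_real_derivative profile a n m z) (at z)) \<and>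
    (\<forall>z. F (z + 2 * pi) = F z + 2 * pi * (2 + (1 + a\<^sup>2) * (real n)\<^sup>2 * mean_value m))"
proof -
  obtain Q where Q: "\<And>x. (Q has_real_derivative cnoidal m x) (at x)"
    "\<And>x. Q (x + 2 * pi) = Q x + 2 * pi * mean_value m"
    using cnoidal_antiderivative[OF m] by blast
  have Qn: "Q (x + real i * (2 * pi)) = Q x + real i * (2 * pi * mean_value m)" for x i
  proof (induction i)
    case (Suc i)
    have "x + real (Suc i) * (2 * pi) = (x + real i * (2 * pi)) + 2 * pi" by (simp add: algebra_simps)
    then show ?case using Q(2)[of "x + real i * (2 * pi)"] Suc by (simp only:) (simp add: algebra_simps)
  qed simp
  let ?F = "\<lambda>z. 2 * z + (1 + a\<^sup>2) * real n * Q (real n * z)"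
  have "(?F has_real_derivative profile a n m z) (at z)" for z
  proof -
    have inner: "((\<lambda>z. real n * z) has_real_derivative real n) (at z)"
      by (auto intro!: derivative_eq_intros)
    show ?thesis
      unfolding profile_def
      by (rule DERIV_cong[OF DERIV_add[OF DERIV_cmult[OF DERIV_ident] DERIV_cmult[OF DERIV_chain2[OF Q(1) inner]]]])
        (simp add: power2_eq_square)
  qed
  moreover have "?F (z + 2 * pi) = ?F z + 2 * pi * (2 + (1 + a\<^sup>2) * (real n)\<^sup>2 * mean_value m)" for z
    using Qn[of "real n * z" n] by (simp add: distrib_left power2_eq_square mult_ac)
  ultimately show ?thesis by blast
qed

lemma spiral_velocity_eq:
  "spiral_velocity a \<phi> \<theta>\<^sub>0 = spiral_field a \<theta>\<^sub>0 (\<lambda>z. - \<phi> z) (\<lambda>z. a * (\<phi> z - 4))"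
proof
  fix x
  define p where "p = \<phi> (spiral_coord a \<theta>\<^sub>0 x)"
  define c s where "c = cos (polar_angle x)" and "s = sin (polar_angle x)"
  have x12: "x $ 1 = norm x * c" "x $ 2 = norm x * s"
    unfolding c_def s_def by (rule polar_components)+
  have inv: "1 / norm x = norm x * inv_sq x"
    by (cases "x = 0") (simp_all add: inv_sq_norm power2_eq_square)
  show "spiral_velocity a \<phi> \<theta>\<^sub>0 x = spiral_field a \<theta>\<^sub>0 (\<lambda>z. - \<phi> z) (\<lambda>z. a * (\<phi> z - 4)) x"
    unfolding spiral_velocity_def spiral_field_def Let_def p_def[symmetric] inv e_r_def e_theta_def
      c_def[symmetric] s_def[symmetric] x12 vec_eq_iff forall_2 vector_2
      vector_scaleR_component vector_add_component real_scaleR_def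
    by (simp add: algebra_simps)
qed

text \<open>With \<open>f = - \<phi>\<close> and \<open>g = a (\<phi> - 4)\<close> the pressure is \<open>G(z) / r\<^sup>2\<close> for the \<open>G\<close> below. The equality
  \<open>G' = angular_part\<close> holds for every \<open>\<phi>\<close>, whereas \<open>a G' - 2 G = radial_part\<close> is the profile equation.\<close>

lemma spiral_velocity_solves_NS:
  assumes \<phi>: "\<And>z. (\<phi> has_real_derivative \<phi>' z) (at z)"
    and \<phi>': "\<And>z. (\<phi>' has_real_derivative ((\<phi> z)\<^sup>2 - C - 4 * \<phi> z) / (1 + a\<^sup>2)) (at z)"
    and per: "\<And>z. \<phi> (z + 2 * pi) = \<phi> z"
  shows "NS_with_pressure (spiral_velocity a \<phi> \<theta>\<^sub>0) (spiral_pressure a C \<phi> \<theta>\<^sub>0)"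
proof -
  define \<phi>'' where "\<phi>'' = (\<lambda>z. ((\<phi> z)\<^sup>2 - C - 4 * \<phi> z) / (1 + a\<^sup>2))"
  have d2: "(\<phi>' has_real_derivative \<phi>'' z) (at z)" for z unfolding \<phi>''_def by (rule \<phi>')
  have nz: "1 + a\<^sup>2 \<noteq> 0" using one_plus_sq_pos[of a] by simp
  have ode: "(1 + a\<^sup>2) * \<phi>'' z = (\<phi> z)\<^sup>2 - C - 4 * \<phi> z" for z unfolding \<phi>''_def using nz by simp
  let ?f = "\<lambda>z. - \<phi> z" and ?g = "\<lambda>z. a * (\<phi> z - 4)"
  have per': "\<phi>' (z + 2 * pi) = \<phi>' z" for z
    using periodic_deriv[of \<phi> \<phi>' "2 * pi"] \<phi> per by blast
  interpret sp: spiral_profiles a \<theta>\<^sub>0 ?f "\<lambda>z. - \<phi>' z" "\<lambda>z. - \<phi>'' z" ?g "\<lambda>z. a * \<phi>' z" "\<lambda>z. a * \<phi>'' z"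
    by standard (auto intro!: derivative_eq_intros \<phi> d2 simp: per)
  define G where "G = (\<lambda>z. a * (1 + a\<^sup>2) * \<phi>' z - (2 * (1 + a\<^sup>2) - 4 * a\<^sup>2) * \<phi> z
    - (16 * a\<^sup>2 + C * (1 + a\<^sup>2)) / 2)"
  define G1 where "G1 = (\<lambda>z. a * (1 + a\<^sup>2) * \<phi>'' z - (2 * (1 + a\<^sup>2) - 4 * a\<^sup>2) * \<phi>' z)"
  have dG: "(G has_real_derivative G1 z) (at z)" for z
    unfolding G_def G1_def by (auto intro!: derivative_eq_intros \<phi> d2)
  have perG: "G (z + 2 * pi) = G z" for z by (simp add: G_def per per')
  have derivphi: "deriv \<phi> = \<phi>'" using \<phi> DERIV_imp_deriv by blast
  have p: "spiral_pressure a C \<phi> \<theta>\<^sub>0 = (\<lambda>x. G (spiral_coord a \<theta>\<^sub>0 x) * inv_sq x)"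
    unfolding spiral_pressure_def Let_def derivphi G_def inv_sq_norm
    by (auto simp: fun_eq_iff diff_divide_distrib add_divide_distrib algebra_simps)
  have A: "sp.radial_part z = a * G1 z - 2 * G z" for z
  proof -
    have "2 * sp.radial_part z = 2 * (a * G1 z) - 2 * (2 * G z)"
      unfolding sp.radial_part_def G1_def G_def using ode[of z] by (simp add: algebra_simps) algebra
    then show ?thesis by simp
  qed
  have B: "sp.angular_part z = G1 z" for z
    unfolding sp.angular_part_def G1_def by algebra
  have gradp: "has_grad (spiral_pressure a C \<phi> \<theta>\<^sub>0) x
     ((sp.S sp.radial_part x * x $ 1 - sp.S sp.angular_part x * x $ 2) * (inv_sq x)\<^sup>2)
     ((sp.S sp.radial_part x * x $ 2 + sp.S sp.angular_part x * x $ 1) * (inv_sq x)\<^sup>2)" if "x \<noteq> 0" for x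
    unfolding p A B by (rule grad_spiral_pressure[OF that perG dG])
  have grad: "grad (spiral_pressure a C \<phi> \<theta>\<^sub>0) x = vector
     [(sp.S sp.radial_part x * x $ 1 - sp.S sp.angular_part x * x $ 2) * (inv_sq x)\<^sup>2,
      (sp.S sp.radial_part x * x $ 2 + sp.S sp.angular_part x * x $ 1) * (inv_sq x)\<^sup>2]" if "x \<noteq> 0" for x
    using has_grad_partial[OF gradp[OF that]] by (simp add: grad_def vec_eq_iff forall_2)
  have quad: "(\<phi>' has_real_derivative
      (1 / (1 + a\<^sup>2)) * (\<phi> z * \<phi> z) + (- 4 / (1 + a\<^sup>2)) * \<phi> z + (- C / (1 + a\<^sup>2))) (at z)" for z
    by (rule DERIV_cong[OF \<phi>']) (simp add: diff_divide_distrib power2_eq_square)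
  note smooth = spiral_ring_smooth[OF \<phi> quad per, where a = a and \<theta>\<^sub>0 = \<theta>\<^sub>0]
  have ringf: "spiral_ring a \<theta>\<^sub>0 \<phi> \<phi>' (\<lambda>x. - \<phi> (spiral_coord a \<theta>\<^sub>0 x))"
  proof -
    have "spiral_ring a \<theta>\<^sub>0 \<phi> \<phi>' (\<lambda>x. 0 - \<phi> (spiral_coord a \<theta>\<^sub>0 x))"
      by (intro spiral_ring_intros)
    then show ?thesis by simp
  qed
  have s1: "smooth_on (spiral_field a \<theta>\<^sub>0 ?f ?g) (- {0})"
    unfolding spiral_field_def[abs_def] Let_def
    by (intro smooth(2) spiral_ring_intros ringf)
  have s2: "smooth_on (spiral_pressure a C \<phi> \<theta>\<^sub>0) (- {0})"
    unfolding p G_def by (intro smooth(1) spiral_ring_intros)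
  have "continuous_on UNIV \<phi>"
    using \<phi> by (intro continuous_at_imp_continuous_on) (auto intro: DERIV_isCont)
  then obtain z0 z1 where z01: "\<And>z. \<phi> z0 \<le> \<phi> z" "\<And>z. \<phi> z \<le> \<phi> z1"
    by (rule periodic_extrema[where p = "2 * pi"]) (use per in auto)
  define M0 where "M0 = \<bar>\<phi> z0\<bar> + \<bar>\<phi> z1\<bar>"
  have M0: "\<bar>\<phi> z\<bar> \<le> M0" for z using z01(1)[of z] z01(2)[of z] unfolding M0_def by linarith
  have "\<bar>?f z\<bar> \<le> M0 + \<bar>a\<bar> * (M0 + 4)" "\<bar>?g z\<bar> \<le> M0 + \<bar>a\<bar> * (M0 + 4)" for z
  proof -
    have m0: "0 \<le> M0" by (simp add: M0_def)
    have "\<bar>?g z\<bar> \<le> \<bar>a\<bar> * (M0 + 4)"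
      unfolding abs_mult using M0[of z] by (intro mult_left_mono) auto
    then show "\<bar>?g z\<bar> \<le> M0 + \<bar>a\<bar> * (M0 + 4)" using m0 by linarith
    have "0 \<le> \<bar>a\<bar> * (M0 + 4)" using m0 by simp
    then show "\<bar>?f z\<bar> \<le> M0 + \<bar>a\<bar> * (M0 + 4)"
      using M0[of z] unfolding abs_minus_cancel by linarith
  qed
  then have lim: "(spiral_field a \<theta>\<^sub>0 ?f ?g \<longlongrightarrow> 0) at_infinity" by (rule spiral_field_tendsto_0)
  show ?thesis
    unfolding NS_with_pressure_def spiral_velocity_eq
  proof (intro conjI s1 s2 lim allI impI)
    fix x :: "real^2" assume x: "x \<noteq> 0"
    show "laplacian (spiral_field a \<theta>\<^sub>0 ?f ?g) x - grad (spiral_pressure a C \<phi> \<theta>\<^sub>0) x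
        = convective (spiral_field a \<theta>\<^sub>0 ?f ?g) (spiral_field a \<theta>\<^sub>0 ?f ?g) x"
      using sp.momentum_spiral_field[OF x] unfolding grad[OF x, symmetric] by (simp add: algebra_simps)
    show "div_field (spiral_field a \<theta>\<^sub>0 ?f ?g) x = 0"
      by (simp add: sp.div_spiral_field[OF x])
  qed
qed

text \<open>The elliptic parameter for which the mean of the profile is \<open>- \<Phi> / (2 \<pi>)\<close>.\<close>

definition modulus :: "nat \<Rightarrow> real \<Rightarrow> real \<Rightarrow> real" where
  "modulus n \<Phi> a = (SOME m. 0 \<le> m \<and> m < 1 \<and>
     2 + (1 + a\<^sup>2) * (real n)\<^sup>2 * mean_value m = - \<Phi> / (2 * pi))"

text \<open>The required mean of the cnoidal wave is \<open>(- \<Phi> / (2 \<pi>) - 2) / ((1 + a\<^sup>2) n\<^sup>2)\<close>; admissibility says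
  precisely that it is at least \<open>- 1/2\<close>.\<close>

lemma modulus:
  assumes "admissible n \<Phi> a"
  shows "0 \<le> modulus n \<Phi> a" "modulus n \<Phi> a < 1"
    "2 + (1 + a\<^sup>2) * (real n)\<^sup>2 * mean_value (modulus n \<Phi> a) = - \<Phi> / (2 * pi)"
proof -
  define q where "q = (1 + a\<^sup>2) * (real n)\<^sup>2"
  have n: "n \<ge> 1" and adm: "(4 + \<Phi> / pi) / (1 + a\<^sup>2) \<le> (real n)\<^sup>2"
    using assms by (auto simp: admissible_def)
  have q: "0 < q" unfolding q_def using n one_plus_sq_pos[of a] by simp
  have "4 + \<Phi> / pi \<le> q"
    using adm one_plus_sq_pos[of a] unfolding q_def by (simp add: pos_divide_le_eq mult.commute)
  then have "- 1/2 * q \<le> - \<Phi> / (2 * pi) - 2" by (simp add: field_simps)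
  then have "- 1/2 \<le> (- \<Phi> / (2 * pi) - 2) / q" using q by (simp add: pos_le_divide_eq)
  then obtain m where m: "0 \<le> m" "m < 1" "mean_value m = (- \<Phi> / (2 * pi) - 2) / q"
    by (rule mean_value_surj)
  have "\<exists>m. 0 \<le> m \<and> m < 1 \<and> 2 + (1 + a\<^sup>2) * (real n)\<^sup>2 * mean_value m = - \<Phi> / (2 * pi)"
    unfolding q_def[symmetric] using m q by (intro exI[of _ m]) simp
  from someI_ex[OF this]
  show "0 \<le> modulus n \<Phi> a" "modulus n \<Phi> a < 1"
    "2 + (1 + a\<^sup>2) * (real n)\<^sup>2 * mean_value (modulus n \<Phi> a) = - \<Phi> / (2 * pi)"
    unfolding modulus_def by blast+
qed

text \<open>Conversely, every cnoidal profile is the one selected for its own flux, by injectivity of the mean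
  value.\<close>

lemma modulus_unique:
  assumes m: "0 \<le> m" "m < 1" and n: "n \<ge> 1"
    and \<Phi>: "\<Phi> = - 2 * pi * (2 + (1 + a\<^sup>2) * (real n)\<^sup>2 * mean_value m)"
  shows "admissible n \<Phi> a" "modulus n \<Phi> a = m"
proof -
  define q where "q = (1 + a\<^sup>2) * (real n)\<^sup>2"
  have q: "0 < q" unfolding q_def using n one_plus_sq_pos[of a] by simp
  have mv: "- 1/2 \<le> mean_value m"
    using mean_value_strict_mono[of 0 m] mean_value_0 m by (cases "m = 0") auto
  have e: "4 + \<Phi> / pi = q * (- 2 * mean_value m)" unfolding \<Phi> q_def[symmetric] by simp
  also have "\<dots> \<le> q * 1" using q mv by (intro mult_left_mono) auto
  finally show adm: "admissible n \<Phi> a"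
    using n one_plus_sq_pos[of a] unfolding admissible_def q_def by (simp add: pos_divide_le_eq mult.commute)
  have "q * mean_value (modulus n \<Phi> a) = q * mean_value m"
    using modulus(3)[OF adm] unfolding q_def[symmetric] \<Phi> by simp
  then have "mean_value (modulus n \<Phi> a) = mean_value m" using q by simp
  then show "modulus n \<Phi> a = m"
    using mean_value_strict_mono[of m "modulus n \<Phi> a"] mean_value_strict_mono[of "modulus n \<Phi> a" m]
      modulus(1,2)[OF adm] m by (cases m "modulus n \<Phi> a" rule: linorder_cases) auto
qed

lemma spiral_solution_properties:
  assumes adm: "admissible n \<Phi> a"
  defines "\<phi> \<equiv> profile a n (modulus n \<Phi> a)" and "C \<equiv> profile_const a n (modulus n \<Phi> a)"
  shows "\<phi> (z + 2 * pi / real n) = \<phi> z" "profile_ode a C \<phi>"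
    "NS_with_pressure (spiral_velocity a \<phi> \<theta>\<^sub>0) (spiral_pressure a C \<phi> \<theta>\<^sub>0)"
    "scale_invariant_up_to_rotation (\<lambda>s. - a * ln s) (spiral_velocity a \<phi> \<theta>\<^sub>0)"
    "has_flux (spiral_velocity a \<phi> \<theta>\<^sub>0) \<Phi>"
proof -
  note m = modulus(1,2)[OF adm]
  have n: "n \<ge> 1" using adm by (simp add: admissible_def)
  note d = profile_deriv[OF m, of a n, folded \<phi>_def]
  note d' = profile'_deriv[OF m, of a n, folded \<phi>_def C_def]
  note per = profile_period(2)[OF m, of a n, folded \<phi>_def]
  show "\<phi> (z + 2 * pi / real n) = \<phi> z" unfolding \<phi>_def by (rule profile_period(1)[OF m n])
  have "deriv \<phi> = profile' a n (modulus n \<Phi> a)" using d DERIV_imp_deriv by blast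
  then show "profile_ode a C \<phi>"
    unfolding profile_ode_def using d d'[THEN DERIV_imp_deriv] d' one_plus_sq_pos[of a]
    by (auto simp: real_differentiable_def)
  show "NS_with_pressure (spiral_velocity a \<phi> \<theta>\<^sub>0) (spiral_pressure a C \<phi> \<theta>\<^sub>0)"
    by (rule spiral_velocity_solves_NS[OF d d' per])
  show "scale_invariant_up_to_rotation (\<lambda>s. - a * ln s) (spiral_velocity a \<phi> \<theta>\<^sub>0)"
    unfolding spiral_velocity_eq by (rule spiral_field_invariant) (simp_all add: per)
  obtain F where F: "\<And>z. (F has_real_derivative \<phi> z) (at z)"
    "\<And>z. F (z + 2 * pi) = F z + 2 * pi * (2 + (1 + a\<^sup>2) * (real n)\<^sup>2 * mean_value (modulus n \<Phi> a))"
    using profile_antiderivative[OF m n, of a] unfolding \<phi>_def by blast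
  show "has_flux (spiral_velocity a \<phi> \<theta>\<^sub>0) \<Phi>"
    unfolding spiral_velocity_eq
  proof (rule spiral_field_flux)
    show "((\<lambda>z. - F z) has_real_derivative - \<phi> z) (at z)" for z by (rule DERIV_minus[OF F(1)])
    show "- F (z + 2 * pi) = - F z + \<Phi>" for z
      unfolding F(2) modulus(3)[OF adm] by simp
    show "a * (\<phi> z - 4) = - 4 * a - a * - \<phi> z" for z by (simp add: algebra_simps)
  qed (simp add: per)
qed

section \<open>Classification of the scale-invariant solutions\<close>

definition twice_differentiable :: "(real \<Rightarrow> real) \<Rightarrow> bool" where
  "twice_differentiable f \<longleftrightarrow> (\<exists>f1 f2. (\<forall>z. (f has_real_derivative f1 z) (at z)) \<and>
     (\<forall>z. (f1 has_real_derivative f2 z) (at z)))"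

lemma twice_differentiableI:
  assumes "\<And>z. (f has_real_derivative f1 z) (at z)" "\<And>z. (f1 has_real_derivative f2 z) (at z)"
  shows "twice_differentiable f"
  using assms unfolding twice_differentiable_def by blast

lemma twice_differentiable_trig: "twice_differentiable sin" "twice_differentiable cos"
proof -
  have "((\<lambda>z::real. - sin z) has_real_derivative - cos z) (at z)" for z
    by (auto intro!: derivative_eq_intros)
  then show "twice_differentiable cos" by (rule twice_differentiableI[OF DERIV_cos])
  show "twice_differentiable sin" by (rule twice_differentiableI[OF DERIV_sin DERIV_cos])
qed

lemma twice_differentiable_add_mult:
  assumes "twice_differentiable f" "twice_differentiable g"
  shows "twice_differentiable (\<lambda>z. f z + g z)" "twice_differentiable (\<lambda>z. f z - g z)"
    "twice_differentiable (\<lambda>z. f z * g z)"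
proof -
  obtain f1 f2 g1 g2 where
    f: "\<And>z. (f has_real_derivative f1 z) (at z)" "\<And>z. (f1 has_real_derivative f2 z) (at z)" and
    g: "\<And>z. (g has_real_derivative g1 z) (at z)" "\<And>z. (g1 has_real_derivative g2 z) (at z)"
    using assms unfolding twice_differentiable_def by blast
  show "twice_differentiable (\<lambda>z. f z + g z)"
    by (rule twice_differentiableI[OF DERIV_add[OF f(1) g(1)] DERIV_add[OF f(2) g(2)]])
  show "twice_differentiable (\<lambda>z. f z - g z)"
    by (rule twice_differentiableI[OF DERIV_diff[OF f(1) g(1)] DERIV_diff[OF f(2) g(2)]])
  show "twice_differentiable (\<lambda>z. f z * g z)"
    by (rule twice_differentiableI[OF DERIV_mult[OF f(1) g(1)]
        DERIV_add[OF DERIV_mult[OF f(2) g(1)] DERIV_mult[OF g(2) f(1)]]])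
qed

lemma e_r_nonzero: "e_r \<theta> \<noteq> 0"
proof
  assume "e_r \<theta> = 0"
  then have "cos \<theta> = 0" "sin \<theta> = 0" by (simp_all add: e_r_def vec_eq_iff forall_2)
  then show False using sin_cos_squared_add[of \<theta>] by simp
qed

lemma e_r_deriv: "(e_r has_vector_derivative e_theta \<theta>) (at \<theta>)"
proof -
  have "((\<lambda>\<theta>. cos \<theta> *\<^sub>R axis 1 1 + sin \<theta> *\<^sub>R axis 2 1 :: real^2) has_vector_derivative
      (- sin \<theta>) *\<^sub>R axis 1 1 + cos \<theta> *\<^sub>R axis 2 1) (at \<theta>)"
    by (auto intro!: derivative_eq_intros)
  moreover have eq: "u *\<^sub>R axis 1 1 + v *\<^sub>R axis 2 1 = (vector [u, v] :: real^2)" for u v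
    by (simp add: vec_eq_iff forall_2 axis_def)
  ultimately show ?thesis unfolding e_r_def[abs_def] e_theta_def eq by simp
qed

lemma frechet_derivative_components:
  fixes h :: "real^2 \<Rightarrow> 'b::real_normed_vector"
  assumes "h differentiable (at x)"
  shows "has_grad h x (frechet_derivative h (at x) (axis 1 1)) (frechet_derivative h (at x) (axis 2 1))"
proof -
  let ?D = "frechet_derivative h (at x)"
  have D: "(h has_derivative ?D) (at x)" using assms by (simp add: frechet_derivative_works)
  interpret D: bounded_linear ?D using D by (rule has_derivative_bounded_linear)
  have "v = (v $ 1) *\<^sub>R axis 1 1 + (v $ 2) *\<^sub>R axis 2 1" for v :: "real^2"
    by (simp add: vec_eq_iff forall_2 axis_def)
  then have "?D v = (v $ 1) *\<^sub>R ?D (axis 1 1) + (v $ 2) *\<^sub>R ?D (axis 2 1)" for v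
    by (metis D.add D.scaleR)
  then show ?thesis using D by (metis (no_types, lifting) ext has_derivative_eq_rhs)
qed

lemma circle_deriv:
  fixes h :: "real^2 \<Rightarrow> real^2"
  assumes "h differentiable (at (e_r \<theta>))"
  shows "((\<lambda>\<theta>. h (e_r \<theta>) $ i) has_real_derivative
    - sin \<theta> * (frechet_derivative h (at (e_r \<theta>)) (axis 1 1) $ i)
    + cos \<theta> * (frechet_derivative h (at (e_r \<theta>)) (axis 2 1) $ i)) (at \<theta>)"
proof -
  note g = frechet_derivative_components[OF assms]
  have e: "(e_r has_derivative (\<lambda>t. t *\<^sub>R e_theta \<theta>)) (at \<theta>)"
    using e_r_deriv[of \<theta>] by (simp add: has_vector_derivative_def)
  note c = has_derivative_compose[OF e g]
  note c' = has_derivative_compose[OF c bounded_linear_imp_has_derivative[OF bounded_linear_vec_nth[of i]]]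
  show ?thesis unfolding has_field_derivative_def
    by (rule has_derivative_eq_rhs[OF c']) (simp add: fun_eq_iff e_theta_def algebra_simps)
qed

lemma circle_twice_differentiable:
  fixes u :: "real^2 \<Rightarrow> real^2"
  assumes "smooth_on u (- {0})"
  shows "twice_differentiable (\<lambda>\<theta>. u (e_r \<theta>) $ i)"
proof -
  have "C_k_on (Suc (Suc 0)) u (- {0})" using assms unfolding smooth_on_def by blast
  then have u: "\<And>x. x \<noteq> 0 \<Longrightarrow> u differentiable (at x)"
    and Du: "\<And>v x. x \<noteq> 0 \<Longrightarrow> (\<lambda>x. frechet_derivative u (at x) v) differentiable (at x)"
    by auto
  show ?thesis
  proof (rule twice_differentiableI)
    fix \<theta>
    show "((\<lambda>\<theta>. u (e_r \<theta>) $ i) has_real_derivative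
        - sin \<theta> * (frechet_derivative u (at (e_r \<theta>)) (axis 1 1) $ i)
        + cos \<theta> * (frechet_derivative u (at (e_r \<theta>)) (axis 2 1) $ i)) (at \<theta>)"
      by (rule circle_deriv[OF u[OF e_r_nonzero]])
    have s: "((\<lambda>\<theta>::real. - sin \<theta>) has_real_derivative - cos \<theta>) (at \<theta>)"
      by (auto intro!: derivative_eq_intros)
    show "((\<lambda>\<theta>. - sin \<theta> * (frechet_derivative u (at (e_r \<theta>)) (axis 1 1) $ i)
        + cos \<theta> * (frechet_derivative u (at (e_r \<theta>)) (axis 2 1) $ i)) has_real_derivative
        (deriv (\<lambda>\<theta>. - sin \<theta> * (frechet_derivative u (at (e_r \<theta>)) (axis 1 1) $ i)
        + cos \<theta> * (frechet_derivative u (at (e_r \<theta>)) (axis 2 1) $ i)) \<theta>)) (at \<theta>)"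
      unfolding DERIV_deriv_iff_real_differentiable real_differentiable_def
      by (rule exI, rule DERIV_add[OF DERIV_mult[OF s circle_deriv[OF Du[OF e_r_nonzero]]]
            DERIV_mult[OF DERIV_cos circle_deriv[OF Du[OF e_r_nonzero]]]])
  qed
qed

text \<open>Comparing derivatives at \<open>t = 1\<close> in the cocycle identity gives \<open>s R'(s) f' = R'(1) f'\<close> at
  \<open>\<theta> - R(s)\<close>. Hence \<open>s \<mapsto> f (\<theta> + R'(1) log s - R s)\<close> has zero derivative and keeps its value at \<open>s = 1\<close>,
  where \<open>R 1\<close> is a period of \<open>f\<close>.\<close>

lemma spiral_from_rotation:
  fixes f R :: "real \<Rightarrow> real"
  assumes f: "\<And>z. (f has_real_derivative f1 z) (at z)"
    and R: "\<And>s. s > 0 \<Longrightarrow> (R has_real_derivative R1 s) (at s)"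
    and cocycle: "\<And>s t \<theta>. s > 0 \<Longrightarrow> t > 0 \<Longrightarrow> f (\<theta> - R (s * t)) = f (\<theta> - R s - R t)"
    and "s > 0"
  shows "f (\<theta> - R s) = f (\<theta> - R1 1 * ln s)"
proof -
  have per: "f (z - R 1) = f z" for z
    using cocycle[of 1 1 "z + R 1"] by simp
  have per1: "f1 (z - R 1) = f1 z" for z
    using periodic_deriv[OF f, of "- R 1" z] per by simp
  have key: "s * R1 s * f1 (\<theta> - R s) = R1 1 * f1 (\<theta> - R s)" if "s > 0" for s \<theta>
  proof -
    have "((\<lambda>t. \<theta> - R (s * t)) has_real_derivative - (R1 (s * 1) * s)) (at 1)"
      using that by (auto intro!: derivative_eq_intros DERIV_chain2[of R] R)
    note l = DERIV_chain2[OF f this]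
    have "((\<lambda>t. \<theta> - R s - R t) has_real_derivative - R1 1) (at 1)"
      by (auto intro!: derivative_eq_intros R)
    note r = DERIV_chain2[OF f this]
    have "((\<lambda>t. f (\<theta> - R s - R t)) has_real_derivative f1 (\<theta> - R (s * 1)) * - (R1 (s * 1) * s)) (at 1)"
      by (rule has_field_derivative_transform_within_open[OF l, of "{0<..}"])
        (use cocycle[OF that] in auto)
    from DERIV_unique[OF this r] show ?thesis using per1[of "\<theta> - R s"] by (simp add: mult_ac)
  qed
  have "\<exists>c. \<forall>s\<in>{0<..}. f ((\<theta> - R1 1 * ln s0) + R1 1 * ln s - R s) = c" for s0
  proof (rule has_field_derivative_zero_constant)
    fix s :: real assume s: "s \<in> {0<..}"
    let ?z = "(\<theta> - R1 1 * ln s0) + R1 1 * ln s"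
    have "((\<lambda>s. (\<theta> - R1 1 * ln s0) + R1 1 * ln s - R s) has_real_derivative R1 1 * (1 / s) - R1 s) (at s)"
      using s by (auto intro!: derivative_eq_intros R)
    note d = DERIV_chain2[OF f this]
    have zero: "f1 (?z - R s) * (R1 1 * (1 / s) - R1 s) = 0"
      using key[of s ?z] s by (auto simp: field_simps)
    show "((\<lambda>s. f ((\<theta> - R1 1 * ln s0) + R1 1 * ln s - R s)) has_real_derivative 0) (at s within {0<..})"
      by (rule has_field_derivative_at_within[OF DERIV_cong[OF d zero]])
  qed simp
  then obtain c where c: "\<And>t. t > 0 \<Longrightarrow> f ((\<theta> - R1 1 * ln s) + R1 1 * ln t - R t) = c" by force
  have "f (\<theta> - R s) = c" using c[OF \<open>s > 0\<close>] by simp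
  moreover have "f (\<theta> - R1 1 * ln s) = c" using c[of 1] per by simp
  ultimately show ?thesis by simp
qed

lemma vec2_eqI: "(x::real^2) $ 1 = y $ 1 \<Longrightarrow> x $ 2 = y $ 2 \<Longrightarrow> x = y"
  by (simp add: vec_eq_iff forall_2)

lemma polar_decomposition: "x = norm x *\<^sub>R e_r (polar_angle x)"
  by (rule vec2_eqI) (simp_all add: e_r_def polar_components[of x])

lemma rot_e: "rot \<alpha> *v e_r \<theta> = e_r (\<theta> + \<alpha>)" "rot \<alpha> *v e_theta \<theta> = e_theta (\<theta> + \<alpha>)"
  by (rule vec2_eqI; simp add: rot_vec e_r_def e_theta_def sin_add cos_add)+

lemma frame: "v = (v \<bullet> e_r \<theta>) *\<^sub>R e_r \<theta> + (v \<bullet> e_theta \<theta>) *\<^sub>R e_theta \<theta>"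
proof -
  have "(cos \<theta>)\<^sup>2 = 1 - (sin \<theta>)\<^sup>2" by (simp add: cos_squared_eq)
  then show ?thesis
    by (intro vec2_eqI; simp add: inner_vec_def sum_2 e_r_def e_theta_def; algebra)
qed

lemma frame_unique:
  assumes "p *\<^sub>R e_r \<theta> + q *\<^sub>R e_theta \<theta> = p' *\<^sub>R e_r \<theta> + q' *\<^sub>R e_theta \<theta>"
  shows "p = p'" "q = q'"
proof -
  have cs: "(cos \<theta>)\<^sup>2 = 1 - (sin \<theta>)\<^sup>2" by (simp add: cos_squared_eq)
  have "p * cos \<theta> - q * sin \<theta> = p' * cos \<theta> - q' * sin \<theta>" "p * sin \<theta> + q * cos \<theta> = p' * sin \<theta> + q' * cos \<theta>"
    using arg_cong[OF assms, of "\<lambda>v::real^2. v $ 1"] arg_cong[OF assms, of "\<lambda>v::real^2. v $ 2"]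
    by (simp_all add: e_r_def e_theta_def)
  then show "p = p'" "q = q'" using cs by algebra+
qed

text \<open>On the unit circle \<open>u = f e_r + g e_\<theta>\<close>. Invariance transports this to the circle of radius \<open>s\<close> with the
  argument of \<open>f\<close> and \<open>g\<close> shifted by \<open>- R s\<close>, and its consistency for products of dilations is the
  cocycle identity.\<close>

lemma scale_invariant_is_spiral:
  assumes smooth: "smooth_on u (- {0})" and inv: "scale_invariant_up_to_rotation R u"
  obtains a f g where "twice_differentiable f" "twice_differentiable g"
    "\<And>z. f (z + 2 * pi) = f z" "\<And>z. g (z + 2 * pi) = g z"
    "\<And>x. x \<noteq> 0 \<Longrightarrow> u x = spiral_field a 0 f g x"
proof -
  define f where "f = (\<lambda>\<theta>. u (e_r \<theta>) \<bullet> e_r \<theta>)"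
  define g where "g = (\<lambda>\<theta>. u (e_r \<theta>) \<bullet> e_theta \<theta>)"
  have f_eq: "f = (\<lambda>\<theta>. u (e_r \<theta>) $ 1 * cos \<theta> + u (e_r \<theta>) $ 2 * sin \<theta>)"
    and g_eq: "g = (\<lambda>\<theta>. u (e_r \<theta>) $ 2 * cos \<theta> - u (e_r \<theta>) $ 1 * sin \<theta>)"
    by (simp_all add: f_def g_def fun_eq_iff inner_vec_def sum_2 e_r_def e_theta_def)
  note td = twice_differentiable_add_mult twice_differentiable_trig circle_twice_differentiable[OF smooth]
  have tf: "twice_differentiable f" unfolding f_eq by (intro td)
  have tg: "twice_differentiable g" unfolding g_eq by (intro td)
  have e_per: "e_r (\<theta> + 2 * pi) = e_r \<theta>" "e_theta (\<theta> + 2 * pi) = e_theta \<theta>" for \<theta>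
    by (simp_all add: e_r_def e_theta_def)
  have per: "f (z + 2 * pi) = f z" "g (z + 2 * pi) = g z" for z
    by (simp_all add: f_def g_def e_per)
  obtain R1 where R1: "\<And>s. s > 0 \<Longrightarrow> (R has_real_derivative R1 s) (at s)"
    using inv unfolding scale_invariant_up_to_rotation_def C1_differentiable_on_def
    by (auto simp: has_real_derivative_iff_has_vector_derivative)
  have invar: "s *\<^sub>R u (s *\<^sub>R x) = rot (R s) *v u (rot (- R s) *v x)" if "s > 0" "x \<noteq> 0" for s x
    using inv that unfolding scale_invariant_up_to_rotation_def matrix_inv_rot by simp
  have circ: "u (e_r \<theta>) = f \<theta> *\<^sub>R e_r \<theta> + g \<theta> *\<^sub>R e_theta \<theta>" for \<theta>
    unfolding f_def g_def by (rule frame)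
  have lin: "rot \<alpha> *v (p *\<^sub>R v + q *\<^sub>R w) = p *\<^sub>R (rot \<alpha> *v v) + q *\<^sub>R (rot \<alpha> *v w)" for \<alpha> p q v w
    by (simp add: matrix_vector_right_distrib matrix_vector_mult_scaleR)
  have ray: "s *\<^sub>R u (s *\<^sub>R e_r \<theta>) = f (\<theta> - R s) *\<^sub>R e_r \<theta> + g (\<theta> - R s) *\<^sub>R e_theta \<theta>" if "s > 0" for s \<theta>
    unfolding invar[OF that e_r_nonzero] rot_e(1) circ lin rot_e by simp
  have cocycle: "f (\<theta> - R (s * t)) = f (\<theta> - R s - R t)" "g (\<theta> - R (s * t)) = g (\<theta> - R s - R t)"
    if "s > 0" "t > 0" for s t \<theta>
  proof -
    have "f (\<theta> - R (s * t)) *\<^sub>R e_r \<theta> + g (\<theta> - R (s * t)) *\<^sub>R e_theta \<theta>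
        = t *\<^sub>R (s *\<^sub>R u (s *\<^sub>R (t *\<^sub>R e_r \<theta>)))"
      using ray[of "s * t" \<theta>] that by (simp add: mult.commute)
    also have "s *\<^sub>R u (s *\<^sub>R (t *\<^sub>R e_r \<theta>)) = rot (R s) *v u (t *\<^sub>R e_r (\<theta> - R s))"
      using invar[of s "t *\<^sub>R e_r \<theta>"] that e_r_nonzero
      by (simp add: matrix_vector_mult_scaleR rot_e)
    also have "t *\<^sub>R \<dots> = rot (R s) *v (t *\<^sub>R u (t *\<^sub>R e_r (\<theta> - R s)))"
      by (simp add: matrix_vector_mult_scaleR)
    also have "\<dots> = f (\<theta> - R s - R t) *\<^sub>R e_r \<theta> + g (\<theta> - R s - R t) *\<^sub>R e_theta \<theta>"
      unfolding ray[OF that(2)] lin rot_e by simp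
    finally show "f (\<theta> - R (s * t)) = f (\<theta> - R s - R t)" "g (\<theta> - R (s * t)) = g (\<theta> - R s - R t)"
      by (rule frame_unique)+
  qed
  obtain f1 g1 where d: "\<And>z. (f has_real_derivative f1 z) (at z)" "\<And>z. (g has_real_derivative g1 z) (at z)"
    using tf tg unfolding twice_differentiable_def by blast
  define a where "a = - R1 1"
  have "u x = spiral_field a 0 f g x" if x: "x \<noteq> 0" for x
  proof -
    define r \<theta> where "r = norm x" and "\<theta> = polar_angle x"
    have r: "r > 0" using x by (simp add: r_def)
    have xp: "x = r *\<^sub>R e_r \<theta>" unfolding r_def \<theta>_def by (rule polar_decomposition)
    have z: "spiral_coord a 0 x = \<theta> - R1 1 * ln r" by (simp add: spiral_coord_def r_def \<theta>_def a_def)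
    have "r *\<^sub>R u x = f (\<theta> - R1 1 * ln r) *\<^sub>R e_r \<theta> + g (\<theta> - R1 1 * ln r) *\<^sub>R e_theta \<theta>"
      using ray[OF r, of \<theta>] spiral_from_rotation[OF d(1) R1 cocycle(1) r]
        spiral_from_rotation[OF d(2) R1 cocycle(2) r] xp by simp
    then have ru: "u x = (1 / r) *\<^sub>R (f (\<theta> - R1 1 * ln r) *\<^sub>R e_r \<theta> + g (\<theta> - R1 1 * ln r) *\<^sub>R e_theta \<theta>)"
      using r by (metis (no_types, lifting) divide_self_if less_irrefl scaleR_one scaleR_scaleR times_divide_eq_left mult_1)
    have x12: "x $ 1 = r * cos \<theta>" "x $ 2 = r * sin \<theta>" unfolding r_def \<theta>_def by (rule polar_components)+
    have i: "inv_sq x = (1 / r) * (1 / r)" by (simp add: inv_sq_norm r_def power2_eq_square)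
    show ?thesis
      unfolding ru spiral_field_def Let_def z x12 i
      by (rule vec2_eqI) (use r in \<open>simp_all add: e_r_def e_theta_def field_simps\<close>)
  qed
  then show thesis using that tf tg per by blast
qed

lemma partial_deriv_eq_off_origin:
  assumes "\<And>y. y \<noteq> 0 \<Longrightarrow> f y = g y" "x \<noteq> 0"
  shows "partial_deriv i f x = partial_deriv i g x"
proof -
  have "(f has_derivative D) (at x) \<longleftrightarrow> (g has_derivative D) (at x)" for D
    using has_derivative_transform_within_open[of f D x UNIV "- {0}" g]
      has_derivative_transform_within_open[of g D x UNIV "- {0}" f] assms by (auto simp: open_Compl)
  then show ?thesis by (simp add: partial_deriv_def frechet_derivative_def)
qed

lemma spiral_field_on_rays:
  assumes per: "\<And>z. \<psi> (z + 2 * pi) = \<psi> z" and "s > 0"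
  shows "\<psi> (spiral_coord a 0 (s *\<^sub>R e_r \<theta>)) = \<psi> (\<theta> + a * ln s)"
proof -
  have e: "to_complex (s *\<^sub>R e_r \<theta>) = exp (Complex (ln s) \<theta>) * to_complex (e_r 0)"
    using \<open>s > 0\<close> by (simp add: to_complex_def e_r_def complex_eq_iff Re_exp Im_exp)
  have "spiral_coord a 0 (e_r 0) = 0"
    by (simp add: spiral_coord_def polar_angle_def to_complex_def e_r_def norm_vec_def L2_set_def sum_2
        Complex_eq)
  then show ?thesis
    using spiral_coord_mult[OF e_r_nonzero e, where \<psi> = \<psi>, OF per] by simp
qed

text \<open>Multiplying the equation by \<open>f'\<close> shows that \<open>d\<close> times the energy has derivative \<open>(d f')\<^sup>2\<close>. A
  nondecreasing periodic function is constant.\<close>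

lemma periodic_dissipation:
  fixes f :: "real \<Rightarrow> real"
  assumes f: "\<And>z. (f has_real_derivative f1 z) (at z)" "\<And>z. (f1 has_real_derivative f2 z) (at z)"
    and per: "\<And>z. f (z + p) = f z" "0 < p"
    and ode: "\<And>z. b * f2 z - d * f1 z + (f z)\<^sup>2 + 4 * f z = c" and "d \<noteq> 0"
  shows "f1 z = 0"
proof (rule ccontr)
  assume nz: "f1 z \<noteq> 0"
  define W where "W = (\<lambda>z. d * (b * (f1 z)\<^sup>2 / 2 + (f z)^3 / 3 + 2 * (f z)\<^sup>2 - c * f z))"
  have W: "(W has_real_derivative (d * f1 z)\<^sup>2) (at z)" for z
  proof -
    have "(W has_real_derivative d * (f1 z * (b * f2 z + (f z)\<^sup>2 + 4 * f z - c))) (at z)"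
      unfolding W_def
      by (auto intro!: derivative_eq_intros f simp: algebra_simps power2_eq_square)
    moreover have "b * f2 z + (f z)\<^sup>2 + 4 * f z - c = d * f1 z" using ode[of z] by simp
    ultimately show ?thesis by (simp add: power2_eq_square mult_ac)
  qed
  have per1: "f1 (z + p) = f1 z" for z by (rule periodic_deriv[OF f(1) per(1)])
  have "0 < (d * f1 z)\<^sup>2" using nz \<open>d \<noteq> 0\<close> by simp
  from DERIV_pos_inc_right[OF W this] obtain e where e: "0 < e" "\<And>h. 0 < h \<Longrightarrow> h < e \<Longrightarrow> W z < W (z + h)" by blast
  define h where "h = min (e / 2) p"
  have h: "0 < h" "h < e" "h \<le> p" using e(1) per(2) by (auto simp: h_def)
  have "W (z + h) \<le> W (z + p)"
    by (rule DERIV_nonneg_imp_nondecreasing) (use h W in force)+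
  moreover have "W (z + p) = W z" by (simp add: W_def per per1)
  ultimately show False using e(2)[OF h(1,2)] by simp
qed

text \<open>Subtracting from \<open>p\<close> the candidate \<open>F(z) / r\<^sup>2\<close>, with \<open>F' = angular_part\<close>, removes the angular
  component of the gradient. The remainder \<open>P\<close> is then a function of \<open>r\<close> alone (this is where the
  pressure must be single-valued on circles), while its radial derivative at \<open>r = 1\<close> is \<open>N(\<theta>)\<close>; so
  \<open>N\<close> is constant, and \<open>N = const\<close> is the asserted equation.\<close>

lemma spiral_NS_solution_ode:
  assumes "spiral_profiles f f1 f2 g g1 g2"
    and smooth: "smooth_on p (- {0})"
    and mom: "\<And>x. x \<noteq> 0 \<Longrightarrow> laplacian (spiral_field a 0 f g) x - grad p x
        = convective (spiral_field a 0 f g) (spiral_field a 0 f g) x"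
    and div0: "\<And>x. x \<noteq> 0 \<Longrightarrow> div_field (spiral_field a 0 f g) x = 0"
  obtains k c where "\<And>z. g z = k - a * f z"
    "\<And>z. (1 + a\<^sup>2) * f2 z - (k + 4 * a) * f1 z + (f z)\<^sup>2 + 4 * f z = c"
proof -
  interpret spiral_profiles a 0 f f1 f2 g g1 g2 by (rule assms(1))
  have ray1: "\<psi> (spiral_coord a 0 (e_r \<theta>)) = \<psi> \<theta>" if "\<And>z. \<psi> (z + 2 * pi) = \<psi> z" for \<psi> :: "real \<Rightarrow> real" and \<theta>
    using spiral_field_on_rays[of \<psi> 1 a \<theta>] that by simp
  have div_ode: "g1 z = - a * f1 z" for z
  proof -
    have "(a * S f1 (e_r z) + S g1 (e_r z)) * inv_sq (e_r z) = 0"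
      using div0[OF e_r_nonzero] div_spiral_field[OF e_r_nonzero] by simp
    then have "(a * f1 z + g1 z) * inv_sq (e_r z) = 0"
      using ray1[of f1 z] ray1[of g1 z] per1 by simp
    moreover have "inv_sq (e_r z) \<noteq> 0" using inv_sq_mult[OF e_r_nonzero[of z]] by force
    ultimately show ?thesis by simp
  qed
  define k where "k = a * f 0 + g 0"
  have "((\<lambda>z. a * f z + g z) has_real_derivative 0) (at z)" for z
    by (rule DERIV_cong[OF DERIV_add[OF DERIV_cmult[OF f(1)] g(1)]]) (simp add: div_ode)
  then have "a * f z + g z = k" for z unfolding k_def using DERIV_isconst_all by blast
  then have gk: "g z = k - a * f z" for z by (simp add: algebra_simps eq_diff_eq)
  have g2: "g2 z = - a * f2 z" for z
  proof -
    have "(g1 has_real_derivative - a * f2 z) (at z)"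
      unfolding div_ode by (rule DERIV_cmult[OF f(2)])
    then show ?thesis using g(2) DERIV_unique by blast
  qed
  define F where "F = (\<lambda>z. - a * (1 + a\<^sup>2) * f1 z + (2 * (1 + a\<^sup>2) + a * k) * f z)"
  have B: "angular_part z = - a * (1 + a\<^sup>2) * f2 z + (2 * (1 + a\<^sup>2) + a * k) * f1 z" for z
    unfolding angular_part_def div_ode g2 gk by algebra
  have dF: "(F has_real_derivative angular_part z) (at z)" for z
    unfolding F_def B by (intro DERIV_add DERIV_cmult f)
  have perF: "F (z + 2 * pi) = F z" for z by (simp add: F_def per per1)
  define N where "N = (\<lambda>z. radial_part z - a * angular_part z + 2 * F z)"
  have perN: "N (z + 2 * pi) = N z" for z
  proof -
    have "f2 (z + 2 * pi) = f2 z" for z by (rule periodic_deriv[OF f(2) per1(1)])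
    then show ?thesis unfolding N_def radial_part_def B F_def div_ode by (simp add: per per1)
  qed
  have "C_k_on (Suc 0) p (- {0})" using smooth unfolding smooth_on_def by blast
  then have pd: "p differentiable (at x)" if "x \<noteq> 0" for x using that by simp
  have grad_p: "has_grad p x ((S radial_part x * x $ 1 - S angular_part x * x $ 2) * (inv_sq x)\<^sup>2)
      ((S radial_part x * x $ 2 + S angular_part x * x $ 1) * (inv_sq x)\<^sup>2)" if x: "x \<noteq> 0" for x
  proof -
    have "grad p x = laplacian (spiral_field a 0 f g) x - convective (spiral_field a 0 f g) (spiral_field a 0 f g) x"
      using mom[OF x] by (simp add: algebra_simps eq_diff_eq diff_eq_eq)
    then have e: "grad p x = vector [(S radial_part x * x $ 1 - S angular_part x * x $ 2) * (inv_sq x)\<^sup>2,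
        (S radial_part x * x $ 2 + S angular_part x * x $ 1) * (inv_sq x)\<^sup>2]"
      using momentum_spiral_field[OF x] by simp
    show ?thesis
      by (rule has_grad_eq[OF frechet_derivative_components[OF pd[OF x]]])
        (use arg_cong[OF e, of "\<lambda>v::real^2. v $ 1"] arg_cong[OF e, of "\<lambda>v::real^2. v $ 2"] in
          \<open>simp_all add: grad_def partial_deriv_def\<close>)
  qed
  define P where "P = (\<lambda>x. p x - F (spiral_coord a 0 x) * inv_sq x)"
  have grad_P: "has_grad P x (S N x * x $ 1 * (inv_sq x)\<^sup>2) (S N x * x $ 2 * (inv_sq x)\<^sup>2)" if x: "x \<noteq> 0" for x
    unfolding P_def
    by (rule has_grad_eq[OF has_grad_diff[OF grad_p[OF x] grad_spiral_pressure[OF x perF dF, where a = a and \<theta>\<^sub>0 = 0]]])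
      (simp_all add: N_def algebra_simps)
  have circle: "P (r *\<^sub>R e_r \<theta>) = P (r *\<^sub>R e_r 0)" if r: "r > 0" for r \<theta>
  proof -
    have "((\<lambda>\<theta>. P (r *\<^sub>R e_r \<theta>)) has_real_derivative 0) (at \<theta>)" for \<theta>
    proof -
      have e: "((\<lambda>\<theta>. r *\<^sub>R e_r \<theta>) has_derivative (\<lambda>t. r *\<^sub>R (t *\<^sub>R e_theta \<theta>))) (at \<theta>)"
        using e_r_deriv[of \<theta>] by (auto intro!: derivative_eq_intros simp: has_vector_derivative_def)
      have nz: "r *\<^sub>R e_r \<theta> \<noteq> 0" using r e_r_nonzero by simp
      show ?thesis unfolding has_field_derivative_def
        by (rule has_derivative_eq_rhs[OF has_derivative_compose[OF e grad_P[OF nz]]])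
          (simp add: fun_eq_iff e_r_def e_theta_def)
    qed
    then show ?thesis using DERIV_isconst_all by blast
  qed
  have radial: "((\<lambda>r. P (r *\<^sub>R e_r \<theta>)) has_real_derivative N \<theta>) (at 1)" for \<theta>
  proof -
    have e: "((\<lambda>r. r *\<^sub>R e_r \<theta>) has_derivative (\<lambda>t. t *\<^sub>R e_r \<theta>)) (at 1)"
      by (auto intro!: derivative_eq_intros)
    have nz: "1 *\<^sub>R e_r \<theta> \<noteq> 0" using e_r_nonzero by simp
    have i: "inv_sq (e_r \<theta>) = 1" by (simp add: inv_sq_def e_r_def)
    have c: "e_r \<theta> $ 1 = cos \<theta>" "e_r \<theta> $ 2 = sin \<theta>" by (simp_all add: e_r_def)
    have cs: "(cos \<theta>)\<^sup>2 = 1 - (sin \<theta>)\<^sup>2" by (simp add: cos_squared_eq)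
    show ?thesis unfolding has_field_derivative_def
    proof (rule has_derivative_eq_rhs[OF has_derivative_compose[OF e grad_P[OF nz]]], rule ext)
      fix t
      show "(t *\<^sub>R e_r \<theta>) $ 1 *\<^sub>R (S N (1 *\<^sub>R e_r \<theta>) * (1 *\<^sub>R e_r \<theta>) $ 1 * (inv_sq (1 *\<^sub>R e_r \<theta>))\<^sup>2)
          + (t *\<^sub>R e_r \<theta>) $ 2 *\<^sub>R (S N (1 *\<^sub>R e_r \<theta>) * (1 *\<^sub>R e_r \<theta>) $ 2 * (inv_sq (1 *\<^sub>R e_r \<theta>))\<^sup>2)
          = N \<theta> * t"
        unfolding scaleR_one ray1[of N, OF perN] i vector_scaleR_component real_scaleR_def c power_one mult_1_right
        using cs by algebra
    qed
  qed
  have Nconst: "N \<theta> = N 0" for \<theta>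
  proof -
    have "((\<lambda>r. P (r *\<^sub>R e_r 0)) has_real_derivative N \<theta>) (at 1)"
    proof (rule has_field_derivative_transform_within_open[OF radial])
      show "P (r *\<^sub>R e_r \<theta>) = P (r *\<^sub>R e_r 0)" if "r \<in> {0<..}" for r
        using that by (intro circle) simp
    qed auto
    then show ?thesis using radial[of 0] DERIV_unique by blast
  qed
  have nz: "1 + a\<^sup>2 \<noteq> 0" using one_plus_sq_pos[of a] by simp
  have ode: "(1 + a\<^sup>2) * ((1 + a\<^sup>2) * f2 z - (k + 4 * a) * f1 z + (f z)\<^sup>2 + 4 * f z) = N 0 - k\<^sup>2" for z
  proof -
    have "(1 + a\<^sup>2) * ((1 + a\<^sup>2) * f2 z - (k + 4 * a) * f1 z + (f z)\<^sup>2 + 4 * f z) = N z - k\<^sup>2"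
      unfolding N_def radial_part_def B F_def div_ode gk by algebra
    then show ?thesis unfolding Nconst[of z] .
  qed
  have "(1 + a\<^sup>2) * f2 z - (k + 4 * a) * f1 z + (f z)\<^sup>2 + 4 * f z = (N 0 - k\<^sup>2) / (1 + a\<^sup>2)" for z
    unfolding ode[of z, symmetric] using nz by simp
  then show thesis using that gk by blast
qed

text \<open>The alternative is whether \<open>f\<close> is constant. If it is not, the first order term of the equation must be
  absent and \<open>y = - (f + 2) / (1 + a\<^sup>2)\<close> solves \<open>y'' = y\<^sup>2 - K\<close>; the translation \<open>z0\<close> of the resulting
  cnoidal wave becomes the angle \<open>\<theta>\<^sub>0 = - z0\<close>.\<close>

lemma scale_invariant_solution_cases:
  assumes "NS_solution u" and inv: "scale_invariant_up_to_rotation R u"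
  shows "(\<exists>n \<Phi> a \<theta>\<^sub>0. admissible n \<Phi> a \<and>
       (\<forall>x. x \<noteq> 0 \<longrightarrow> u x = spiral_velocity a (profile a n (modulus n \<Phi> a)) \<theta>\<^sub>0 x)) \<or>
     (\<exists>\<Phi> \<mu>. \<forall>x. x \<noteq> 0 \<longrightarrow> u x = hamel_velocity \<Phi> \<mu> x)"
proof -
  obtain p where p: "NS_with_pressure u p" using assms(1) unfolding NS_solution_def by blast
  then have smooth: "smooth_on u (- {0})" "smooth_on p (- {0})"
    and mom: "\<And>x. x \<noteq> 0 \<Longrightarrow> laplacian u x - grad p x = convective u u x"
    and div0: "\<And>x. x \<noteq> 0 \<Longrightarrow> div_field u x = 0"
    unfolding NS_with_pressure_def by blast+
  obtain a f g where tf: "twice_differentiable f" "twice_differentiable g"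
    and per: "\<And>z. f (z + 2 * pi) = f z" "\<And>z. g (z + 2 * pi) = g z"
    and u: "\<And>x. x \<noteq> 0 \<Longrightarrow> u x = spiral_field a 0 f g x"
    using scale_invariant_is_spiral[OF smooth(1) inv] by metis
  obtain f1 f2 where f: "\<And>z. (f has_real_derivative f1 z) (at z)" "\<And>z. (f1 has_real_derivative f2 z) (at z)"
    using tf(1) unfolding twice_differentiable_def by blast
  obtain g1 g2 where g: "\<And>z. (g has_real_derivative g1 z) (at z)" "\<And>z. (g1 has_real_derivative g2 z) (at z)"
    using tf(2) unfolding twice_differentiable_def by blast
  have sp: "spiral_profiles f f1 f2 g g1 g2" by standard (fact f g per)+
  have pd: "partial_deriv i u x = partial_deriv i (spiral_field a 0 f g) x" if "x \<noteq> 0" for x i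
    by (rule partial_deriv_eq_off_origin[OF _ that]) (rule u)
  have pd2: "partial_deriv i (partial_deriv i u) x = partial_deriv i (partial_deriv i (spiral_field a 0 f g)) x"
    if "x \<noteq> 0" for x i
    by (rule partial_deriv_eq_off_origin[OF _ that]) (rule pd)
  have mom': "laplacian (spiral_field a 0 f g) x - grad p x
      = convective (spiral_field a 0 f g) (spiral_field a 0 f g) x" if x: "x \<noteq> 0" for x
    using mom[OF x] unfolding laplacian_def convective_def pd2[OF x] pd[OF x] u[OF x] .
  have div': "div_field (spiral_field a 0 f g) x = 0" if x: "x \<noteq> 0" for x
    using div0[OF x] unfolding div_field_def pd[OF x] .
  obtain k c where gk: "\<And>z. g z = k - a * f z"
    and ode: "\<And>z. (1 + a\<^sup>2) * f2 z - (k + 4 * a) * f1 z + (f z)\<^sup>2 + 4 * f z = c"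
    using spiral_NS_solution_ode[OF sp smooth(2) mom' div'] by metis
  show ?thesis
  proof (cases "\<forall>z. f1 z = 0")
    case True
    then have fc: "f z = f 0" for z using f(1) DERIV_isconst_all[of f z 0] by simp
    have "u x = hamel_velocity (2 * pi * f 0) (k - a * f 0) x" if "x \<noteq> 0" for x
    proof -
      have i: "inv_sq x = (1 / norm x) * (1 / norm x)" by (simp add: inv_sq_norm power2_eq_square)
      have n: "norm x > 0" using that by simp
      show ?thesis
        unfolding u[OF that] spiral_field_def hamel_velocity_def Let_def fc[of "spiral_coord a 0 x"] gk
          polar_components[of x] i
        by (rule vec2_eqI) (use n in \<open>simp_all add: e_r_def e_theta_def field_simps\<close>)
    qed
    then show ?thesis by blast
  next
    case False
    then have k: "k + 4 * a = 0"
      using periodic_dissipation[OF f per(1), where b = "1 + a\<^sup>2" and d = "k + 4 * a" and c = c] ode by auto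
    define q where "q = 1 + a\<^sup>2"
    have q: "q > 0" unfolding q_def by (rule one_plus_sq_pos)
    define y where "y = (\<lambda>z. - (f z + 2) / q)"
    define y' where "y' = (\<lambda>z. - f1 z / q)"
    have y1: "(y has_real_derivative y' z) (at z)" for z
      unfolding y_def y'_def using q by (auto intro!: derivative_eq_intros f)
    have y2: "(y' has_real_derivative (y z)\<^sup>2 - (c + 4) / q\<^sup>2) (at z)" for z
    proof -
      have "q * f2 z = c - (f z)\<^sup>2 - 4 * f z" using ode[of z] k by (simp add: q_def)
      then have "(f z + 2)\<^sup>2 - (c + 4) = - f2 z * q" by algebra
      moreover have "(y z)\<^sup>2 = (f z + 2)\<^sup>2 / q\<^sup>2"
        unfolding y_def by (simp add: power_divide power2_eq_square algebra_simps)
      ultimately have "(y z)\<^sup>2 - (c + 4) / q\<^sup>2 = - f2 z * q / q\<^sup>2"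
        by (simp add: diff_divide_distrib[symmetric])
      then have e: "- f2 z / q = (y z)\<^sup>2 - (c + 4) / q\<^sup>2"
        using q by (simp add: power2_eq_square)
      have "(y' has_real_derivative - f2 z / q) (at z)"
        unfolding y'_def using q by (auto intro!: derivative_eq_intros f)
      then show ?thesis unfolding e .
    qed
    have nonconst: "\<exists>b. y b \<noteq> y 0"
    proof (rule ccontr)
      assume "\<nexists>b. y b \<noteq> y 0"
      then have "f = (\<lambda>z. f 0)" using q by (auto simp: y_def fun_eq_iff)
      then have "(f has_real_derivative 0) (at z)" for z by (metis DERIV_const)
      then show False using False f(1) DERIV_unique by blast
    qed
    then obtain b where b: "y b \<noteq> y 0" by blast
    have pery: "y (z + 2 * pi) = y z" for z by (simp add: y_def per)
    obtain n m z0 where n: "n \<ge> 1" and m: "0 \<le> m" "m < 1"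
      and yc: "\<And>z. y z = (real n)\<^sup>2 * cnoidal m (real n * (z - z0))"
      using periodic_solution_is_cnoidal[OF y1 y2 pery b] by metis
    have fp: "f z = - profile a n m (z - z0)" for z
    proof -
      have "- (f z + 2) = q * y z" unfolding y_def using q by simp
      then show ?thesis unfolding profile_def yc q_def by (simp add: algebra_simps)
    qed
    define \<Phi> where "\<Phi> = - 2 * pi * (2 + (1 + a\<^sup>2) * (real n)\<^sup>2 * mean_value m)"
    note mod = modulus_unique[OF m n \<Phi>_def]
    have "u x = spiral_velocity a (profile a n (modulus n \<Phi> a)) (- z0) x" if "x \<noteq> 0" for x
    proof -
      have z: "spiral_coord a (- z0) x = spiral_coord a 0 x - z0" by (simp add: spiral_coord_def)
      have k': "k = - 4 * a" using k by simp
      show ?thesis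
        unfolding u[OF that] spiral_velocity_eq mod(2) spiral_field_def Let_def z gk fp k'
        by (simp add: algebra_simps)
    qed
    then show ?thesis using mod(1) by blast
  qed
qed

theorem theorem1:
  shows "\<exists>(\<phi> :: nat \<Rightarrow> real \<Rightarrow> real \<Rightarrow> real \<Rightarrow> real) (C :: nat \<Rightarrow> real \<Rightarrow> real \<Rightarrow> real).
    (\<forall>n \<Phi> a. admissible n \<Phi> a \<longrightarrow>
       (\<forall>z. \<phi> n \<Phi> a (z + 2 * pi / real n) = \<phi> n \<Phi> a z) \<and>
       profile_ode a (C n \<Phi> a) (\<phi> n \<Phi> a)) \<and>
    (\<forall>n \<Phi> a \<theta>\<^sub>0. admissible n \<Phi> a \<longrightarrow>
       NS_with_pressure (spiral_velocity a (\<phi> n \<Phi> a) \<theta>\<^sub>0)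
         (spiral_pressure a (C n \<Phi> a) (\<phi> n \<Phi> a) \<theta>\<^sub>0) \<and>
       scale_invariant_up_to_rotation (\<lambda>s. - a * ln s) (spiral_velocity a (\<phi> n \<Phi> a) \<theta>\<^sub>0) \<and>
       has_flux (spiral_velocity a (\<phi> n \<Phi> a) \<theta>\<^sub>0) \<Phi>) \<and>
    (\<forall>u R. NS_solution u \<and> scale_invariant_up_to_rotation R u \<longrightarrow>
       (\<exists>n \<Phi> a \<theta>\<^sub>0. admissible n \<Phi> a \<and>
          (\<forall>x. x \<noteq> 0 \<longrightarrow> u x = spiral_velocity a (\<phi> n \<Phi> a) \<theta>\<^sub>0 x)) \<or>
       (\<exists>\<Phi> \<mu>. \<forall>x. x \<noteq> 0 \<longrightarrow> u x = hamel_velocity \<Phi> \<mu> x))"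
proof (rule exI[of _ "\<lambda>n \<Phi> a. profile a n (modulus n \<Phi> a)"],
    rule exI[of _ "\<lambda>n \<Phi> a. profile_const a n (modulus n \<Phi> a)"], intro conjI allI impI)
  fix u R assume "NS_solution u \<and> scale_invariant_up_to_rotation R u"
  then show "(\<exists>n \<Phi> a \<theta>\<^sub>0. admissible n \<Phi> a \<and>
       (\<forall>x. x \<noteq> 0 \<longrightarrow> u x = spiral_velocity a (profile a n (modulus n \<Phi> a)) \<theta>\<^sub>0 x)) \<or>
     (\<exists>\<Phi> \<mu>. \<forall>x. x \<noteq> 0 \<longrightarrow> u x = hamel_velocity \<Phi> \<mu> x)"
    using scale_invariant_solution_cases by blast
qed (fact spiral_solution_properties)+

end
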